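(* Let $n\in\mathbb{N}$ and let $K\subset\mathbb{Z}^n_+$ be an arbitrary admissible finite set such that $$(\mathrm{Ext}\,K)\setminus K\subseteq\partial(\mathrm{Ext}\,K).$$ Set $\mathcal{K}=K+K$ and $\mathcal{K}'=\mathrm{Ext}\,K+\mathrm{Ext}\,K$. Let the truncated moment problem $$\int\mathbf{t}^{\mathbf{k}}\,d\mu(\mathbf{t})=s_{\mathbf{k}},\qquad\mathbf{k}\in\mathcal{K},$$ with some prescribed real moments $\mathcal{S}=(s_{\mathbf{k}})_{\mathbf{k}\in\mathcal{K}}$ be given, and suppose that (with some indexation of $K$) the conditions $\Gamma\ge0$ and $\operatorname{Ker}\Gamma_l\subseteq\operatorname{Ker}\widehat\Gamma_l$, $l=1,\dots,n$, are satisfied for $\mathcal{S}$. Fix a continuation of the indexation of $K$ to $\mathrm{Ext}\,K$. Then there exists a one-to-one correspondence (bijection) between the set of all canonical solutions of this moment problem and the set of all dimensionally stable sets $\widehat{\mathcal{S}}=(\widehat s_{\mathbf{k}})_{\mathbf{k}\in\mathcal{K}'}$ with $\widehat s_{\mathbf{k}}\in\mathbb{R}$ for $\mathbf{k}\in\mathcal{K}'$ and $\widehat s_{\mathbf{m}}=s_{\mathbf{m}}$ for $\mathbf{m}\in\mathcal{K}$. Here it is assumed that each $\widehat{\mathcal{S}}$ in the latter set satisfies the analogous conditions ($\Gamma\ge0$ and $\operatorname{Ker}\Gamma_l\subseteq\operatorname{Ker}\widehat\Gamma_l$, $l=1,\dots,n$, formed with $\mathrm{Ext}\,K$ and $\widehat{\mathcal{S}}$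 in place of $K$ and $\mathcal{S}$, with the fixed indexation of $\mathrm{Ext}\,K$).
   Context: Notation: $\mathbb{Z}_+$ is the set of non-negative integers; for $\mathbf{k}=(k_1,\dots,k_n)\in\mathbb{Z}^n_+$ and $\mathbf{t}=(t_1,\dots,t_n)\in\mathbb{R}^n$, $\mathbf{t}^{\mathbf{k}}=t_1^{k_1}\cdots t_n^{k_n}$ and $|\mathbf{k}|=k_1+\dots+k_n$; $\vec e_l\in\mathbb{Z}^n_+$ is the $l$-th standard unit vector; $\mathfrak{B}(\mathbb{R}^n)$ is the Borel $\sigma$-algebra. A solution of the moment problem is a non-negative measure $\mu$ on $\mathfrak{B}(\mathbb{R}^n)$ satisfying the displayed equalities. Admissible set: a finite set $K\subset\mathbb{Z}^n_+$ is admissible if $\mathbf{0}\in K$ and every $\mathbf{k}\in K\setminus\{\mathbf{0}\}$ can be written as $\mathbf{k}=\vec e_{a_1}+\dots+\vec e_{a_{|\mathbf{k}|}}$ with some $a_j\in\{1,\dots,n\}$ such that all partial sums $\vec e_{a_1}+\dots+\vec e_{a_q}$, $q=1,\dots,|\mathbf{k}|$, belong to $K$. Close extension and border: for an admissible finite $K$, the close extension is $\mathrm{Ext}\,K=K\cup\bigcup_{j=1}^n(K+\vec e_j)$ (it is again an admissible finite set), and the border is $\partial K=\{\mathbf{m}\in K:\ \exists j\in\{1,\dots,n\}\text{ such that }\mathbf{m}+\vec e_j\notin K\}$. Indexation and matrices (for an admissible finite set $K$ and moments $\mathcal{S}$ indexed by $K+K$): write $K=\{\mathbf{k}_j: j=0,1,\dots,\rho\}$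 (distinct elements). For $l=1,\dots,n$ put $\Omega_l=\{j\in\{0,\dots,\rho\}:\mathbf{k}_j+\vec e_l\in K\}$, and put $\Omega_0=\{j\in\{0,\dots,\rho\}:\mathbf{k}_j+\vec e_1,\dots,\mathbf{k}_j+\vec e_n\in K\}$. Define $$\Gamma=(s_{\mathbf{k}_j+\mathbf{k}_m})_{m,j=0}^{\rho},\quad \Gamma_l=(s_{\mathbf{k}_j+\mathbf{k}_m})_{m,j\in\Omega_l},\quad \widehat\Gamma_l=(s_{\mathbf{k}_j+\vec e_l+\mathbf{k}_m+\vec e_l})_{m,j\in\Omega_l},\quad l=1,\dots,n,$$ with indices from $\Omega_l$ taken in increasing order. $\Gamma\ge0$ means positive semidefinite. A continuation of the indexation of $K$ to $\mathrm{Ext}\,K$ is an indexation $\mathrm{Ext}\,K=\{\mathbf{k}_j:j=0,\dots,\widehat\rho\}$ whose first $\rho+1$ elements are the given $\mathbf{k}_0,\dots,\mathbf{k}_\rho$. Associated Hilbert space: let $\mathfrak{L}$ be the complex vector space of polynomials $p(\mathbf{t})=\sum_{j=0}^{\rho}\alpha_j\mathbf{t}^{\mathbf{k}_j}$, $\alpha_j\in\mathbb{C}$, with the sesquilinear form $\langle p,q\rangle=\sum_{j,m=0}^{\rho}\alpha_j\overline{\beta_m}s_{\mathbf{k}_j+\mathbf{k}_m}$ for $q=\sum_{j=0}^\rho\beta_j\mathbf{t}^{\mathbf{k}_j}$. Since $\Gamma\ge0$, this form is positive semidefinite; $H$ is the finite-dimensional Hilbert space obtained as the quotient of $\mathfrak{L}$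 by the null space of the form, and $[p]$ denotes the class of $p$. Operators: for $l=1,\dots,n$, $M_l$ is the linear operator in $H$ with domain $D(M_l)=\operatorname{Lin}\{[\mathbf{t}^{\mathbf{k}_j}]\}_{j\in\Omega_l}$ given by $M_l\sum_{j\in\Omega_l}\alpha_j[\mathbf{t}^{\mathbf{k}_j}]=\sum_{j\in\Omega_l}\alpha_j[\mathbf{t}^{\mathbf{k}_j+\vec e_l}]$, $\alpha_j\in\mathbb{C}$; it is well defined because of the kernel conditions, it is symmetric, and it may be defined only on a proper subspace of $H$. Let $H_0=\operatorname{Lin}\{[\mathbf{t}^{\mathbf{k}_j}]\}_{j\in\Omega_0}$. Dimensional stability: $\mathcal{S}$ is dimensionally stable if $\dim H=\dim H_0$. For $\widehat{\mathcal{S}}=(\widehat s_{\mathbf{k}})_{\mathbf{k}\in\mathcal{K}'}$ all these objects are formed with $\mathrm{Ext}\,K$ in place of $K$ and $\widehat{\mathcal{S}}$ in place of $\mathcal{S}$. Canonical solution: a solution $\mu$ of the moment problem with data $\mathcal{S}$ is canonical if there exist pairwise commuting self-adjoint operators $\widetilde M_1,\dots,\widetilde M_n$ on the associated Hilbert space $H$ of $\mathcal{S}$ with $\widetilde M_j\supseteq M_j$ ($j=1,\dots,n$) such that $\mu(\delta)=(E(\delta)[1],[1])_H$ for all $\delta\in\mathfrak{B}(\mathbb{R}^n)$, where $E$ is the joint spectral measure of the commuting tuple $\widetilde M_1,\dots,\widetilde M_n$. *)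

theory Defs
  imports
    "HOL-Analysis.Analysis"
    "HOL-Library.Poly_Mapping"
    "HOL-Library.Set_Algebras"
    "HOL-Library.Nonpos_Ints"
begin

hide_const (open) Poly_Mapping.degree Poly_Mapping.range Poly_Mapping.map

text \<open>
  Multi-indices are elements of \<open>nat ^ 'n\<close>, so \<open>n\<close> is the cardinality of the finite nonempty type
  \<open>'n\<close>; the unit vectors are \<open>axis l 1\<close>, and \<open>K + K\<close> is the Minkowski sum of
  \<^theory>\<open>HOL-Library.Set_Algebras\<close>.
\<close>

section \<open>Index sets\<close>

definition admissible :: "(nat ^ 'n::finite) set \<Rightarrow> bool" where
  "admissible K \<longleftrightarrow> finite K \<and> 0 \<in> K \<and>
     (\<forall>k \<in> K - {0}. \<exists>a :: nat \<Rightarrow> 'n.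
        k = (\<Sum>j = 1..(\<Sum>i\<in>UNIV. k $ i). axis (a j) 1) \<and>
        (\<forall>q \<in> {1..(\<Sum>i\<in>UNIV. k $ i)}. (\<Sum>j = 1..q. axis (a j) 1) \<in> K))"

definition Ext :: "(nat ^ 'n::finite) set \<Rightarrow> (nat ^ 'n) set" where
  "Ext K = K \<union> (\<Union>j. K + {axis j 1})"

definition border :: "(nat ^ 'n::finite) set \<Rightarrow> (nat ^ 'n) set" where
  "border K = {m \<in> K. \<exists>j. m + axis j 1 \<notin> K}"

section \<open>The truncated moment problem\<close>

definition moment_solution ::
    "(nat ^ 'n::finite) set \<Rightarrow> (nat ^ 'n \<Rightarrow> real) \<Rightarrow> (real ^ 'n) measure \<Rightarrow> bool" where
  "moment_solution KK s \<mu> \<longleftrightarrow> sets \<mu> = sets borel \<and>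
     (\<forall>k \<in> KK. has_bochner_integral \<mu> (\<lambda>t. \<Prod>i\<in>UNIV. (t $ i) ^ (k $ i)) (s k))"

section \<open>Indexation and moment matrices\<close>

text \<open>
  An indexation of \<open>K\<close> is a map \<open>k\<close> that is a bijection from \<open>{..\<rho>}\<close> onto \<open>K\<close>.  A matrix whose rows
  and columns are labelled by \<open>J \<subseteq> {..\<rho>}\<close> is a function \<open>nat \<Rightarrow> nat \<Rightarrow> real\<close> considered on
  \<open>J \<times> J\<close> only, and vectors indexed by \<open>J\<close> are elements of \<open>J \<rightarrow>\<^sub>E UNIV\<close>.
\<close>

definition Omega :: "(nat \<Rightarrow> nat ^ 'n::finite) \<Rightarrow> nat \<Rightarrow> 'n \<Rightarrow> nat set" where
  "Omega k \<rho> l = {j \<in> {..\<rho>}. k j + axis l 1 \<in> k ` {..\<rho>}}"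

definition Omega0 :: "(nat \<Rightarrow> nat ^ 'n::finite) \<Rightarrow> nat \<Rightarrow> nat set" where
  "Omega0 k \<rho> = {j \<in> {..\<rho>}. \<forall>l. k j + axis l 1 \<in> k ` {..\<rho>}}"

definition Gam :: "(nat \<Rightarrow> nat ^ 'n::finite) \<Rightarrow> (nat ^ 'n \<Rightarrow> real) \<Rightarrow> nat \<Rightarrow> nat \<Rightarrow> real" where
  "Gam k s m j = s (k j + k m)"

definition Gam_hat ::
    "(nat \<Rightarrow> nat ^ 'n::finite) \<Rightarrow> (nat ^ 'n \<Rightarrow> real) \<Rightarrow> 'n \<Rightarrow> nat \<Rightarrow> nat \<Rightarrow> real" where
  "Gam_hat k s l m j = s ((k j + axis l 1) + (k m + axis l 1))"

definition psd_on :: "nat set \<Rightarrow> (nat \<Rightarrow> nat \<Rightarrow> real) \<Rightarrow> bool" where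
  "psd_on J A \<longleftrightarrow> (\<forall>x :: nat \<Rightarrow> complex.
     (\<Sum>m\<in>J. \<Sum>j\<in>J. cnj (x m) * of_real (A m j) * x j) \<in> \<real>\<^sub>\<ge>\<^sub>0)"

definition Ker_on :: "nat set \<Rightarrow> (nat \<Rightarrow> nat \<Rightarrow> real) \<Rightarrow> (nat \<Rightarrow> complex) set" where
  "Ker_on J A = {x \<in> J \<rightarrow>\<^sub>E UNIV. \<forall>m\<in>J. (\<Sum>j\<in>J. of_real (A m j) * x j) = 0}"

definition moment_conditions ::
    "(nat \<Rightarrow> nat ^ 'n::finite) \<Rightarrow> nat \<Rightarrow> (nat ^ 'n \<Rightarrow> real) \<Rightarrow> bool" where
  "moment_conditions k \<rho> s \<longleftrightarrow> psd_on {..\<rho>} (Gam k s) \<and>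
     (\<forall>l. Ker_on (Omega k \<rho> l) (Gam k s) \<subseteq> Ker_on (Omega k \<rho> l) (Gam_hat k s l))"

section \<open>The associated Hilbert space\<close>

text \<open>
  Polynomials in \<open>n\<close> variables with complex coefficients are finitely supported functions on
  multi-indices, with multiplication the usual one (convolution); \<open>single k c\<close> is the monomial
  \<open>c t\<^sup>k\<close>.  The Hilbert space consists of the cosets \<open>p +o null_space\<close>.
\<close>

type_synonym 'n mpol = "(nat ^ 'n) \<Rightarrow>\<^sub>0 complex"

definition Lin_monomials :: "(nat \<Rightarrow> nat ^ 'n::finite) \<Rightarrow> nat set \<Rightarrow> 'n mpol set" where
  "Lin_monomials k J = {\<Sum>j\<in>J. Poly_Mapping.single (k j) (\<alpha> j) | \<alpha>. True}"

definition form ::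
    "(nat \<Rightarrow> nat ^ 'n::finite) \<Rightarrow> nat \<Rightarrow> (nat ^ 'n \<Rightarrow> real) \<Rightarrow> 'n mpol \<Rightarrow> 'n mpol \<Rightarrow> complex" where
  "form k \<rho> s p q = (\<Sum>j\<le>\<rho>. \<Sum>m\<le>\<rho>.
     Poly_Mapping.lookup p (k j) * cnj (Poly_Mapping.lookup q (k m)) * of_real (s (k j + k m)))"

definition null_space ::
    "(nat \<Rightarrow> nat ^ 'n::finite) \<Rightarrow> nat \<Rightarrow> (nat ^ 'n \<Rightarrow> real) \<Rightarrow> 'n mpol set" where
  "null_space k \<rho> s = {p \<in> Lin_monomials k {..\<rho>}. form k \<rho> s p p = 0}"

definition cls ::
    "(nat \<Rightarrow> nat ^ 'n::finite) \<Rightarrow> nat \<Rightarrow> (nat ^ 'n \<Rightarrow> real) \<Rightarrow> 'n mpol \<Rightarrow> 'n mpol set" where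
  "cls k \<rho> s p = p +o null_space k \<rho> s"

definition Hilb ::
    "(nat \<Rightarrow> nat ^ 'n::finite) \<Rightarrow> nat \<Rightarrow> (nat ^ 'n \<Rightarrow> real) \<Rightarrow> 'n mpol set set" where
  "Hilb k \<rho> s = cls k \<rho> s ` Lin_monomials k {..\<rho>}"

text \<open>
  The sum of two cosets is their Minkowski sum.  In scalar multiples and linear combinations the null
  space is added once more, because \<open>0 *o x = {0}\<close> and the empty sum of sets is \<open>{0}\<close>.
\<close>

definition hscale ::
    "(nat \<Rightarrow> nat ^ 'n::finite) \<Rightarrow> nat \<Rightarrow> (nat ^ 'n \<Rightarrow> real) \<Rightarrow> complex \<Rightarrow> 'n mpol set \<Rightarrow> 'n mpol set"
  where
  "hscale k \<rho> s c x = null_space k \<rho> s + Poly_Mapping.single 0 c *o x"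

definition hlincomb ::
    "(nat \<Rightarrow> nat ^ 'n::finite) \<Rightarrow> nat \<Rightarrow> (nat ^ 'n \<Rightarrow> real) \<Rightarrow> 'n mpol set set \<Rightarrow>
      ('n mpol set \<Rightarrow> complex) \<Rightarrow> 'n mpol set" where
  "hlincomb k \<rho> s B c = null_space k \<rho> s + (\<Sum>b\<in>B. hscale k \<rho> s (c b) b)"

text \<open>
  For \<open>\<Gamma> \<ge> 0\<close> the value of the form does not depend on the representatives.
\<close>

definition hinner ::
    "(nat \<Rightarrow> nat ^ 'n::finite) \<Rightarrow> nat \<Rightarrow> (nat ^ 'n \<Rightarrow> real) \<Rightarrow> 'n mpol set \<Rightarrow> 'n mpol set \<Rightarrow> complex"
  where
  "hinner k \<rho> s x y = form k \<rho> s (SOME p. p \<in> x) (SOME q. q \<in> y)"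

definition hbasis ::
    "(nat \<Rightarrow> nat ^ 'n::finite) \<Rightarrow> nat \<Rightarrow> (nat ^ 'n \<Rightarrow> real) \<Rightarrow> 'n mpol set set \<Rightarrow> 'n mpol set set \<Rightarrow> bool"
  where
  "hbasis k \<rho> s V B \<longleftrightarrow> finite B \<and> B \<subseteq> V \<and>
     (\<forall>c. hlincomb k \<rho> s B c = cls k \<rho> s 0 \<longrightarrow> (\<forall>b\<in>B. c b = 0)) \<and>
     V = {hlincomb k \<rho> s B c | c. True}"

definition hdim ::
    "(nat \<Rightarrow> nat ^ 'n::finite) \<Rightarrow> nat \<Rightarrow> (nat ^ 'n \<Rightarrow> real) \<Rightarrow> 'n mpol set set \<Rightarrow> nat" where
  "hdim k \<rho> s V = card (SOME B. hbasis k \<rho> s V B)"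

text \<open>
  \<open>Hilb_Lin k \<rho> s J\<close> is the span of the classes of the monomials with index in \<open>J\<close>.
\<close>

definition Hilb_Lin ::
    "(nat \<Rightarrow> nat ^ 'n::finite) \<Rightarrow> nat \<Rightarrow> (nat ^ 'n \<Rightarrow> real) \<Rightarrow> nat set \<Rightarrow> 'n mpol set set" where
  "Hilb_Lin k \<rho> s J = cls k \<rho> s ` Lin_monomials k J"

definition dimensionally_stable ::
    "(nat \<Rightarrow> nat ^ 'n::finite) \<Rightarrow> nat \<Rightarrow> (nat ^ 'n \<Rightarrow> real) \<Rightarrow> bool" where
  "dimensionally_stable k \<rho> s \<longleftrightarrow>
     hdim k \<rho> s (Hilb k \<rho> s) = hdim k \<rho> s (Hilb_Lin k \<rho> s (Omega0 k \<rho>))"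

section \<open>Operators and canonical solutions\<close>

text \<open>
  The operator \<open>M\<^sub>l\<close>, with domain \<open>Hilb_Lin k \<rho> s (Omega k \<rho> l)\<close>: choose a representative in the span
  of the monomials with index in \<open>\<Omega>\<^sub>l\<close> and multiply it by the variable \<open>t\<^sub>l\<close>.  By the kernel condition
  the result does not depend on the choice.
\<close>

definition M_op ::
    "(nat \<Rightarrow> nat ^ 'n::finite) \<Rightarrow> nat \<Rightarrow> (nat ^ 'n \<Rightarrow> real) \<Rightarrow> 'n \<Rightarrow> 'n mpol set \<Rightarrow> 'n mpol set" where
  "M_op k \<rho> s l x = cls k \<rho> s (Poly_Mapping.single (axis l 1) 1 *
     (SOME p. p \<in> Lin_monomials k (Omega k \<rho> l) \<and> cls k \<rho> s p = x))"

text \<open>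
  A self-adjoint operator is densely defined, and the only dense subspace of a finite-dimensional
  Hilbert space is the whole space.
\<close>

definition selfadjoint_op ::
    "(nat \<Rightarrow> nat ^ 'n::finite) \<Rightarrow> nat \<Rightarrow> (nat ^ 'n \<Rightarrow> real) \<Rightarrow> ('n mpol set \<Rightarrow> 'n mpol set) \<Rightarrow> bool"
  where
  "selfadjoint_op k \<rho> s A \<longleftrightarrow>
     (\<forall>x\<in>Hilb k \<rho> s. A x \<in> Hilb k \<rho> s) \<and>
     (\<forall>x\<in>Hilb k \<rho> s. \<forall>y\<in>Hilb k \<rho> s. A (x + y) = A x + A y) \<and>
     (\<forall>c. \<forall>x\<in>Hilb k \<rho> s. A (hscale k \<rho> s c x) = hscale k \<rho> s c (A x)) \<and>
     (\<forall>x\<in>Hilb k \<rho> s. \<forall>y\<in>Hilb k \<rho> s. hinner k \<rho> s (A x) y = hinner k \<rho> s x (A y))"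

definition spectral_measure ::
    "(nat \<Rightarrow> nat ^ 'n::finite) \<Rightarrow> nat \<Rightarrow> (nat ^ 'n \<Rightarrow> real) \<Rightarrow>
      ((real ^ 'n) set \<Rightarrow> 'n mpol set \<Rightarrow> 'n mpol set) \<Rightarrow> bool" where
  "spectral_measure k \<rho> s E \<longleftrightarrow>
     (\<forall>\<delta>\<in>sets borel. selfadjoint_op k \<rho> s (E \<delta>) \<and>
        (\<forall>x\<in>Hilb k \<rho> s. E \<delta> (E \<delta> x) = E \<delta> x)) \<and>
     (\<forall>x\<in>Hilb k \<rho> s. E UNIV x = x) \<and>
     (\<forall>\<delta>\<in>sets borel. \<forall>\<delta>'\<in>sets borel. \<forall>x\<in>Hilb k \<rho> s. E (\<delta> \<inter> \<delta>') x = E \<delta> (E \<delta>' x)) \<and>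
     (\<forall>D :: nat \<Rightarrow> (real ^ 'n) set. range D \<subseteq> sets borel \<longrightarrow> disjoint_family D \<longrightarrow>
        (\<forall>x\<in>Hilb k \<rho> s. \<forall>y\<in>Hilb k \<rho> s.
           (\<lambda>i. hinner k \<rho> s (E (D i) x) y) sums hinner k \<rho> s (E (\<Union>i. D i) x) y))"

text \<open>The scalar measure \<open>\<delta> \<mapsto> (E(\<delta>)x, x)\<close>.\<close>

definition scalar_measure ::
    "(nat \<Rightarrow> nat ^ 'n::finite) \<Rightarrow> nat \<Rightarrow> (nat ^ 'n \<Rightarrow> real) \<Rightarrow>
      ((real ^ 'n) set \<Rightarrow> 'n mpol set \<Rightarrow> 'n mpol set) \<Rightarrow> 'n mpol set \<Rightarrow> (real ^ 'n) measure" where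
  "scalar_measure k \<rho> s E x =
     measure_of UNIV (sets borel) (\<lambda>\<delta>. ennreal (Re (hinner k \<rho> s (E \<delta> x) x)))"

text \<open>
  \<open>E\<close> is the joint spectral measure of a tuple \<open>A\<close> of commuting self-adjoint operators if
  \<open>A\<^sub>l = \<integral> t\<^sub>l dE\<close> for every \<open>l\<close>.  The domain of this integral, the set of \<open>x\<close> with
  \<open>\<integral> t\<^sub>l\<^sup>2 d(Ex,x) < \<infinity>\<close>, is the whole space, and by polarization the operator is determined by its
  quadratic form.
\<close>

definition joint_spectral_measure ::
    "(nat \<Rightarrow> nat ^ 'n::finite) \<Rightarrow> nat \<Rightarrow> (nat ^ 'n \<Rightarrow> real) \<Rightarrow> ('n \<Rightarrow> 'n mpol set \<Rightarrow> 'n mpol set) \<Rightarrow>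
      ((real ^ 'n) set \<Rightarrow> 'n mpol set \<Rightarrow> 'n mpol set) \<Rightarrow> bool" where
  "joint_spectral_measure k \<rho> s A E \<longleftrightarrow> spectral_measure k \<rho> s E \<and>
     (\<forall>l. \<forall>x\<in>Hilb k \<rho> s.
        integrable (scalar_measure k \<rho> s E x) (\<lambda>t. (t $ l)\<^sup>2) \<and>
        hinner k \<rho> s (A l x) x = of_real (\<integral>t. t $ l \<partial>scalar_measure k \<rho> s E x))"

definition canonical_solution ::
    "(nat \<Rightarrow> nat ^ 'n::finite) \<Rightarrow> nat \<Rightarrow> (nat ^ 'n \<Rightarrow> real) \<Rightarrow> (real ^ 'n) measure \<Rightarrow> bool" where
  "canonical_solution k \<rho> s \<mu> \<longleftrightarrow>
     moment_solution (k ` {..\<rho>} + k ` {..\<rho>}) s \<mu> \<and>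
     (\<exists>A E.
        (\<forall>l. selfadjoint_op k \<rho> s (A l)) \<and>
        (\<forall>i j. \<forall>x\<in>Hilb k \<rho> s. A i (A j x) = A j (A i x)) \<and>
        (\<forall>l. \<forall>x\<in>Hilb_Lin k \<rho> s (Omega k \<rho> l). A l x = M_op k \<rho> s l x) \<and>
        joint_spectral_measure k \<rho> s A E \<and>
        (\<forall>\<delta>\<in>sets borel.
           of_real (measure \<mu> \<delta>) = hinner k \<rho> s (E \<delta> (cls k \<rho> s 1)) (cls k \<rho> s 1)))"

end

theory Submission
  imports Defs "HOL-Computational_Algebra.Fundamental_Theorem_Algebra"
begin

text \<open>
  A canonical solution is the distribution, in the state \<open>[1]\<close>, of commuting self-adjoint extensions
  \<open>T\<^sub>l\<close> of the multiplication operators \<open>M\<^sub>l\<close> on the space \<open>H\<close> of \<open>(k, \<rho>, s)\<close>.  The bijection sends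
  such a measure \<open>\<mu>\<close> to its moments on \<open>Ext K + Ext K\<close>.  Everything rests on the vectors
  \<open>X u = T\<^sup>u [1]\<close>: they satisfy \<open>\<langle>X u, X v\<rangle> = \<integral> t\<^sup>u\<^sup>+\<^sup>v d\<mu>\<close> for all multi-indices \<open>u, v\<close>
  (\<open>moment_vectors\<close>), and \<open>X u\<close> is the class of the monomial \<open>t\<^sup>u\<close> when \<open>u \<in> K\<close>, because an
  admissible set can be climbed from \<open>0\<close> in unit steps inside the domains of the \<open>M\<^sub>l\<close>
  (\<open>mono_eqv_moment_vector\<close>).

  The moments of \<open>\<mu>\<close> form an admitted data set (\<open>canonical_solution_moments\<close>): they are a Gram matrix
  of the vectors \<open>X u\<close>, \<open>u \<in> Ext K\<close>, on which \<open>T\<^sub>l\<close> acts as the shift \<open>u \<mapsto> u + e\<^sub>l\<close>.  This gives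
  positivity and the kernel conditions; and since every \<open>X u\<close> lies in \<open>H\<close>, the extended space is
  already spanned by the monomials with exponents in \<open>K\<close>, which is dimensional stability.

  The map is injective (\<open>canonical_solution_unique\<close>): for \<open>u, v \<in> K\<close> the number
  \<open>\<langle>T\<^sub>l t\<^sup>u, t\<^sup>v\<rangle>\<close> is the moment at \<open>u + e\<^sub>l + v \<in> Ext K + Ext K\<close>.  So the moments determine the
  operators, and the operators determine their joint spectral measure (\<open>scal_measure_unique\<close>).

  The map is surjective (\<open>canonical_solution_exists\<close>): by the border hypothesis the set \<open>\<Omega>\<^sub>0\<close> of
  \<open>Ext K\<close> is exactly the index set of \<open>K\<close>.  Hence dimensional stability says that \<open>t\<^sub>l p\<close>, for \<open>p\<close> over
  \<open>K\<close>, agrees with a polynomial over \<open>K\<close> up to a null vector of the extended form, and this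
  polynomial is taken as \<open>T\<^sub>l p\<close>.  Symmetry and commutativity are read off from the extended form, for
  example \<open>\<langle>T\<^sub>i T\<^sub>j p, q\<rangle> = \<langle>t\<^sub>j p, t\<^sub>i q\<rangle>\<close> is symmetric in \<open>i\<close> and \<open>j\<close>.

  The quotient by null vectors is avoided: all linear algebra is done with polynomials up to the
  relation \<open>\<doteq>\<close> of having the same products with all vectors, and results are
  transferred to the cosets only where the definitions mention them.
\<close>

section \<open>Positive semidefinite sesquilinear forms\<close>

locale semidefinite_form = vs: vector_space scale
  for scale :: "complex \<Rightarrow> 'a::ab_group_add \<Rightarrow> 'a" (infixr "\<odot>" 75) +
  fixes ip :: "'a \<Rightarrow> 'a \<Rightarrow> complex"
  assumes ip_add_left: "ip (x + y) z = ip x z + ip y z"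
    and ip_scale_left: "ip (c \<odot> x) y = c * ip x y"
    and ip_commute: "ip y x = cnj (ip x y)"
    and ip_nonneg: "0 \<le> Re (ip x x)"
begin

lemma ip_add_right: "ip x (y + z) = ip x y + ip x z"
  by (metis complex_cnj_add ip_add_left ip_commute)

lemma ip_scale_right: "ip x (c \<odot> y) = cnj c * ip x y"
  by (metis complex_cnj_mult ip_commute ip_scale_left)

lemma ip_zero_left [simp]: "ip 0 y = 0"
  using ip_add_left[of 0 0 y] by simp

lemma ip_zero_right [simp]: "ip x 0 = 0"
  using ip_add_right[of x 0 0] by simp

lemma ip_diff_left: "ip (x - y) z = ip x z - ip y z"
  using ip_add_left[of "x - y" y z] by simp

lemma ip_diff_right: "ip x (y - z) = ip x y - ip x z"
  using ip_add_right[of x "y - z" z] by simp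

lemma ip_sum_left: "ip (sum f A) y = (\<Sum>i\<in>A. ip (f i) y)"
  by (induction A rule: infinite_finite_induct) (auto simp: ip_add_left)

lemma ip_sum_right: "ip x (sum f A) = (\<Sum>i\<in>A. ip x (f i))"
  by (induction A rule: infinite_finite_induct) (auto simp: ip_add_right)

lemma ip_self_real: "ip x x = of_real (Re (ip x x))"
  using ip_commute[of x x] by (simp add: complex_eq_iff)

text \<open>
  Equality modulo null vectors.  This formulation makes congruence rules immediate; by the
  Cauchy-Schwarz inequality it amounts to \<open>ip (x - y) (x - y) = 0\<close>.
\<close>

definition eqv :: "'a \<Rightarrow> 'a \<Rightarrow> bool" (infix "\<doteq>" 50) where
  "x \<doteq> y \<longleftrightarrow> (\<forall>z. ip x z = ip y z)"

text \<open>
  Otherwise moving from \<open>y\<close> in the direction of \<open>x\<close> changes the square of the norm linearly, and it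
  becomes negative.
\<close>

lemma isotropic_imp_orthogonal:
  assumes "ip x x = 0"
  shows "ip x y = 0"
proof (rule ccontr)
  define z where "z = ip x y"
  \<comment> \<open>the step that brings the square of the norm down to \<open>-1\<close>\<close>
  define r where "r = (Re (ip y y) + 1) / (2 * (cmod z)\<^sup>2)"
  assume "ip x y \<noteq> 0"
  then have z: "z \<noteq> 0" by (simp add: z_def)
  define c where "c = - of_real r * cnj z"
  have "ip (c \<odot> x + y) (c \<odot> x + y) = c * z + cnj (c * z) + ip y y"
    using assms ip_commute[of y x]
    by (simp add: ip_add_left ip_add_right ip_scale_left ip_scale_right z_def)
  also have "c * z = - of_real (r * (cmod z)\<^sup>2)"
    unfolding of_real_mult complex_norm_square by (simp add: c_def mult.commute[of z])
  finally have "Re (ip (c \<odot> x + y) (c \<odot> x + y)) = - 2 * (r * (cmod z)\<^sup>2) + Re (ip y y)"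
    by simp
  also have "\<dots> = -1" using z by (simp add: r_def field_simps)
  finally show False using ip_nonneg[of "c \<odot> x + y"] by simp
qed

lemma eqv_iff: "x \<doteq> y \<longleftrightarrow> ip (x - y) (x - y) = 0"
  unfolding eqv_def using isotropic_imp_orthogonal[of "x - y"]
  by (metis eq_iff_diff_eq_0 ip_diff_left)

lemma eqv_zero_iff: "x \<doteq> 0 \<longleftrightarrow> ip x x = 0"
  using eqv_iff[of x 0] by simp

lemma eqv_diff_zero_iff: "x \<doteq> y \<longleftrightarrow> x - y \<doteq> 0"
  by (simp add: eqv_iff)

lemma eqv_refl [simp]: "x \<doteq> x"
  and eqv_sym: "x \<doteq> y \<Longrightarrow> y \<doteq> x"
  and eqv_trans [trans]: "x \<doteq> y \<Longrightarrow> y \<doteq> z \<Longrightarrow> x \<doteq> z"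
  by (auto simp: eqv_def)

lemma eqv_add: "x \<doteq> y \<Longrightarrow> x' \<doteq> y' \<Longrightarrow> x + x' \<doteq> y + y'"
  and eqv_scale: "x \<doteq> y \<Longrightarrow> c \<odot> x \<doteq> c \<odot> y"
  by (auto simp: eqv_def ip_add_left ip_diff_left ip_scale_left)

lemma eqv_sum: "(\<And>i. i \<in> A \<Longrightarrow> f i \<doteq> g i) \<Longrightarrow> sum f A \<doteq> sum g A"
  by (auto simp: eqv_def ip_sum_left intro!: sum.cong)

lemma eqv_ip: "x \<doteq> x' \<Longrightarrow> y \<doteq> y' \<Longrightarrow> ip x y = ip x' y'"
  by (metis eqv_def ip_commute)

lemma subspace_eqv_zero: "vs.subspace {x. x \<doteq> 0}"
  by (auto simp: vs.subspace_def eqv_def ip_add_left ip_scale_left)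

abbreviation lin :: "('a \<Rightarrow> 'a) \<Rightarrow> bool" where "lin \<equiv> Vector_Spaces.linear scale scale"

sublocale vsp: vector_space_pair scale scale ..

lemmas lin_add = vsp.linear_add
lemmas lin_scale = vsp.linear_scale
lemmas lin_sum = vsp.linear_sum
lemmas lin_diff = vsp.linear_diff
lemmas lin_zero = vsp.linear_0

lemma lin_compose: "lin f \<Longrightarrow> lin g \<Longrightarrow> lin (\<lambda>x. f (g x))"
  using Vector_Spaces.linear_compose[of scale scale g scale f] by (simp add: o_def)

text \<open>
  Choosing representatives of classes gives maps that are linear only up to null vectors.  Extending
  linearly from the values on a basis replaces such a map by an equivalent linear one.
\<close>

lemma linear_lift:
  assumes U: "vs.subspace U" and W: "vs.subspace W"
    and f: "\<And>x. x \<in> U \<Longrightarrow> f x \<in> W"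
    and add: "\<And>x y. x \<in> U \<Longrightarrow> y \<in> U \<Longrightarrow> f (x + y) \<doteq> f x + f y"
    and scale: "\<And>c x. x \<in> U \<Longrightarrow> f (c \<odot> x) \<doteq> c \<odot> f x"
  obtains g where "lin g" "\<And>x. g x \<in> W" "\<And>x. x \<in> U \<Longrightarrow> g x \<doteq> f x"
proof -
  obtain B where B: "B \<subseteq> U" "vs.independent B" "U \<subseteq> vs.span B"
    using vs.maximal_independent_subset[of U] by auto
  obtain g where g: "lin g" "\<forall>x\<in>B. g x = f x" "range g = vs.span (f ` B)"
    using vsp.linear_independent_extend_subspace[OF B(2), of f] by auto
  have "vs.span (f ` B) \<subseteq> W" using B f by (intro vs.span_minimal W) auto
  then have gW: "g x \<in> W" for x using g(3) by auto
  have f0: "f 0 \<doteq> 0" using scale[of 0 0] vs.subspace_0[OF U] by simp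
  have "vs.subspace {x \<in> U. g x \<doteq> f x}"
    unfolding vs.subspace_def
  proof (intro conjI ballI allI)
    show "0 \<in> {x \<in> U. g x \<doteq> f x}"
      using f0 U by (auto simp: lin_zero[OF g(1)] vs.subspace_0 intro: eqv_sym)
    show "x + y \<in> {x \<in> U. g x \<doteq> f x}" if "x \<in> {x \<in> U. g x \<doteq> f x}" "y \<in> {x \<in> U. g x \<doteq> f x}" for x y
      using that U eqv_trans[OF eqv_add eqv_sym[OF add]]
      by (auto simp: lin_add[OF g(1)] vs.subspace_add)
    show "c \<odot> x \<in> {x \<in> U. g x \<doteq> f x}" if "x \<in> {x \<in> U. g x \<doteq> f x}" for c x
      using that U eqv_trans[OF eqv_scale eqv_sym[OF scale]]
      by (auto simp: lin_scale[OF g(1)] vs.subspace_scale)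
  qed
  moreover have "B \<subseteq> {x \<in> U. g x \<doteq> f x}" using B g by auto
  ultimately have "vs.span B \<subseteq> {x \<in> U. g x \<doteq> f x}" by (intro vs.span_minimal)
  then show ?thesis using B gW g(1) that[of g] by auto
qed

lemma subspace_eq_if_dim_eq:
  assumes "vs.subspace U" "vs.subspace W" "U \<subseteq> W" "W \<subseteq> vs.span B" "finite B" "vs.dim U = vs.dim W"
  shows "U = W"
proof -
  obtain C where C: "C \<subseteq> U" "vs.independent C" "U \<subseteq> vs.span C"
    using vs.maximal_independent_subset[of U] by auto
  obtain D where D: "C \<subseteq> D" "D \<subseteq> W" "vs.independent D" "W \<subseteq> vs.span D"
    using vs.maximal_independent_subset_extend[of C W, OF _ C(2)] C(1) assms(3) by blast
  have "finite D" using vs.independent_span_bound[OF assms(5) D(3)] D(2) assms(4) by auto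
  moreover have "card C = card D"
    using vs.basis_card_eq_dim[OF C(1,3,2)] vs.basis_card_eq_dim[OF D(2,4,3)] assms(6) by simp
  ultimately have "C = D" using D(1) by (metis card_subset_eq)
  then have "W \<subseteq> vs.span C" using D by simp
  also have "\<dots> \<subseteq> U" using C assms(1) by (simp add: vs.span_minimal)
  finally show ?thesis using assms(3) by auto
qed

lemma dim_less_if_psubset:
  assumes "vs.subspace U" "vs.subspace W" "U \<subset> W" "W \<subseteq> vs.span B" "finite B"
  shows "vs.dim U < vs.dim W"
proof -
  obtain C where C: "C \<subseteq> U" "vs.independent C" "U \<subseteq> vs.span C"
    using vs.maximal_independent_subset[of U] by auto
  obtain D where D: "C \<subseteq> D" "D \<subseteq> W" "vs.independent D" "W \<subseteq> vs.span D"
    using vs.maximal_independent_subset_extend[of C W, OF _ C(2)] C(1) assms(3) by blast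
  have "finite D" using vs.independent_span_bound[OF assms(5) D(3)] D(2) assms(4) by auto
  then have "card C \<le> card D" using D(1) by (simp add: card_mono)
  then have "vs.dim U \<le> vs.dim W"
    using vs.basis_card_eq_dim[OF C(1,3,2)] vs.basis_card_eq_dim[OF D(2,4,3)] by simp
  then show ?thesis using subspace_eq_if_dim_eq[OF assms(1,2) _ assms(4,5)] assms(3)
    by (auto simp: le_less)
qed

text \<open>
  The vectors are taken as a family, since repetitions among the powers \<open>T\<^sup>i x\<close> also yield a dependency.
\<close>

lemma nontrivial_dependency:
  fixes f :: "nat \<Rightarrow> 'a"
  assumes "finite B" "\<And>i. f i \<in> vs.span B"
  obtains c where "(\<Sum>i\<le>card B. c i \<odot> f i) = 0" "\<exists>i\<le>card B. c i \<noteq> 0"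
proof (cases "inj_on f {..card B}")
  case True
  have "vs.dependent (f ` {..card B})"
    using vs.independent_span_bound[OF assms(1), of "f ` {..card B}"] assms(2)
    by (auto simp: card_image[OF True])
  then obtain u where u: "\<exists>v\<in>f ` {..card B}. u v \<noteq> 0" "(\<Sum>v\<in>f ` {..card B}. u v \<odot> v) = 0"
    using vs.dependent_finite[of "f ` {..card B}"] by auto
  show ?thesis
    using u by (intro that[of "\<lambda>i. u (f i)"]) (auto simp: sum.reindex[OF True])
next
  case False
  then obtain i j where ij: "i \<le> card B" "j \<le> card B" "i \<noteq> j" "f i = f j"
    by (auto simp: inj_on_def)
  let ?c = "\<lambda>m. if m = i then 1 else if m = j then -1 else 0 :: complex"
  have "(\<Sum>m\<le>card B. ?c m \<odot> f m) = (\<Sum>m\<in>{i, j}. ?c m \<odot> f m)"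
    using ij by (intro sum.mono_neutral_right) auto
  also have "\<dots> = 0" using ij by simp
  finally show ?thesis using ij by (intro that[of ?c]) auto
qed

text \<open>
  The fundamental theorem of algebra splits off one linear factor \<open>T - \<alpha>\<close> at a time from a polynomial
  in \<open>T\<close> that maps \<open>x\<close> to a null vector; the first factor to make a vector null has that vector as an
  eigenvector.
\<close>

lemma eigenvector_if_annihilated:
  fixes p :: "complex poly"
  assumes T: "lin T" and U: "vs.subspace U" "\<And>x. x \<in> U \<Longrightarrow> T x \<in> U"
    and "x \<in> U" "\<not> x \<doteq> 0" "p \<noteq> 0" "degree p \<le> n" "(\<Sum>i\<le>n. coeff p i \<odot> (T ^^ i) x) \<doteq> 0"
  shows "\<exists>\<alpha>. \<exists>v\<in>U. \<not> v \<doteq> 0 \<and> T v \<doteq> \<alpha> \<odot> v"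
  using assms(6-8)
proof (induction n arbitrary: p)
  case 0
  then have "coeff p 0 \<noteq> 0" by (metis le_zero_eq leading_coeff_0_iff)
  moreover have "coeff p 0 \<odot> x \<doteq> 0" using 0 by simp
  then have "inverse (coeff p 0) \<odot> coeff p 0 \<odot> x \<doteq> inverse (coeff p 0) \<odot> 0" by (rule eqv_scale)
  ultimately show ?case using assms(5) by simp
next
  case (Suc n)
  show ?case
  proof (cases "degree p = 0")
    case True
    then have "(\<Sum>i\<le>n. coeff p i \<odot> (T ^^ i) x) \<doteq> 0"
      using Suc.prems(3) by (simp add: coeff_eq_0)
    then show ?thesis using Suc.IH[of p] Suc.prems True by simp
  next
    case False
    obtain \<alpha> where "poly p \<alpha> = 0"
      using fundamental_theorem_of_algebra[of p] False by (auto simp: constant_degree)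
    then obtain q where q: "p = [:- \<alpha>, 1:] * q" by (auto simp: poly_eq_0_iff_dvd elim: dvdE)
    with Suc.prems have "q \<noteq> 0" by auto
    then have "degree p = Suc (degree q)" unfolding q by (subst degree_mult_eq) auto
    then have dq: "degree q \<le> n" using Suc.prems by simp
    define y where "y = (\<Sum>i\<le>n. coeff q i \<odot> (T ^^ i) x)"
    have yU: "y \<in> U"
    proof -
      have "(T ^^ i) x \<in> U" for i by (induction i) (auto simp: assms)
      then show ?thesis unfolding y_def by (intro vs.subspace_sum vs.subspace_scale U) auto
    qed
    \<comment> \<open>hence the polynomial \<open>p\<close> in \<open>T\<close> applied to \<open>x\<close> is \<open>T y - \<alpha> y\<close>\<close>
    have p: "coeff p i = coeff (pCons 0 q) i - \<alpha> * coeff q i" for i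
      by (simp add: q coeff_pCons split: nat.splits)
    have "(\<Sum>i\<le>Suc n. coeff p i \<odot> (T ^^ i) x) =
        (\<Sum>i\<le>Suc n. coeff (pCons 0 q) i \<odot> (T ^^ i) x) - (\<Sum>i\<le>Suc n. \<alpha> \<odot> coeff q i \<odot> (T ^^ i) x)"
      by (simp only: p vs.scale_left_diff_distrib sum_subtractf vs.scale_scale)
    also have "(\<Sum>i\<le>Suc n. coeff (pCons 0 q) i \<odot> (T ^^ i) x) = T y"
      by (subst sum.atMost_Suc_shift) (simp add: y_def lin_sum[OF T] lin_scale[OF T])
    also have "(\<Sum>i\<le>Suc n. \<alpha> \<odot> coeff q i \<odot> (T ^^ i) x) = \<alpha> \<odot> y"
      using dq by (simp add: y_def vs.scale_sum_right coeff_eq_0)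
    finally have *: "T y \<doteq> \<alpha> \<odot> y" using Suc.prems(3) by (simp add: eqv_diff_zero_iff[of "T y"])
    show ?thesis
    proof (cases "y \<doteq> 0")
      case True
      then show ?thesis using Suc.IH[of q] \<open>q \<noteq> 0\<close> dq by (simp add: y_def)
    qed (use * yU in blast)
  qed
qed

lemma exists_eigenvector:
  assumes T: "lin T" and U: "vs.subspace U" "\<And>x. x \<in> U \<Longrightarrow> T x \<in> U"
    and B: "finite B" "U \<subseteq> vs.span B" and x: "x \<in> U" "\<not> x \<doteq> 0"
  shows "\<exists>\<alpha>. \<exists>v\<in>U. \<not> v \<doteq> 0 \<and> T v \<doteq> \<alpha> \<odot> v"
proof -
  have "(T ^^ i) x \<in> U" for i by (induction i) (auto simp: assms)
  then obtain c where c: "(\<Sum>i\<le>card B. c i \<odot> (T ^^ i) x) = 0" "\<exists>i\<le>card B. c i \<noteq> 0"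
    using nontrivial_dependency[OF B(1), of "\<lambda>i. (T ^^ i) x"] B(2) by (metis subsetD)
  define p where "p = poly_of_list (map c [0..<Suc (card B)])"
  have p: "coeff p i = (if i \<le> card B then c i else 0)" for i
    by (auto simp: p_def nth_default_def simp del: upt_Suc)
  have "p \<noteq> 0" using c(2) p by (metis coeff_0)
  moreover have "degree p \<le> card B" by (rule degree_le) (simp add: p)
  moreover have "(\<Sum>i\<le>card B. coeff p i \<odot> (T ^^ i) x) \<doteq> 0" using c(1) by (simp add: p)
  ultimately show ?thesis using eigenvector_if_annihilated[OF T U x] by blast
qed

end

lemma sesquilinear_eq_on_span:
  assumes "semidefinite_form sc ip" "semidefinite_form sc ip'"
    and F: "Vector_Spaces.linear sc sc F" "Vector_Spaces.linear sc sc F'"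
    and G: "Vector_Spaces.linear sc sc G" "Vector_Spaces.linear sc sc G'"
    and A: "\<And>u v. u \<in> A \<Longrightarrow> v \<in> A \<Longrightarrow> ip (F u) (G v) = ip' (F' u) (G' v)"
    and pq: "p \<in> module.span sc A" "q \<in> module.span sc A"
  shows "ip (F p) (G q) = ip' (F' p) (G' q)"
proof -
  interpret semidefinite_form sc ip by fact
  interpret I': semidefinite_form sc ip' by fact
  have "vs.subspace {q. ip (F u) (G q) = ip' (F' u) (G' q)}" for u
    by (auto simp: vs.subspace_def lin_zero[OF G(1)] lin_zero[OF G(2)] lin_add[OF G(1)]
        lin_add[OF G(2)] lin_scale[OF G(1)] lin_scale[OF G(2)] ip_add_right ip_scale_right
        I'.ip_add_right I'.ip_scale_right)
  then have "vs.span A \<subseteq> {q. ip (F u) (G q) = ip' (F' u) (G' q)}" if "u \<in> A" for u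
    using that A by (intro vs.span_minimal) auto
  then have "A \<subseteq> {p. ip (F p) (G q) = ip' (F' p) (G' q)}" using pq by auto
  moreover have "vs.subspace {p. ip (F p) (G q) = ip' (F' p) (G' q)}"
    by (auto simp: vs.subspace_def lin_zero[OF F(1)] lin_zero[OF F(2)] lin_add[OF F(1)]
        lin_add[OF F(2)] lin_scale[OF F(1)] lin_scale[OF F(2)] ip_add_left ip_scale_left
        I'.ip_add_left I'.ip_scale_left)
  ultimately have "vs.span A \<subseteq> {p. ip (F p) (G q) = ip' (F' p) (G' q)}"
    by (intro vs.span_minimal)
  then show ?thesis using pq by auto
qed

section \<open>Joint diagonalisation of commuting symmetric operators\<close>

context semidefinite_form
begin

definition joint_eig :: "('n \<Rightarrow> 'a \<Rightarrow> 'a) \<Rightarrow> real ^ 'n \<Rightarrow> 'a \<Rightarrow> bool" where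
  "joint_eig T a v \<longleftrightarrow> (\<forall>l. T l v \<doteq> of_real (a $ l) \<odot> v)"

lemma subspace_joint_eig:
  assumes "\<And>l. lin (T l)"
  shows "vs.subspace {v. joint_eig T a v}"
  unfolding vs.subspace_def joint_eig_def
  by (auto simp: lin_zero[OF assms] lin_add[OF assms] lin_scale[OF assms] eqv_def ip_add_left
      ip_scale_left distrib_left)

end

locale symmetric_tuple = semidefinite_form scale ip
  for scale :: "complex \<Rightarrow> 'a::ab_group_add \<Rightarrow> 'a" (infixr "\<odot>" 75) and ip +
  fixes T :: "'n::finite \<Rightarrow> 'a \<Rightarrow> 'a"
  assumes lin_T: "lin (T l)"
    and symmetric: "ip (T l x) y = ip x (T l y)"
begin

lemma T_eqv: "x \<doteq> y \<Longrightarrow> T l x \<doteq> T l y"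
  by (simp add: eqv_def symmetric)

lemma joint_eig_orthogonal:
  assumes "joint_eig T a v" "joint_eig T b w" "a \<noteq> b"
  shows "ip v w = 0"
proof -
  obtain l where l: "a $ l \<noteq> b $ l" using assms(3) by (auto simp: vec_eq_iff)
  have "of_real (a $ l) * ip v w = ip (T l v) w"
    using assms(1) by (simp add: joint_eig_def eqv_def ip_scale_left)
  also have "\<dots> = ip v (T l w)" by (rule symmetric)
  also have "\<dots> = of_real (b $ l) * ip v w"
    using assms(2) eqv_ip[of v v "T l w" "of_real (b $ l) \<odot> w"] by (simp add: joint_eig_def ip_scale_right)
  finally show ?thesis using l by simp
qed

lemma ip_T_component:
  assumes "joint_eig T a v"
  shows "ip (T l v) y = of_real (a $ l) * ip v y"
  using assms by (simp add: joint_eig_def eqv_def ip_scale_left)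

lemma ip_sum_orthogonal:
  assumes "finite S" "finite S'" "\<And>a. a \<in> S \<Longrightarrow> joint_eig T a (v a)" "\<And>a. a \<in> S' \<Longrightarrow> joint_eig T a (w a)"
  shows "ip (\<Sum>a\<in>S. v a) (\<Sum>a\<in>S'. w a) = (\<Sum>a\<in>S \<inter> S'. ip (v a) (w a))"
proof -
  have "ip (\<Sum>a\<in>S. v a) (\<Sum>a\<in>S'. w a) = (\<Sum>a\<in>S. \<Sum>b\<in>S'. ip (v a) (w b))"
    by (simp add: ip_sum_left ip_sum_right) (rule sum.swap)
  also have "\<dots> = (\<Sum>a\<in>S. \<Sum>b\<in>S'. if b = a then ip (v a) (w a) else 0)"
    by (intro sum.cong refl) (auto intro: joint_eig_orthogonal assms(3,4))
  also have "\<dots> = (\<Sum>a\<in>S \<inter> S'. ip (v a) (w a))"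
    using assms(1,2) by (simp add: sum.inter_restrict)
  finally show ?thesis .
qed

end

locale commuting_tuple = symmetric_tuple scale ip T
  for scale :: "complex \<Rightarrow> 'a::ab_group_add \<Rightarrow> 'a" (infixr "\<odot>" 75) and ip
    and T :: "'n::finite \<Rightarrow> 'a \<Rightarrow> 'a" +
  fixes B :: "'a set"
  assumes finite_B: "finite B"
    and exhaustive: "\<exists>y\<in>vs.span B. x \<doteq> y"
    and T_closed: "T l x \<in> vs.span B"
    and commuting: "T i (T j x) \<doteq> T j (T i x)"
begin

text \<open>
  On an invariant subspace of minimal dimension that is not entirely null, every \<open>T l\<close> is a scalar:
  an eigenspace of \<open>T l\<close> inside it is again invariant, because the operators commute.
\<close>

lemma exists_joint_eigenvector:
  assumes U: "vs.subspace U" "U \<subseteq> vs.span B" "\<And>l x. x \<in> U \<Longrightarrow> T l x \<in> U"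
    and x: "x \<in> U" "\<not> x \<doteq> 0"
  shows "\<exists>v\<in>U. \<exists>a. \<not> v \<doteq> 0 \<and> joint_eig T a v"
  using assms
proof (induction "vs.dim U" arbitrary: U x rule: less_induct)
  case less
  show ?case
  proof (cases "\<forall>l. \<exists>\<alpha>. \<forall>u\<in>U. T l u \<doteq> \<alpha> \<odot> u")
    case True
    then obtain \<alpha> where \<alpha>: "\<And>l u. u \<in> U \<Longrightarrow> T l u \<doteq> \<alpha> l \<odot> u" by metis
    have "\<alpha> l = of_real (Re (\<alpha> l))" for l
    proof -
      have "\<alpha> l * ip x x = ip (T l x) x"
        using \<alpha>[OF less.prems(4)] by (simp add: eqv_def ip_scale_left)
      also have "\<dots> = ip x (T l x)" by (rule symmetric)
      also have "\<dots> = cnj (\<alpha> l) * ip x x"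
        using eqv_ip[OF eqv_refl \<alpha>[OF less.prems(4)], of x l] by (simp add: ip_scale_right)
      finally have "\<alpha> l = cnj (\<alpha> l)" using less.prems(5) by (simp add: eqv_zero_iff)
      then show ?thesis by (simp add: complex_eq_iff)
    qed
    then have "joint_eig T (\<chi> l. Re (\<alpha> l)) x"
      using \<alpha>[OF less.prems(4)] by (simp add: joint_eig_def)
    then show ?thesis using less.prems by blast
  next
    case False
    then obtain l where l: "\<And>\<alpha>. \<exists>u\<in>U. \<not> T l u \<doteq> \<alpha> \<odot> u" by blast
    obtain \<alpha> v where v: "v \<in> U" "\<not> v \<doteq> 0" "T l v \<doteq> \<alpha> \<odot> v"
      using exists_eigenvector[OF lin_T less.prems(1,3) finite_B less.prems(2,4,5)] by blast
    define U' where "U' = {u \<in> U. T l u \<doteq> \<alpha> \<odot> u}"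
    have U': "vs.subspace U'"
      unfolding vs.subspace_def U'_def
      using less.prems(1)
      by (auto simp: vs.subspace_0 vs.subspace_add vs.subspace_scale lin_zero[OF lin_T]
          lin_add[OF lin_T] lin_scale[OF lin_T] eqv_def ip_add_left ip_scale_left distrib_left)
    have "U' \<subset> U" using l[of \<alpha>] unfolding U'_def by blast
    then have dim: "vs.dim U' < vs.dim U"
      using dim_less_if_psubset[OF U' less.prems(1) _ less.prems(2) finite_B] by blast
    have inv: "T j u \<in> U'" if "u \<in> U'" for j u
    proof -
      have "T l (T j u) \<doteq> T j (T l u)"
        by (rule commuting)
      also have "\<dots> \<doteq> T j (\<alpha> \<odot> u)" using that by (intro T_eqv) (auto simp: U'_def)
      also have "T j (\<alpha> \<odot> u) = \<alpha> \<odot> T j u" by (rule lin_scale[OF lin_T])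
      finally show ?thesis using that less.prems(3) by (simp add: U'_def)
    qed
    have "v \<in> U'" using v by (simp add: U'_def)
    then have "\<exists>v\<in>U'. \<exists>a. \<not> v \<doteq> 0 \<and> joint_eig T a v"
      using less.hyps[OF dim U' _ inv _ v(2)] \<open>U' \<subset> U\<close> less.prems(2) by blast
    then show ?thesis by (auto simp: U'_def)
  qed
qed

text \<open>
  Splitting off one joint eigenvector at a time leaves its orthogonal complement, which is invariant
  because the operators are symmetric.
\<close>

lemma spectral_decomposition_on:
  assumes U: "vs.subspace U" "U \<subseteq> vs.span B" "\<And>l x. x \<in> U \<Longrightarrow> T l x \<in> U" and x: "x \<in> U"
  shows "\<exists>S v. finite S \<and> (\<forall>a. v a \<in> U \<and> joint_eig T a (v a)) \<and> (\<forall>a. a \<notin> S \<longrightarrow> v a = 0) \<and>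
    x \<doteq> (\<Sum>a\<in>S. v a)"
  using assms
proof (induction "vs.dim U" arbitrary: U x rule: less_induct)
  case less
  have zero: "joint_eig T a 0" for a
    by (simp add: joint_eig_def lin_zero[OF lin_T])
  show ?case
  proof (cases "\<forall>u\<in>U. u \<doteq> 0")
    case True
    then show ?thesis using less.prems(1,4) zero
      by (intro exI[of _ "{}"] exI[of _ "\<lambda>a. 0"]) (auto simp: vs.subspace_0)
  next
    case False
    then obtain w b where w: "w \<in> U" "\<not> w \<doteq> 0" "joint_eig T b w"
      using exists_joint_eigenvector[OF less.prems(1-3)] by blast
    define U' where "U' = {u \<in> U. ip u w = 0}"
    have U': "vs.subspace U'"
      unfolding vs.subspace_def U'_def using less.prems(1)
      by (auto simp: vs.subspace_0 vs.subspace_add vs.subspace_scale ip_add_left ip_scale_left)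
    have "w \<notin> U'" using w by (auto simp: U'_def eqv_zero_iff)
    then have "U' \<subset> U" using w by (auto simp: U'_def)
    then have dim: "vs.dim U' < vs.dim U"
      using dim_less_if_psubset[OF U' less.prems(1) _ less.prems(2) finite_B] by blast
    have inv: "T l u \<in> U'" if "u \<in> U'" for l u
    proof -
      have "ip (T l u) w = cnj (ip (T l w) u)" using symmetric ip_commute by metis
      also have "\<dots> = 0" using that ip_commute[of u w] by (simp add: ip_T_component[OF w(3)] U'_def)
      finally show ?thesis using that less.prems(3) by (simp add: U'_def)
    qed
    define c where "c = ip x w / ip w w"
    define x' where "x' = x - c \<odot> w"
    have "ip w w \<noteq> 0" using w by (simp add: eqv_zero_iff)
    then have "x' \<in> U'"
      using less.prems(1,4) w
      by (auto simp: x'_def U'_def vs.subspace_diff vs.subspace_scale ip_diff_left ip_scale_left c_def)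
    moreover have "U' \<subseteq> vs.span B" using \<open>U' \<subset> U\<close> less.prems(2) by auto
    ultimately have "\<exists>S v. finite S \<and> (\<forall>a. v a \<in> U' \<and> joint_eig T a (v a)) \<and>
        (\<forall>a. a \<notin> S \<longrightarrow> v a = 0) \<and> x' \<doteq> (\<Sum>a\<in>S. v a)"
      using less.hyps[OF dim U'] inv by simp
    then obtain S v where S: "finite S" "\<And>a. v a \<in> U' \<and> joint_eig T a (v a)"
      "\<And>a. a \<notin> S \<Longrightarrow> v a = 0" "x' \<doteq> (\<Sum>a\<in>S. v a)"
      by metis
    define v' where "v' = v(b := v b + c \<odot> w)"
    have "(\<Sum>a\<in>S. v a) = (\<Sum>a\<in>insert b S. v a)"
      using S by (intro sum.mono_neutral_left) auto
    then have "(\<Sum>a\<in>insert b S. v' a) = (\<Sum>a\<in>S. v a) + c \<odot> w"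
      using S(1) by (simp add: sum.insert_remove v'_def)
    moreover have "x \<doteq> (\<Sum>a\<in>S. v a) + c \<odot> w"
      using eqv_add[OF S(4) eqv_refl[of "c \<odot> w"]] by (simp add: x'_def)
    ultimately have "x \<doteq> (\<Sum>a\<in>insert b S. v' a)" by simp
    moreover have "v' a \<in> U \<and> joint_eig T a (v' a)" for a
    proof (cases "a = b")
      case True
      have "v b \<in> U" using S(2) \<open>U' \<subset> U\<close> by auto
      then have "v' b \<in> U" using w less.prems(1) by (simp add: v'_def vs.subspace_add vs.subspace_scale)
      moreover have "v' b \<in> {u. joint_eig T b u}"
        unfolding v'_def fun_upd_same using S(2)[of b] w
        by (intro vs.subspace_add vs.subspace_scale subspace_joint_eig lin_T) auto
      ultimately show ?thesis using True by simp
    next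
      case False
      then show ?thesis using S(2)[of a] \<open>U' \<subset> U\<close> by (auto simp: v'_def)
    qed
    ultimately show ?thesis
      using S by (intro exI[of _ "insert b S"] exI[of _ v']) (auto simp: v'_def)
  qed
qed

lemma spectral_decomposition:
  obtains S v where "finite S" "\<And>a. v a \<in> vs.span B" "\<And>a. joint_eig T a (v a)"
    "\<And>a. a \<notin> S \<Longrightarrow> v a = 0" "x \<doteq> (\<Sum>a\<in>S. v a)"
proof -
  obtain y where y: "y \<in> vs.span B" "x \<doteq> y" using exhaustive by blast
  have "\<exists>S v. finite S \<and> (\<forall>a. v a \<in> vs.span B \<and> joint_eig T a (v a)) \<and>
      (\<forall>a. a \<notin> S \<longrightarrow> v a = 0) \<and> y \<doteq> (\<Sum>a\<in>S. v a)"
    using y T_closed by (intro spectral_decomposition_on) auto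
  then obtain S v where Sv: "finite S" "\<forall>a. v a \<in> vs.span B \<and> joint_eig T a (v a)"
    "\<forall>a. a \<notin> S \<longrightarrow> v a = 0" "y \<doteq> (\<Sum>a\<in>S. v a)" by (elim exE conjE)
  then show ?thesis using eqv_trans[OF y(2) Sv(4)] by (intro that[of S v]) auto
qed

text \<open>
  The components of a vector are unique up to null vectors, but they are chosen for a basis and extended
  linearly, so that one finite set of joint eigenvalues serves all vectors.
\<close>

lemma spectral_projections:
  obtains S P where "finite S" "\<And>a. lin (P a)" "\<And>a x. P a x \<in> vs.span B"
    "\<And>a x. joint_eig T a (P a x)" "\<And>x. x \<doteq> (\<Sum>a\<in>S. P a x)"
proof -
  obtain C where C: "C \<subseteq> vs.span B" "vs.independent C" "vs.span B \<subseteq> vs.span C"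
    using vs.maximal_independent_subset[of "vs.span B"] by auto
  have finC: "finite C" using vs.independent_span_bound[OF finite_B C(2,1)] by simp
  have "\<forall>x. \<exists>S v. x \<in> C \<longrightarrow> finite S \<and> (\<forall>a. v a \<in> vs.span B \<and> joint_eig T a (v a)) \<and>
    (\<forall>a. a \<notin> S \<longrightarrow> v a = 0) \<and> x \<doteq> (\<Sum>a\<in>S. v a)"
    using spectral_decomposition by metis
  then obtain S v where Sv: "\<And>x. x \<in> C \<Longrightarrow> finite (S x)"
    "\<And>x a. x \<in> C \<Longrightarrow> v x a \<in> vs.span B \<and> joint_eig T a (v x a)"
    "\<And>x a. x \<in> C \<Longrightarrow> a \<notin> S x \<Longrightarrow> v x a = 0" "\<And>x. x \<in> C \<Longrightarrow> x \<doteq> (\<Sum>a\<in>S x. v x a)"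
    by metis
  have "\<forall>a. \<exists>g. lin g \<and> (\<forall>x\<in>C. g x = v x a) \<and> range g = vs.span ((\<lambda>x. v x a) ` C)"
    by (intro allI vsp.linear_independent_extend_subspace C(2))
  then obtain P where P: "\<And>a. lin (P a)" "\<And>a x. x \<in> C \<Longrightarrow> P a x = v x a"
    "\<And>a. range (P a) = vs.span ((\<lambda>x. v x a) ` C)"
    by metis
  have range: "range (P a) \<subseteq> vs.span B \<inter> {x. joint_eig T a x}" for a
    unfolding P(3) using Sv(2) subspace_joint_eig[OF lin_T]
    by (intro vs.span_minimal vs.subspace_inter) auto
  define S' where "S' = (\<Union>x\<in>C. S x)"
  have "x \<doteq> (\<Sum>a\<in>S'. P a x)" if "x \<in> vs.span B" for x
  proof -
    have "vs.subspace {x. x \<doteq> (\<Sum>a\<in>S'. P a x)}"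
      by (auto simp: vs.subspace_def lin_zero[OF P(1)] lin_add[OF P(1)] lin_scale[OF P(1)]
          eqv_def ip_add_left ip_scale_left ip_sum_left sum.distrib sum_distrib_left)
    moreover have "C \<subseteq> {x. x \<doteq> (\<Sum>a\<in>S'. P a x)}"
    proof
      fix x assume x: "x \<in> C"
      have "(\<Sum>a\<in>S x. v x a) = (\<Sum>a\<in>S'. v x a)"
        using x Sv finC by (intro sum.mono_neutral_left) (auto simp: S'_def)
      then show "x \<in> {x. x \<doteq> (\<Sum>a\<in>S'. P a x)}" using Sv(4)[OF x] x by (simp add: P(2))
    qed
    ultimately have "vs.span C \<subseteq> {x. x \<doteq> (\<Sum>a\<in>S'. P a x)}" by (intro vs.span_minimal)
    then show ?thesis using that C(3) by auto
  qed
  moreover have "finite S'" using finC Sv(1) by (simp add: S'_def)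
  ultimately have S': "finite S'" "\<And>x. x \<in> vs.span B \<Longrightarrow> x \<doteq> (\<Sum>a\<in>S'. P a x)" by auto
  define f where "f x = (SOME y. y \<in> vs.span B \<and> x \<doteq> y)" for x
  have f: "f x \<in> vs.span B" "x \<doteq> f x" for x
    using someI_ex[of "\<lambda>y. y \<in> vs.span B \<and> x \<doteq> y"] exhaustive[of x] by (auto simp: f_def)
  have fadd: "f (x + y) \<doteq> f x + f y" and fscale: "f (c \<odot> x) \<doteq> c \<odot> f x" for x y c
    using eqv_trans[OF eqv_sym[OF f(2)] eqv_add[OF f(2) f(2)]]
      eqv_trans[OF eqv_sym[OF f(2)] eqv_scale[OF f(2)]] by auto
  obtain g where g: "lin g" "\<And>x. g x \<in> vs.span B" "\<And>x. x \<in> UNIV \<Longrightarrow> g x \<doteq> f x"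
    using linear_lift[of UNIV "vs.span B" f] f(1) fadd fscale by auto
  have "x \<doteq> g x" for x using eqv_trans[OF f(2) eqv_sym[OF g(3)]] by simp
  then have "x \<doteq> (\<Sum>a\<in>S'. P a (g x))" for x using eqv_trans S'(2)[OF g(2)] by blast
  then show ?thesis
    using S'(1) subsetD[OF range rangeI] lin_compose[OF P(1) g(1)]
    by (intro that[of S' "\<lambda>a x. P a (g x)"]) auto
qed

end

section \<open>Projection-valued measures\<close>

lemma has_bochner_integral_finite_support:
  fixes f :: "'b::t1_space \<Rightarrow> real"
  assumes "finite_measure M" "sets M = sets borel" "finite S" "emeasure M (- S) = 0"
    "f \<in> borel_measurable borel"
  shows "has_bochner_integral M f (\<Sum>a\<in>S. measure M {a} * f a)"
proof -
  interpret finite_measure M by fact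
  have "has_bochner_integral M (\<lambda>x. \<Sum>a\<in>S. indicator {a} x * f a) (\<Sum>a\<in>S. measure M {a} * f a)"
    using assms(2)
    by (intro has_bochner_integral_sum has_bochner_integral_mult_left has_bochner_integral_real_indicator)
      (auto simp: top.not_eq_extremum[symmetric])
  moreover have "AE x in M. (\<Sum>a\<in>S. indicator {a} x * f a) = f x"
  proof (rule AE_I')
    show "- S \<in> null_sets M"
      using assms finite_imp_closed[of S] by (auto simp: null_sets_def)
    show "{x \<in> space M. (\<Sum>a\<in>S. indicator {a} x * f a) \<noteq> f x} \<subseteq> - S"
    proof
      fix x assume x: "x \<in> {x \<in> space M. (\<Sum>a\<in>S. indicator {a} x * f a) \<noteq> f x}"
      have "(\<Sum>a\<in>S. indicator {a} x * f a) = (\<Sum>a\<in>S. if a = x then f x else 0)"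
        by (intro sum.cong) (auto simp: indicator_def)
      then show "x \<in> - S" using x assms(3) by auto
    qed
  qed
  moreover have "f \<in> borel_measurable M" using assms(2,5) by (simp cong: measurable_cong_sets)
  ultimately show ?thesis using has_bochner_integralI_AE by blast
qed

text \<open>The measure \<open>\<delta> \<mapsto> \<langle>E(\<delta>)x, x\<rangle>\<close> of a projection-valued measure.\<close>

definition scal_measure :: "('a \<Rightarrow> 'a \<Rightarrow> complex) \<Rightarrow> ('b::topological_space set \<Rightarrow> 'a \<Rightarrow> 'a) \<Rightarrow> 'a \<Rightarrow> 'b measure" where
  "scal_measure ip e x = measure_of UNIV (sets borel) (\<lambda>\<delta>. ennreal (Re (ip (e \<delta> x) x)))"

locale projection_valued_measure = semidefinite_form scale ip
  for scale :: "complex \<Rightarrow> 'a::ab_group_add \<Rightarrow> 'a" (infixr "\<odot>" 75) and ip +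
  fixes e :: "'b::topological_space set \<Rightarrow> 'a \<Rightarrow> 'a"
  assumes e_symmetric: "\<delta> \<in> sets borel \<Longrightarrow> ip (e \<delta> x) y = ip x (e \<delta> y)"
    and e_UNIV: "e UNIV x \<doteq> x"
    and e_Int: "\<delta> \<in> sets borel \<Longrightarrow> \<delta>' \<in> sets borel \<Longrightarrow> e (\<delta> \<inter> \<delta>') x \<doteq> e \<delta> (e \<delta>' x)"
    and e_sums: "range D \<subseteq> sets borel \<Longrightarrow> disjoint_family D \<Longrightarrow>
      (\<lambda>i. ip (e (D i) x) y) sums ip (e (\<Union>i. D i) x) y"
begin

abbreviation "scal \<equiv> scal_measure ip e"

lemma sets_scal [simp]: "sets (scal x) = sets borel" and space_scal [simp]: "space (scal x) = UNIV"
  unfolding scal_measure_def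
  using sets.sigma_sets_eq[of "borel :: 'b measure"] by (auto simp: space_measure_of_conv)

text \<open>A constant series converges only if its terms vanish.\<close>

lemma e_empty: "e {} x \<doteq> 0"
proof -
  have "ip (e {} x) y = 0" for y
  proof -
    have "(\<lambda>i::nat. ip (e {} x) y) sums ip (e {} x) y"
      using e_sums[of "\<lambda>i. {}" x y] by (simp add: disjoint_family_on_def)
    then show ?thesis using summable_const_iff sums_summable by blast
  qed
  then show ?thesis by (simp add: eqv_def)
qed

lemma ip_e_self: "\<delta> \<in> sets borel \<Longrightarrow> ip (e \<delta> x) x = ip (e \<delta> x) (e \<delta> x)"
  using e_Int[of \<delta> \<delta> x] e_symmetric[of \<delta> "e \<delta> x" x] by (simp add: eqv_def)

lemma emeasure_scal:
  assumes "\<delta> \<in> sets borel"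
  shows "emeasure (scal x) \<delta> = ennreal (Re (ip (e \<delta> x) x))"
  unfolding scal_measure_def
proof (rule emeasure_measure_of_sigma)
  show "sigma_algebra UNIV (sets (borel :: 'b measure))"
    using sets.sigma_algebra_axioms[of "borel :: 'b measure"] by simp
  show "positive (sets borel) (\<lambda>\<delta>. ennreal (Re (ip (e \<delta> x) x)))"
    using e_empty by (simp add: positive_def eqv_def)
  show "countably_additive (sets borel) (\<lambda>\<delta>. ennreal (Re (ip (e \<delta> x) x)))"
  proof (rule countably_additiveI)
    fix D :: "nat \<Rightarrow> 'b set" assume D: "range D \<subseteq> sets borel" "disjoint_family D"
    have "(\<lambda>i. Re (ip (e (D i) x) x)) sums Re (ip (e (\<Union>i. D i) x) x)"
      using e_sums[OF D] by (rule sums_Re)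
    moreover have "0 \<le> Re (ip (e (D i) x) x)" for i
      using D ip_nonneg by (subst ip_e_self) auto
    ultimately show "suminf (\<lambda>i. ennreal (Re (ip (e (D i) x) x))) = ennreal (Re (ip (e (\<Union>i. D i) x) x))"
      by (intro suminf_ennreal_eq)
  qed
qed fact

lemma finite_measure_scal: "finite_measure (scal x)"
  by (rule finite_measureI) (simp add: emeasure_scal)

lemma measure_scal: "\<delta> \<in> sets borel \<Longrightarrow> measure (scal x) \<delta> = Re (ip (e \<delta> x) x)"
  unfolding measure_def using ip_nonneg[of "e \<delta> x"] by (simp add: emeasure_scal ip_e_self)

lemma emeasure_scal_eq_0_iff:
  assumes "\<delta> \<in> sets borel"
  shows "emeasure (scal x) \<delta> = 0 \<longleftrightarrow> e \<delta> x \<doteq> 0"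
  using assms ip_nonneg[of "e \<delta> x"] ip_self_real[of "e \<delta> x"]
  by (auto simp: emeasure_scal ip_e_self eqv_zero_iff ennreal_eq_0_iff complex_eq_iff)

end

section \<open>Joint spectral measures\<close>

text \<open>
  Only the quadratic forms of the operators \<open>T l\<close> are tied to \<open>e\<close>; that \<open>e\<close> acts on joint
  eigenvectors as an indicator is a consequence (\<open>e_eigenvector\<close>).
\<close>

locale spectral_tuple =
  projection_valued_measure scale ip e + symmetric_tuple scale ip T
  for scale :: "complex \<Rightarrow> 'a::ab_group_add \<Rightarrow> 'a" (infixr "\<odot>" 75) and ip
    and e :: "(real ^ 'n::finite) set \<Rightarrow> 'a \<Rightarrow> 'a" and T :: "'n \<Rightarrow> 'a \<Rightarrow> 'a" +
  assumes square_integrable: "integrable (scal_measure ip e x) (\<lambda>t. (t $ l)\<^sup>2)"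
    and quadratic_form: "ip (T l x) x = of_real (\<integral>t. t $ l \<partial>scal_measure ip e x)"
begin

lemma coordinate_measurable [measurable]: "(\<lambda>t. t $ l) \<in> borel_measurable (scal x)"
proof -
  have "(\<lambda>t :: real ^ 'n. t $ l) \<in> borel_measurable borel"
    by (intro borel_measurable_continuous_onI continuous_intros)
  then show ?thesis by (simp cong: measurable_cong_sets)
qed

lemma coordinate_integrable: "integrable (scal x) (\<lambda>t. t $ l)"
proof -
  interpret finite_measure "scal x" by (rule finite_measure_scal)
  have "integrable (scal x) (\<lambda>t. 1 + (t $ l)\<^sup>2)" using square_integrable by simp
  moreover have "\<bar>r\<bar> \<le> 1 + r\<^sup>2" for r :: real
  proof -
    have "0 \<le> (\<bar>r\<bar> - 1)\<^sup>2" by simp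
    then have "2 * \<bar>r\<bar> \<le> 1 + r\<^sup>2" by (simp add: power2_diff)
    then show ?thesis by simp
  qed
  ultimately show ?thesis
    using Bochner_Integration.integrable_bound[of "scal x" "\<lambda>t. 1 + (t $ l)\<^sup>2" "\<lambda>t. t $ l"] by simp
qed

text \<open>
  Let \<open>u\<close> be the part of the eigenvector \<open>v\<close> in the range of the projection for an open half-space
  not containing \<open>a\<close>, and \<open>w = v - u\<close>.  The vectors \<open>w + u\<close> and \<open>w - u\<close> have the same scalar
  measure, so the quadratic form of \<open>T l\<close> agrees on them, which means that the cross term of \<open>u\<close> and
  \<open>w\<close> vanishes.  Hence \<open>u\<close> has mean value \<open>a $ l\<close> although its scalar measure sits strictly on one
  side of \<open>a $ l\<close>.
\<close>

lemma half_space_component_null: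
  assumes v: "joint_eig T a v" and \<sigma>: "\<sigma> \<in> {1, -1 :: real}"
  shows "e {t. \<sigma> * t $ l > \<sigma> * a $ l} v \<doteq> 0"
proof -
  define \<delta> where "\<delta> = {t :: real ^ 'n. \<sigma> * t $ l > \<sigma> * a $ l}"
  have \<delta>: "\<delta> \<in> sets borel"
    unfolding \<delta>_def by (intro borel_open open_Collect_less continuous_intros)
  define u where "u = e \<delta> v"
  define w where "w = v - u"
  have cross: "ip (e \<eta> w) u = 0" if \<eta>: "\<eta> \<in> sets borel" for \<eta>
  proof -
    have 1: "ip x (e \<eta> u) = ip x (e (\<eta> \<inter> \<delta>) v)" for x
      using eqv_ip[OF eqv_refl[of x] e_Int[OF \<eta> \<delta>, of v]] by (simp add: u_def)
    have "ip u (e (\<eta> \<inter> \<delta>) v) = ip v (e \<delta> (e (\<eta> \<inter> \<delta>) v))"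
      unfolding u_def by (rule e_symmetric[OF \<delta>])
    also have "\<dots> = ip v (e (\<delta> \<inter> (\<eta> \<inter> \<delta>)) v)"
      using \<eta> \<delta> by (intro eqv_ip eqv_refl eqv_sym[OF e_Int]) auto
    also have "\<delta> \<inter> (\<eta> \<inter> \<delta>) = \<eta> \<inter> \<delta>" by auto
    finally have "ip w (e (\<eta> \<inter> \<delta>) v) = 0" by (simp add: w_def ip_diff_left)
    then show ?thesis using e_symmetric[OF \<eta>, of w u] by (simp add: 1)
  qed
  have e_add: "e \<eta> (x + y) \<doteq> e \<eta> x + e \<eta> y" and e_diff: "e \<eta> (x - y) \<doteq> e \<eta> x - e \<eta> y"
    if "\<eta> \<in> sets borel" for \<eta> x y
    using that by (auto simp: eqv_def e_symmetric ip_add_left ip_diff_left)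
  have "scal (w + u) = scal (w - u)"
    unfolding scal_measure_def
  proof (rule measure_of_eq)
    fix \<eta> :: "(real ^ 'n) set"
    assume "\<eta> \<in> sigma_sets UNIV (sets borel)"
    then have \<eta>: "\<eta> \<in> sets borel" using sets.sigma_sets_eq[of "borel :: (real ^ 'n) measure"] by simp
    have c: "ip (e \<eta> u) w = 0"
      using cross[OF \<eta>] e_symmetric[OF \<eta>, of u w] ip_commute[of u "e \<eta> w"] by simp
    have "ip (e \<eta> (w + u)) (w + u) = ip (e \<eta> w + e \<eta> u) (w + u)"
      by (intro eqv_ip e_add \<eta> eqv_refl)
    also have "\<dots> = ip (e \<eta> w - e \<eta> u) (w - u)"
      by (simp add: ip_add_left ip_add_right ip_diff_left ip_diff_right cross[OF \<eta>] c)
    also have "\<dots> = ip (e \<eta> (w - u)) (w - u)"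
      by (intro eqv_ip eqv_sym[OF e_diff] \<eta> eqv_refl)
    finally show "ennreal (Re (ip (e \<eta> (w + u)) (w + u))) = ennreal (Re (ip (e \<eta> (w - u)) (w - u)))"
      by simp
  qed simp
  then have "ip (T l (w + u)) (w + u) = ip (T l (w - u)) (w - u)"
    by (simp add: quadratic_form)
  moreover have "ip (T l u) w = cnj (ip (T l w) u)"
    using symmetric[of l u w] ip_commute[of u "T l w"] by (metis ip_commute)
  ultimately have "Re (ip (T l w) u) = 0"
    by (simp add: lin_add[OF lin_T] lin_diff[OF lin_T] ip_add_left ip_add_right ip_diff_left
        ip_diff_right complex_eq_iff)
  moreover have "ip (T l w) u = a $ l * ip u u - ip (T l u) u"
  proof -
    have "ip v u = ip u u"
      using ip_e_self[OF \<delta>, of v] e_symmetric[OF \<delta>, of v v] by (simp add: u_def)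
    then show ?thesis
      using ip_T_component[OF v, of l u] by (simp add: w_def lin_diff[OF lin_T] ip_diff_left)
  qed
  ultimately have mean: "(\<integral>t. t $ l \<partial>scal u) = a $ l * Re (ip u u)"
    by (simp add: quadratic_form)
  interpret finite_measure "scal u" by (rule finite_measure_scal)
  have total: "measure (scal u) UNIV = Re (ip u u)"
    using eqv_ip[OF e_UNIV eqv_refl, of u u] by (simp add: measure_scal)
  have "e (- \<delta>) u \<doteq> e (- \<delta> \<inter> \<delta>) v"
    unfolding u_def using \<delta> by (intro eqv_sym[OF e_Int]) auto
  also have "e (- \<delta> \<inter> \<delta>) v \<doteq> 0" using e_empty by simp
  finally have "emeasure (scal u) (- \<delta>) = 0" using \<delta> by (subst emeasure_scal_eq_0_iff) auto
  then have pos: "AE t in scal u. 0 < \<sigma> * (t $ l - a $ l)"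
    using \<delta> by (intro AE_I[of _ _ "- \<delta>"]) (auto simp: \<delta>_def algebra_simps)
  have int: "integrable (scal u) (\<lambda>t. \<sigma> * (t $ l - a $ l))"
    using coordinate_integrable by simp
  have zero: "(\<integral>t. \<sigma> * (t $ l - a $ l) \<partial>scal u) = 0"
    using coordinate_integrable[of u l] by (simp add: mean total)
  have "AE t in scal u. 0 \<le> \<sigma> * (t $ l - a $ l)" using pos by eventually_elim simp
  then have "AE t in scal u. \<sigma> * (t $ l - a $ l) = 0"
    by (rule iffD1[OF integral_nonneg_eq_0_iff_AE[OF int] zero])
  with pos have "AE t in scal u. False" by eventually_elim simp
  then have "emeasure (scal u) UNIV = 0" by (simp add: eventually_False ae_filter_eq_bot_iff)
  then have "e UNIV u \<doteq> 0" by (simp add: emeasure_scal_eq_0_iff)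
  then have "u \<doteq> 0" using eqv_trans[OF eqv_sym[OF e_UNIV]] by blast
  then show ?thesis by (simp add: u_def \<delta>_def)
qed

text \<open>
  The complement of \<open>a\<close> is the union of finitely many half-spaces of the preceding kind, so the scalar
  measure of \<open>v\<close> is concentrated at \<open>a\<close>.
\<close>

lemma e_eigenvector:
  assumes v: "joint_eig T a v" and \<delta>: "\<delta> \<in> sets borel"
  shows "e \<delta> v \<doteq> (if a \<in> \<delta> then v else 0)"
proof -
  define Z where "Z = (\<Union>l. {t. 1 * t $ l > 1 * a $ l} \<union> {t. -1 * t $ l > -1 * a $ l})"
  have half: "{t :: real ^ 'n. \<sigma> * t $ l > \<sigma> * a $ l} \<in> null_sets (scal v)" if "\<sigma> \<in> {1, -1}" for \<sigma> l
  proof -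
    have "{t :: real ^ 'n. \<sigma> * t $ l > \<sigma> * a $ l} \<in> sets borel"
      by (intro borel_open open_Collect_less continuous_intros)
    then show ?thesis
      using half_space_component_null[OF v that] by (simp add: null_sets_def emeasure_scal_eq_0_iff)
  qed
  have Z: "Z \<in> null_sets (scal v)"
    unfolding Z_def using half[of 1] half[of "-1"] by (intro null_sets_UN' null_sets.Un) auto
  have sub: "- {a} \<subseteq> Z"
  proof
    fix t assume "t \<in> - {a}"
    then obtain l where "t $ l \<noteq> a $ l" by (auto simp: vec_eq_iff)
    then have "t $ l < a $ l \<or> a $ l < t $ l" by auto
    then show "t \<in> Z" by (auto simp: Z_def)
  qed
  have null: "emeasure (scal v) \<eta> = 0" if "\<eta> \<in> sets borel" "a \<notin> \<eta>" for \<eta>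
  proof -
    have "\<eta> \<subseteq> Z" using that(2) by (intro subset_trans[OF _ sub]) auto
    then have "\<eta> \<in> null_sets (scal v)" using null_sets_subset[OF Z] that(1) by simp
    then show ?thesis by (rule null_setsD1)
  qed
  show ?thesis
  proof (cases "a \<in> \<delta>")
    case False
    then show ?thesis using null[OF \<delta>] \<delta> by (simp add: emeasure_scal_eq_0_iff)
  next
    case True
    interpret finite_measure "scal v" by (rule finite_measure_scal)
    have "measure (scal v) (- \<delta>) = 0" using null[of "- \<delta>"] True \<delta> by (simp add: measure_def)
    then have "measure (scal v) \<delta> = measure (scal v) UNIV"
      using finite_measure_compl[of \<delta>] \<delta> by (simp add: Compl_eq_Diff_UNIV)
    then have "Re (ip (e \<delta> v) v) = Re (ip v v)"
      using \<delta> eqv_ip[OF e_UNIV eqv_refl, of v v] by (simp add: measure_scal)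
    then have eq: "ip (e \<delta> v) (e \<delta> v) = ip v v"
      using ip_e_self[OF \<delta>, of v] ip_self_real[of v] ip_self_real[of "e \<delta> v"] by metis
    have "ip (e \<delta> v - v) (e \<delta> v - v) = 0"
      using ip_e_self[OF \<delta>, of v] e_symmetric[OF \<delta>, of v v] eq
      by (simp add: ip_diff_left ip_diff_right)
    then show ?thesis using True by (simp add: eqv_iff)
  qed
qed

end

context commuting_tuple
begin

text \<open>
  The spectral measure is the sum of the projections to those joint eigenspaces whose eigenvalue lies in
  \<open>\<delta>\<close>.  Symmetry and multiplicativity follow from the symmetric expression for \<open>\<langle>e \<delta> x, e \<delta>' y\<rangle>\<close>.
\<close>

lemma exists_spectral_tuple:
  obtains e where "spectral_tuple scale ip e T" "\<And>\<delta>. lin (e \<delta>)" "\<And>\<delta> x. e \<delta> x \<in> vs.span B"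
proof -
  obtain S P where S: "finite S" and P: "\<And>a. lin (P a)" "\<And>a x. P a x \<in> vs.span B"
    "\<And>a x. joint_eig T a (P a x)" "\<And>x. x \<doteq> (\<Sum>a\<in>S. P a x)"
    by (rule spectral_projections, rule that)
  define e where "e \<delta> x = (\<Sum>a\<in>S \<inter> \<delta>. P a x)" for \<delta> x
  have UNIV: "e UNIV x \<doteq> x" for x using P(4) by (simp add: e_def eqv_sym)
  have ip_e: "ip (e \<delta> x) (e \<delta>' y) = (\<Sum>a\<in>S \<inter> \<delta> \<inter> \<delta>'. ip (P a x) (P a y))" for \<delta> \<delta>' x y
  proof -
    have "(S \<inter> \<delta>) \<inter> (S \<inter> \<delta>') = S \<inter> \<delta> \<inter> \<delta>'" by auto
    then show ?thesis using S P(3) unfolding e_def by (subst ip_sum_orthogonal) auto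
  qed
  have ip_left: "ip (e \<delta> x) y = (\<Sum>a\<in>S \<inter> \<delta>. ip (P a x) (P a y))" for \<delta> x y
    using ip_e[of \<delta> x UNIV y] eqv_ip[OF eqv_refl UNIV[of y], of "e \<delta> x"] by simp
  have ip_right: "ip x (e \<delta> y) = (\<Sum>a\<in>S \<inter> \<delta>. ip (P a x) (P a y))" for \<delta> x y
    using ip_e[of UNIV x \<delta> y] eqv_ip[OF UNIV[of x] eqv_refl, of "e \<delta> y"] by simp
  interpret pvm: projection_valued_measure scale ip e
  proof
    show "ip (e \<delta> x) y = ip x (e \<delta> y)" for \<delta> x y by (simp add: ip_left ip_right)
    show "e UNIV x \<doteq> x" for x by (rule UNIV)
    show "e (\<delta> \<inter> \<delta>') x \<doteq> e \<delta> (e \<delta>' x)" for \<delta> \<delta>' x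
      unfolding eqv_def
    proof
      fix z
      have "ip (e (\<delta> \<inter> \<delta>') x) z = ip (e \<delta>' x) (e \<delta> z)"
        unfolding ip_e by (simp add: ip_left Int_ac)
      also have "\<dots> = ip (e \<delta> (e \<delta>' x)) z" by (simp only: ip_left ip_right)
      finally show "ip (e (\<delta> \<inter> \<delta>') x) z = ip (e \<delta> (e \<delta>' x)) z" .
    qed
    show "(\<lambda>i. ip (e (D i) x) y) sums ip (e (\<Union>i. D i) x) y"
      if "disjoint_family D" for D :: "nat \<Rightarrow> (real ^ 'n) set" and x y
    proof -
      have e_if: "ip (e \<delta> x) y = (\<Sum>a\<in>S. if a \<in> \<delta> then ip (P a x) y else 0)" for \<delta>
        using S by (auto simp: e_def ip_sum_left sum.inter_restrict intro!: sum.cong)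
      have "(\<lambda>i. if a \<in> D i then c else 0) sums (if a \<in> (\<Union>i. D i) then c else 0)" for a and c :: complex
      proof (cases "a \<in> (\<Union>i. D i)")
        case True
        then obtain j where j: "a \<in> D j" by auto
        have "(\<lambda>i. if a \<in> D i then c else 0) = (\<lambda>i. if i = j then c else 0)"
          using j that by (auto simp: disjoint_family_on_def fun_eq_iff)
        then show ?thesis using sums_single[of j "\<lambda>_. c"] True by simp
      qed auto
      then show ?thesis unfolding e_if by (intro sums_sum)
    qed
  qed
  have spectral: "has_bochner_integral (scal_measure ip e x) f (\<Sum>a\<in>S. Re (ip (P a x) x) * f a)"
    if "f \<in> borel_measurable borel" for x f
  proof -
    have "e (- S) x \<doteq> 0" by (simp add: e_def)
    then have "emeasure (scal_measure ip e x) (- S) = 0"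
      using S finite_imp_closed[of S] by (subst pvm.emeasure_scal_eq_0_iff) auto
    then have "has_bochner_integral (scal_measure ip e x) f
        (\<Sum>a\<in>S. measure (scal_measure ip e x) {a} * f a)"
      using that S pvm.finite_measure_scal by (intro has_bochner_integral_finite_support) auto
    also have "(\<Sum>a\<in>S. measure (scal_measure ip e x) {a} * f a) = (\<Sum>a\<in>S. Re (ip (P a x) x) * f a)"
      by (intro sum.cong refl) (simp add: pvm.measure_scal e_def)
    finally show ?thesis .
  qed
  have meas: "(\<lambda>t :: real ^ 'n. t $ l) \<in> borel_measurable borel" for l
    by (intro borel_measurable_continuous_onI continuous_intros)
  have "spectral_tuple scale ip e T"
  proof
    show "integrable (scal_measure ip e x) (\<lambda>t. (t $ l)\<^sup>2)" for x l
      using spectral[of "\<lambda>t. (t $ l)\<^sup>2" x] meas[of l] by (auto simp: has_bochner_integral_iff)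
    show "ip (T l x) x = of_real (\<integral>t. t $ l \<partial>scal_measure ip e x)" for l x
    proof -
      have "ip (T l x) x = ip (T l (\<Sum>a\<in>S. P a x)) x" by (intro eqv_ip T_eqv P(4) eqv_refl)
      also have "\<dots> = (\<Sum>a\<in>S. a $ l * ip (P a x) x)"
        by (simp add: lin_sum[OF lin_T] ip_sum_left ip_T_component[OF P(3)])
      also have "\<dots> = of_real (\<Sum>a\<in>S. Re (ip (P a x) x) * a $ l)"
      proof -
        have "ip (P a x) x = of_real (Re (ip (P a x) x))" if "a \<in> S" for a
          using that ip_left[of "{a}" x x] ip_self_real[of "P a x"] by (simp add: e_def)
        then show ?thesis by (simp add: mult.commute)
      qed
      finally show ?thesis using spectral[OF meas[of l], of x] by (simp add: has_bochner_integral_iff)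
    qed
  qed
  moreover have "lin (e \<delta>)" for \<delta>
    unfolding e_def by (intro vsp.linear_compose_sum ballI P(1))
  moreover have "e \<delta> x \<in> vs.span B" for \<delta> x
    unfolding e_def by (intro vs.span_sum P(2))
  ultimately show ?thesis by (rule that)
qed

end

context spectral_tuple
begin

lemma e_eigenvector_sum:
  assumes "\<And>a. joint_eig T a (v a)" "finite S" "x \<doteq> (\<Sum>a\<in>S. v a)" "\<delta> \<in> sets borel"
  shows "e \<delta> x \<doteq> (\<Sum>a\<in>S \<inter> \<delta>. v a)"
proof -
  have "ip (e \<delta> x) z = ip (\<Sum>a\<in>S. e \<delta> (v a)) z" for z
    using eqv_ip[OF assms(3) eqv_refl] by (simp add: e_symmetric[OF assms(4)] ip_sum_left)
  then have "e \<delta> x \<doteq> (\<Sum>a\<in>S. e \<delta> (v a))" by (simp add: eqv_def)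
  also have "\<dots> \<doteq> (\<Sum>a\<in>S. if a \<in> \<delta> then v a else 0)"
    by (intro eqv_sum e_eigenvector assms)
  also have "(\<Sum>a\<in>S. if a \<in> \<delta> then v a else 0) = (\<Sum>a\<in>S \<inter> \<delta>. v a)"
    using assms(2) by (simp add: sum.inter_restrict)
  finally show ?thesis .
qed

lemma measure_scal_eigenvector_sum:
  assumes "\<And>a. joint_eig T a (v a)" "finite S" "x \<doteq> (\<Sum>a\<in>S. v a)" "\<delta> \<in> sets borel"
  shows "measure (scal x) \<delta> = (\<Sum>a\<in>S \<inter> \<delta>. Re (ip (v a) (v a)))"
proof -
  have "ip (e \<delta> x) x = ip (\<Sum>a\<in>S \<inter> \<delta>. v a) (\<Sum>a\<in>S. v a)"
    by (intro eqv_ip e_eigenvector_sum assms)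
  also have "\<dots> = (\<Sum>a\<in>S \<inter> \<delta> \<inter> S. ip (v a) (v a))"
    using assms by (intro ip_sum_orthogonal) auto
  also have "S \<inter> \<delta> \<inter> S = S \<inter> \<delta>" by auto
  finally show ?thesis using assms(4) by (simp add: measure_scal)
qed

end

text \<open>
  Both measures are computed from one and the same decomposition into joint eigenvectors.
\<close>

lemma scal_measure_unique:
  assumes "commuting_tuple sc ip T B" "spectral_tuple sc ip e T" "spectral_tuple sc ip e' T'"
    and eq: "\<And>l x y. ip (T l x) y = ip (T' l x) y"
  shows "scal_measure ip e x = scal_measure ip e' x"
proof -
  interpret commuting_tuple sc ip T B by fact
  interpret E: spectral_tuple sc ip e T by fact
  interpret E': spectral_tuple sc ip e' T' by fact
  obtain S v where S: "finite S" "\<And>a. joint_eig T a (v a)" "x \<doteq> (\<Sum>a\<in>S. v a)"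
    by (rule spectral_decomposition, rule that)
  have T': "joint_eig T' a (v a)" for a
    using S(2)[of a] by (simp add: joint_eig_def eqv_def eq)
  have "measure (E.scal x) \<delta> = measure (E'.scal x) \<delta>" if "\<delta> \<in> sets borel" for \<delta>
    using E.measure_scal_eigenvector_sum[OF S(2,1,3) that]
      E'.measure_scal_eigenvector_sum[OF T' S(1,3) that] by simp
  then show ?thesis
    using E.finite_measure_scal[of x] E'.finite_measure_scal[of x]
    by (intro measure_eqI) (auto simp: finite_measure.emeasure_eq_measure)
qed

section \<open>Moments of scalar measures\<close>

definition mpower :: "real ^ 'n \<Rightarrow> nat ^ 'n \<Rightarrow> real" where
  "mpower t u = (\<Prod>i\<in>UNIV. (t $ i) ^ (u $ i))"

lemma mpower_zero [simp]: "mpower t 0 = 1"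
  by (simp add: mpower_def)

lemma mpower_add: "mpower t (u + v) = mpower t u * mpower t v"
  by (simp add: mpower_def power_add prod.distrib)

lemma mpower_axis: "mpower t (axis l 1) = t $ l"
proof -
  have "mpower t (axis l 1) = (\<Prod>i\<in>UNIV. if i = l then t $ l else 1)"
    unfolding mpower_def by (intro prod.cong refl) (auto simp: axis_def)
  then show ?thesis by simp
qed

lemma mpower_measurable: "(\<lambda>t :: real ^ 'n. mpower t u) \<in> borel_measurable borel"
  unfolding mpower_def by (intro borel_measurable_continuous_onI continuous_intros)

locale commuting_spectral_tuple =
  commuting_tuple scale ip T B + spectral_tuple scale ip e T
  for scale :: "complex \<Rightarrow> 'a::ab_group_add \<Rightarrow> 'a" (infixr "\<odot>" 75) and ip
    and e :: "(real ^ 'n::finite) set \<Rightarrow> 'a \<Rightarrow> 'a" and T :: "'n \<Rightarrow> 'a \<Rightarrow> 'a" and B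
begin

text \<open>
  The vector \<open>X u\<close> is \<open>T\<^sup>u x\<close>, obtained from \<open>x\<close> by multiplying the component for the joint
  eigenvalue \<open>a\<close> by \<open>a\<^sup>u\<close>.
\<close>

lemma moment_vectors:
  obtains X where "X 0 \<doteq> x" "\<And>u l. T l (X u) \<doteq> X (u + axis l 1)" "\<And>u. X u \<in> vs.span B"
    "\<And>u v. \<exists>r. has_bochner_integral (scal x) (\<lambda>t. mpower t (u + v)) r \<and> ip (X u) (X v) = of_real r"
proof -
  obtain S v where S: "finite S" and v: "\<And>a. v a \<in> vs.span B" "\<And>a. joint_eig T a (v a)"
    and x: "x \<doteq> (\<Sum>a\<in>S. v a)"
    by (rule spectral_decomposition, rule that)
  define X where "X u = (\<Sum>a\<in>S. of_real (mpower a u) \<odot> v a)" for u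
  have eig: "joint_eig T a (of_real (mpower a u) \<odot> v a)" for a u
    using vs.subspace_scale[OF subspace_joint_eig[of T a, OF lin_T]] v(2) by simp
  have "X 0 \<doteq> x" using x by (simp add: X_def eqv_sym)
  moreover have "T l (X u) \<doteq> X (u + axis l 1)" for u l
  proof -
    have "T l (X u) = (\<Sum>a\<in>S. of_real (mpower a u) \<odot> T l (v a))"
      by (simp add: X_def lin_sum[OF lin_T] lin_scale[OF lin_T])
    also have "\<dots> \<doteq> (\<Sum>a\<in>S. of_real (mpower a u) \<odot> of_real (a $ l) \<odot> v a)"
      using v(2) by (intro eqv_sum eqv_scale) (simp add: joint_eig_def)
    also have "\<dots> = X (u + axis l 1)"
      unfolding X_def mpower_add mpower_axis by simp
    finally show ?thesis .
  qed
  moreover have "X u \<in> vs.span B" for u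
    unfolding X_def by (intro vs.span_sum vs.span_scale v)
  moreover have "\<exists>r. has_bochner_integral (scal x) (\<lambda>t. mpower t (u + w)) r \<and> ip (X u) (X w) = of_real r" for u w
  proof (intro exI conjI)
    note meas = measure_scal_eigenvector_sum[OF v(2) S x]
    interpret finite_measure "scal x" by (rule finite_measure_scal)
    have "- S \<in> sets borel" using S finite_imp_closed[of S] by auto
    then have "measure (scal x) (- S) = 0" by (subst meas) auto
    then have "emeasure (scal x) (- S) = 0" by (simp add: emeasure_eq_measure)
    then have "has_bochner_integral (scal x) (\<lambda>t. mpower t (u + w))
        (\<Sum>a\<in>S. measure (scal x) {a} * mpower a (u + w))"
      using S mpower_measurable finite_measure_scal by (intro has_bochner_integral_finite_support) auto
    also have "(\<Sum>a\<in>S. measure (scal x) {a} * mpower a (u + w)) =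
        (\<Sum>a\<in>S. Re (ip (v a) (v a)) * mpower a (u + w))"
      using meas by (intro sum.cong) auto
    finally show "has_bochner_integral (scal x) (\<lambda>t. mpower t (u + w))
        (\<Sum>a\<in>S. Re (ip (v a) (v a)) * mpower a (u + w))" .
    have "ip (X u) (X w) = (\<Sum>a\<in>S. of_real (mpower a u * mpower a w) * ip (v a) (v a))"
      unfolding X_def using eig S
      by (subst ip_sum_orthogonal) (auto simp: ip_scale_left ip_scale_right mult_ac)
    also have "\<dots> = of_real (\<Sum>a\<in>S. Re (ip (v a) (v a)) * mpower a (u + w))"
      by (simp add: mpower_add ip_self_real[symmetric] mult_ac)
    finally show "ip (X u) (X w) = of_real (\<Sum>a\<in>S. Re (ip (v a) (v a)) * mpower a (u + w))" .
  qed
  ultimately show ?thesis by (rule that)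
qed

end

section \<open>The moment form on polynomials\<close>

text \<open>Scalar multiplication in the form in which it enters \<^const>\<open>hscale\<close>.\<close>

definition smul :: "complex \<Rightarrow> 'n::finite mpol \<Rightarrow> 'n mpol" where
  "smul c p = Poly_Mapping.single 0 c * p"

definition mono_at :: "nat ^ 'n \<Rightarrow> 'n::finite mpol" where
  "mono_at m = Poly_Mapping.single m 1"

definition mul_var :: "'n \<Rightarrow> 'n::finite mpol \<Rightarrow> 'n mpol" where
  "mul_var l p = Poly_Mapping.single (axis l 1) 1 * p"

lemma smul_single: "smul c (Poly_Mapping.single m d) = Poly_Mapping.single m (c * d)"
  by (simp add: smul_def mult_single)

lemma single_eq_smul: "Poly_Mapping.single m c = smul c (mono_at m)"
  by (simp add: mono_at_def smul_single)

lemma lookup_smul: "Poly_Mapping.lookup (smul c p) m = c * Poly_Mapping.lookup p m"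
  unfolding smul_def mult_map_scale_conv_mult[symmetric]
  by (simp add: Poly_Mapping.map.rep_eq when_def)

lemma vector_space_smul: "vector_space smul"
  by unfold_locales (auto simp: smul_def algebra_simps single_add mult_single simp flip: mult.assoc)

lemma mul_var_mono: "mul_var l (mono_at m) = mono_at (m + axis l 1)"
  by (simp add: mul_var_def mono_at_def mult_single add.commute)

lemma linear_mul_var: "Vector_Spaces.linear smul smul (mul_var l)"
proof -
  interpret vector_space_pair smul smul
    by (intro vector_space_pair.intro vector_space_smul)
  show ?thesis by unfold_locales (auto simp: mul_var_def smul_def algebra_simps)
qed

lemma form_eq_quadratic:
  "form k \<rho> s p p = (\<Sum>m\<le>\<rho>. \<Sum>j\<le>\<rho>. cnj (Poly_Mapping.lookup p (k m)) * of_real (Gam k s m j) *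
     Poly_Mapping.lookup p (k j))"
  unfolding form_def Gam_def by (subst sum.swap) (simp add: mult_ac)

locale moment_data =
  fixes k :: "nat \<Rightarrow> nat ^ 'n::finite" and \<rho> :: nat and s :: "nat ^ 'n \<Rightarrow> real"
  assumes inj_k: "inj_on k {..\<rho>}" and psd: "psd_on {..\<rho>} (Gam k s)"
begin

abbreviation "ip \<equiv> form k \<rho> s"
abbreviation "V \<equiv> Lin_monomials k {..\<rho>}"
abbreviation "K \<equiv> k ` {..\<rho>}"

sublocale semidefinite_form smul ip
proof -
  interpret vector_space smul by (rule vector_space_smul)
  show "semidefinite_form smul ip"
  proof
    show "ip (x + y) z = ip x z + ip y z" for x y z
      by (simp add: form_def lookup_add algebra_simps sum.distrib)
    show "ip (smul c x) y = c * ip x y" for c x y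
      by (simp add: form_def lookup_smul sum_distrib_left mult.assoc)
    show "ip y x = cnj (ip x y)" for x y
      unfolding form_def by (subst sum.swap) (simp add: mult_ac add.commute)
    show "0 \<le> Re (ip x x)" for x
      using psd unfolding psd_on_def form_eq_quadratic
      by (auto dest!: spec[of _ "\<lambda>j. Poly_Mapping.lookup x (k j)"] simp: complex_nonneg_Reals_iff)
  qed
qed

notation eqv (infix "\<doteq>" 50)

lemma Lin_monomials_eq_span:
  assumes "finite J"
  shows "Lin_monomials k J = vs.span (mono_at ` k ` J)"
proof
  show "Lin_monomials k J \<subseteq> vs.span (mono_at ` k ` J)"
    unfolding Lin_monomials_def single_eq_smul
    by (auto intro!: vs.span_sum vs.span_scale intro: vs.span_base)
  have "vs.subspace (Lin_monomials k J)"
    unfolding vs.subspace_def Lin_monomials_def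
  proof (intro conjI ballI allI)
    show "0 \<in> {\<Sum>j\<in>J. Poly_Mapping.single (k j) (\<alpha> j) |\<alpha>. True}"
      by (auto intro!: exI[of _ "\<lambda>j. 0"])
    show "x + y \<in> {\<Sum>j\<in>J. Poly_Mapping.single (k j) (\<alpha> j) |\<alpha>. True}"
      if "x \<in> {\<Sum>j\<in>J. Poly_Mapping.single (k j) (\<alpha> j) |\<alpha>. True}"
        "y \<in> {\<Sum>j\<in>J. Poly_Mapping.single (k j) (\<alpha> j) |\<alpha>. True}" for x y
    proof -
      obtain \<alpha> \<beta> where "x = (\<Sum>j\<in>J. Poly_Mapping.single (k j) (\<alpha> j))"
        "y = (\<Sum>j\<in>J. Poly_Mapping.single (k j) (\<beta> j))" using \<open>x \<in> _\<close> \<open>y \<in> _\<close> by blast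
      then show ?thesis
        by (auto intro!: exI[of _ "\<lambda>j. \<alpha> j + \<beta> j"] simp: single_add sum.distrib)
    qed
    show "smul c x \<in> {\<Sum>j\<in>J. Poly_Mapping.single (k j) (\<alpha> j) |\<alpha>. True}"
      if "x \<in> {\<Sum>j\<in>J. Poly_Mapping.single (k j) (\<alpha> j) |\<alpha>. True}" for c x
    proof -
      obtain \<alpha> where "x = (\<Sum>j\<in>J. Poly_Mapping.single (k j) (\<alpha> j))" using \<open>x \<in> _\<close> by blast
      then show ?thesis
        by (auto intro!: exI[of _ "\<lambda>j. c * \<alpha> j"] simp: vs.scale_sum_right smul_single)
    qed
  qed
  moreover have "mono_at (k i) \<in> Lin_monomials k J" if "i \<in> J" for i
  proof -
    have "(\<Sum>j\<in>J. Poly_Mapping.single (k j) (if j = i then 1 else 0 :: complex)) =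
        (\<Sum>j\<in>J. if j = i then mono_at (k i) else 0)"
      by (intro sum.cong) (auto simp: mono_at_def)
    then show ?thesis
      using that assms unfolding Lin_monomials_def
      by (auto intro!: exI[of _ "\<lambda>j. if j = i then 1 else 0 :: complex"])
  qed
  ultimately show "vs.span (mono_at ` k ` J) \<subseteq> Lin_monomials k J"
    by (intro vs.span_minimal) auto
qed

lemma V_eq_span: "V = vs.span (mono_at ` K)"
  by (simp add: Lin_monomials_eq_span)

lemma subspace_V: "vs.subspace V"
  by (simp add: V_eq_span)

lemma mono_in_V: "u \<in> K \<Longrightarrow> mono_at u \<in> V"
  by (simp add: V_eq_span vs.span_base)

lemma Lin_monomials_mono:
  assumes "J \<subseteq> {..\<rho>}"
  shows "Lin_monomials k J \<subseteq> V"
  unfolding Lin_monomials_eq_span[OF finite_subset[OF assms finite_atMost]] V_eq_span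
  using assms by (intro vs.span_mono image_mono)

text \<open>
  The form sees only coefficients at exponents in \<open>K\<close>, so it is defined on all polynomials, and every
  polynomial is equivalent to its part with exponents in \<open>K\<close>.
\<close>

definition trunc :: "'n mpol \<Rightarrow> 'n mpol" where
  "trunc p = (\<Sum>j\<le>\<rho>. Poly_Mapping.single (k j) (Poly_Mapping.lookup p (k j)))"

lemma trunc_in_V: "trunc p \<in> V"
  by (auto simp: trunc_def Lin_monomials_def)

lemma lookup_trunc: "j \<le> \<rho> \<Longrightarrow> Poly_Mapping.lookup (trunc p) (k j) = Poly_Mapping.lookup p (k j)"
proof -
  assume j: "j \<le> \<rho>"
  have "Poly_Mapping.lookup (trunc p) (k j) =
      (\<Sum>i\<le>\<rho>. if i = j then Poly_Mapping.lookup p (k j) else 0)"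
    unfolding trunc_def lookup_sum
    using inj_k j by (intro sum.cong) (auto simp: lookup_single when_def inj_on_def)
  then show ?thesis using j by simp
qed

lemma trunc_eqv: "trunc p \<doteq> p"
  by (simp add: eqv_def form_def lookup_trunc cong: sum.cong_simp)

lemma trunc_add: "trunc (p + q) = trunc p + trunc q"
  by (simp add: trunc_def lookup_add single_add sum.distrib)

lemma trunc_smul: "trunc (smul c p) = smul c (trunc p)"
  by (simp add: trunc_def lookup_smul vs.scale_sum_right smul_single)

lemma trunc_id: "p \<in> V \<Longrightarrow> trunc p = p"
proof -
  have "trunc (mono_at (k i)) = mono_at (k i)" if "i \<le> \<rho>" for i
  proof -
    have "trunc (mono_at (k i)) = (\<Sum>j\<le>\<rho>. if j = i then mono_at (k i) else 0)"
      unfolding trunc_def mono_at_def using that inj_k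
      by (intro sum.cong) (auto simp: lookup_single when_def inj_on_def)
    then show ?thesis using that by simp
  qed
  moreover have "vs.subspace {p. trunc p = p}"
    by (auto simp: vs.subspace_def trunc_add trunc_smul) (simp add: trunc_def)
  ultimately have "V \<subseteq> {p. trunc p = p}"
    unfolding V_eq_span by (intro vs.span_minimal) auto
  then show "p \<in> V \<Longrightarrow> trunc p = p" by auto
qed

lemma ip_mono:
  assumes "u \<in> K" "v \<in> K"
  shows "ip (mono_at u) (mono_at v) = of_real (s (u + v))"
proof -
  obtain i j where ij: "i \<le> \<rho>" "j \<le> \<rho>" "u = k i" "v = k j" using assms by auto
  have l: "Poly_Mapping.lookup (mono_at (k i)) (k m) = (if m = i then 1 else 0)"
    if "i \<le> \<rho>" "m \<le> \<rho>" for i m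
    using that inj_k by (auto simp: mono_at_def lookup_single when_def inj_on_def)
  have "ip (mono_at u) (mono_at v) =
      (\<Sum>i'\<le>\<rho>. \<Sum>j'\<le>\<rho>. if j' = j then (if i' = i then of_real (s (u + v)) else 0) else 0)"
    unfolding form_def ij(3,4) using ij(1,2) l by (intro sum.cong refl) auto
  also have "\<dots> = of_real (s (u + v))" using ij by simp
  finally show ?thesis .
qed

lemma ip_eq_zero_if_monomials:
  assumes "finite J" "p \<in> Lin_monomials k J" "lin F"
    and "\<And>j. j \<in> J \<Longrightarrow> ip q (F (mono_at (k j))) = 0"
  shows "ip q (F p) = 0"
proof -
  have "vs.subspace {p. ip q (F p) = 0}"
    by (auto simp: vs.subspace_def lin_zero[OF assms(3)] lin_add[OF assms(3)] lin_scale[OF assms(3)]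
        ip_add_right ip_scale_right)
  then have "vs.span (mono_at ` k ` J) \<subseteq> {p. ip q (F p) = 0}"
    using assms(4) by (intro vs.span_minimal) auto
  then show ?thesis using assms(1,2) by (auto simp: Lin_monomials_eq_span)
qed

lemma eqv_if_moments_eq:
  assumes "\<And>u. u \<in> K \<Longrightarrow> ip p (mono_at u) = ip q (mono_at u)"
  shows "p \<doteq> q"
proof -
  have "ip (p - q) z = 0" for z
  proof -
    have "ip (p - q) z = ip (p - q) (trunc z)"
      using eqv_ip[OF eqv_refl trunc_eqv] by metis
    also have "\<dots> = 0"
      using ip_eq_zero_if_monomials[of "{..\<rho>}" "trunc z" id "p - q"] assms trunc_in_V
        vs.linear_id[unfolded id_def] 
      by (simp add: ip_diff_left id_def)
    finally show ?thesis .
  qed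
  then show ?thesis by (simp add: eqv_iff)
qed

lemma linear_eqv_on_V:
  assumes "lin F" "lin G" "\<And>u. u \<in> K \<Longrightarrow> F (mono_at u) \<doteq> G (mono_at u)" "p \<in> V"
  shows "F p \<doteq> G p"
proof -
  have "vs.subspace {p. F p \<doteq> G p}"
    using assms(1,2)
    by (auto simp: vs.subspace_def lin_zero lin_add lin_scale eqv_add eqv_scale)
  then have "V \<subseteq> {p. F p \<doteq> G p}"
    unfolding V_eq_span using assms(3) by (intro vs.span_minimal) auto
  then show ?thesis using assms(4) by auto
qed

lemma ip_mul_var_mono:
  assumes "i \<in> Omega k \<rho> l" "j \<in> Omega k \<rho> l"
  shows "ip (mul_var l (mono_at (k j))) (mul_var l (mono_at (k i))) = of_real (Gam_hat k s l i j)"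
  using assms by (simp add: Omega_def mul_var_mono ip_mono Gam_hat_def)

lemma finite_Omega: "finite (Omega k \<rho> l)" and Omega_subset: "Omega k \<rho> l \<subseteq> {..\<rho>}"
  by (auto simp: Omega_def)

text \<open>
  The condition says that multiplication by the variable preserves null vectors.  Coefficient vectors
  in the kernel of \<open>\<Gamma>\<^sub>l\<close> are null polynomials supported on \<open>\<Omega>\<^sub>l\<close>, and the matrix
  with the hat is the Gram matrix of the shifted monomials.
\<close>

lemma kernel_condition_iff:
  "Ker_on (Omega k \<rho> l) (Gam k s) \<subseteq> Ker_on (Omega k \<rho> l) (Gam_hat k s l) \<longleftrightarrow>
   (\<forall>p\<in>Lin_monomials k (Omega k \<rho> l). p \<doteq> 0 \<longrightarrow> mul_var l p \<doteq> 0)"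
proof -
  let ?J = "Omega k \<rho> l"
  define pol where "pol x = (\<Sum>j\<in>?J. Poly_Mapping.single (k j) (x j))" for x :: "nat \<Rightarrow> complex"
  have pol: "pol x = (\<Sum>j\<in>?J. smul (x j) (mono_at (k j)))" for x
    by (simp add: pol_def single_eq_smul)
  have pol_in: "pol x \<in> Lin_monomials k ?J" for x by (auto simp: pol_def Lin_monomials_def)
  have gam: "(\<Sum>j\<in>?J. of_real (Gam k s m j) * x j) = ip (pol x) (mono_at (k m))" if "m \<in> ?J" for x m
    using that Omega_subset[of l] unfolding pol ip_sum_left ip_scale_left
    by (intro sum.cong refl) (auto simp: ip_mono Gam_def mult.commute subset_iff)
  have gam_hat: "(\<Sum>j\<in>?J. of_real (Gam_hat k s l m j) * x j) =
      ip (mul_var l (pol x)) (mul_var l (mono_at (k m)))" if "m \<in> ?J" for x m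
    using that unfolding pol lin_sum[OF linear_mul_var] lin_scale[OF linear_mul_var] ip_sum_left ip_scale_left
    by (intro sum.cong refl) (auto simp: ip_mul_var_mono mult.commute)
  have null: "pol x \<doteq> 0 \<longleftrightarrow> (\<forall>m\<in>?J. (\<Sum>j\<in>?J. of_real (Gam k s m j) * x j) = 0)" for x
    using ip_eq_zero_if_monomials[OF finite_Omega pol_in vs.linear_id, of "pol x"]
    by (auto simp: gam eqv_zero_iff eqv_def id_def dest: isotropic_imp_orthogonal)
  have null_hat: "mul_var l (pol x) \<doteq> 0 \<longleftrightarrow>
      (\<forall>m\<in>?J. (\<Sum>j\<in>?J. of_real (Gam_hat k s l m j) * x j) = 0)" for x
    using ip_eq_zero_if_monomials[OF finite_Omega pol_in linear_mul_var, of "mul_var l (pol x)"]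
    by (auto simp: gam_hat eqv_zero_iff dest: isotropic_imp_orthogonal)
  have restr: "pol (restrict x ?J) = pol x" for x
    by (simp add: pol_def cong: sum.cong)
  have "Ker_on ?J (Gam k s) = {x \<in> ?J \<rightarrow>\<^sub>E UNIV. pol x \<doteq> 0}"
    "Ker_on ?J (Gam_hat k s l) = {x \<in> ?J \<rightarrow>\<^sub>E UNIV. mul_var l (pol x) \<doteq> 0}"
    by (auto simp: Ker_on_def null null_hat)
  moreover have "Lin_monomials k ?J = pol ` (?J \<rightarrow>\<^sub>E UNIV)"
  proof -
    have "pol x \<in> pol ` (?J \<rightarrow>\<^sub>E UNIV)" for x
      by (rule image_eqI[of _ _ "restrict x ?J"]) (auto simp: restr)
    then show ?thesis by (auto simp: Lin_monomials_def pol_def)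
  qed
  ultimately show ?thesis by auto
qed

end

context moment_data
begin

abbreviation "N \<equiv> null_space k \<rho> s"
abbreviation "cl \<equiv> cls k \<rho> s"
abbreviation "H \<equiv> Hilb k \<rho> s"

section \<open>The quotient space\<close>

lemma null_space_eq: "N = {p \<in> V. p \<doteq> 0}"
  by (simp add: null_space_def eqv_zero_iff)

lemma subspace_N: "vs.subspace N"
  unfolding null_space_eq using vs.subspace_inter[OF subspace_V subspace_eqv_zero]
  by (simp add: Collect_conj_eq)

lemma mem_cls_iff:
  assumes "p \<in> V"
  shows "q \<in> cl p \<longleftrightarrow> q \<in> V \<and> q \<doteq> p"
proof -
  have "q \<in> cl p \<longleftrightarrow> q - p \<in> N"
    by (simp add: cls_def set_minus_plus)
  also have "\<dots> \<longleftrightarrow> q - p \<in> V \<and> q \<doteq> p"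
    by (simp add: null_space_eq eqv_diff_zero_iff[of q p])
  also have "q - p \<in> V \<longleftrightarrow> q \<in> V"
    using vs.subspace_add[OF subspace_V, of "q - p" p] vs.subspace_diff[OF subspace_V, of q p] assms
    by auto
  finally show ?thesis .
qed

lemma cls_eq_iff:
  assumes "p \<in> V" "q \<in> V"
  shows "cl p = cl q \<longleftrightarrow> p \<doteq> q"
proof
  assume "cl p = cl q"
  then have "p \<in> cl q" using mem_cls_iff[OF assms(1), of p] assms(1) by simp
  then show "p \<doteq> q" by (simp add: mem_cls_iff[OF assms(2)])
next
  assume "p \<doteq> q"
  then have "r \<doteq> p \<longleftrightarrow> r \<doteq> q" for r by (auto simp: eqv_def)
  then show "cl p = cl q" using assms by (auto simp: mem_cls_iff)
qed

lemma Hilb_eq: "H = cl ` V"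
  by (simp add: Hilb_def)

lemma cls_in_Hilb [simp]: "p \<in> V \<Longrightarrow> cl p \<in> H"
  by (simp add: Hilb_eq)

definition rep :: "'n mpol set \<Rightarrow> 'n mpol" where
  "rep x = (SOME p. p \<in> x)"

lemma rep_cls:
  assumes "p \<in> V"
  shows "rep (cl p) \<in> V" "rep (cl p) \<doteq> p"
proof -
  have "p \<in> cl p" using assms by (simp add: mem_cls_iff)
  then have "rep (cl p) \<in> cl p" unfolding rep_def by (rule someI)
  then show "rep (cl p) \<in> V" "rep (cl p) \<doteq> p" using assms by (auto simp: mem_cls_iff)
qed

lemma rep_Hilb:
  assumes "x \<in> H"
  shows "rep x \<in> V" "cl (rep x) = x"
proof -
  obtain p where p: "p \<in> V" "x = cl p" using assms by (auto simp: Hilb_eq)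
  then show "rep x \<in> V" "cl (rep x) = x"
    using rep_cls[OF p(1)] cls_eq_iff[OF rep_cls(1)[OF p(1)] p(1)] by auto
qed

lemma hinner_cls: "p \<in> V \<Longrightarrow> q \<in> V \<Longrightarrow> hinner k \<rho> s (cl p) (cl q) = ip p q"
  unfolding hinner_def rep_def[symmetric] by (intro eqv_ip rep_cls)

lemma cls_add: "cl p + cl q = cl (p + q)"
proof -
  have "N + N = N"
    using vs.subspace_0[OF subspace_N] vs.subspace_add[OF subspace_N]
    by (force simp: set_plus_def)
  then show ?thesis by (simp add: cls_def set_plus_rearrange)
qed

lemma cls_zero: "cl 0 = N"
  by (simp add: cls_def elt_set_plus_def)

lemma hscale_cls: "hscale k \<rho> s c (cl p) = cl (smul c p)"
proof -
  have "hscale k \<rho> s c (cl p) = N + smul c ` ((+) p ` N)"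
  proof -
    have "cl p = (+) p ` N" by (auto simp: cls_def elt_set_plus_def)
    moreover have "Poly_Mapping.single 0 c *o X = smul c ` X" for X :: "'n mpol set"
      by (auto simp: elt_set_times_def smul_def)
    ultimately show ?thesis by (simp add: hscale_def)
  qed
  also have "\<dots> = (+) (smul c p) ` N"
  proof (intro equalityI subsetI)
    fix x assume "x \<in> N + smul c ` ((+) p ` N)"
    then obtain m n where "m \<in> N" "n \<in> N" "x = m + smul c (p + n)" by (auto simp: set_plus_def)
    moreover have "m + smul c n \<in> N"
      using calculation subspace_N by (simp add: vs.subspace_add vs.subspace_scale)
    ultimately show "x \<in> (+) (smul c p) ` N"
      by (intro image_eqI[of _ _ "m + smul c n"]) (auto simp: vs.scale_right_distrib algebra_simps)
  next
    fix x assume "x \<in> (+) (smul c p) ` N"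
    then obtain n where "n \<in> N" "x = n + smul c (p + 0)" by (auto simp: algebra_simps)
    then show "x \<in> N + smul c ` ((+) p ` N)"
      using vs.subspace_0[OF subspace_N] by (auto intro!: set_plus_intro)
  qed
  also have "\<dots> = cl (smul c p)" by (auto simp: cls_def elt_set_plus_def)
  finally show ?thesis .
qed

text \<open>
  The extra null space in the definition of \<^const>\<open>hlincomb\<close> is the class of \<open>0\<close>, with which the
  induction starts.
\<close>

lemma hlincomb_eq:
  assumes "B \<subseteq> H" "finite B"
  shows "hlincomb k \<rho> s B c = cl (\<Sum>b\<in>B. smul (c b) (rep b))"
proof -
  have "N + (\<Sum>b\<in>B. hscale k \<rho> s (c b) b) = cl (\<Sum>b\<in>B. smul (c b) (rep b))"
    using assms(2,1)
  proof (induction B rule: finite_induct)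
    case empty
    then show ?case by (simp add: cls_zero)
  next
    case (insert b B)
    have "hscale k \<rho> s (c b) b = cl (smul (c b) (rep b))"
      using hscale_cls[of "c b" "rep b"] rep_Hilb insert.prems by simp
    then have "N + (\<Sum>b\<in>insert b B. hscale k \<rho> s (c b) b) =
        cl (smul (c b) (rep b)) + (N + (\<Sum>b\<in>B. hscale k \<rho> s (c b) b))"
      using insert.hyps by (simp add: add_ac)
    also have "\<dots> = cl (\<Sum>b\<in>insert b B. smul (c b) (rep b))"
      using insert by (simp add: cls_add)
    finally show ?case .
  qed
  then show ?thesis by (simp add: hlincomb_def)
qed

subsection \<open>Dimension\<close>

text \<open>
  This linear map vanishes exactly on the null vectors.  It embeds the quotient in the polynomials,
  where the dimension theory of vector spaces applies.
\<close>

definition gram :: "'n mpol \<Rightarrow> 'n mpol" where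
  "gram p = (\<Sum>m\<le>\<rho>. smul (ip p (mono_at (k m))) (mono_at (k m)))"

lemma lin_gram: "lin gram"
  by unfold_locales (auto simp: gram_def ip_add_left ip_scale_left vs.scale_left_distrib
      vs.scale_sum_right sum.distrib)

lemma gram_eq_iff: "gram p = gram q \<longleftrightarrow> p \<doteq> q"
proof
  assume "p \<doteq> q"
  then show "gram p = gram q" by (simp add: gram_def eqv_def)
next
  assume eq: "gram p = gram q"
  have l: "Poly_Mapping.lookup (gram p) (k j) = ip p (mono_at (k j))" if "j \<le> \<rho>" for p j
  proof -
    have "Poly_Mapping.lookup (gram p) (k j) = (\<Sum>m\<le>\<rho>. if m = j then ip p (mono_at (k j)) else 0)"
      unfolding gram_def lookup_sum mono_at_def smul_single
      using that inj_k by (intro sum.cong) (auto simp: lookup_single when_def inj_on_def)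
    then show ?thesis using that by simp
  qed
  show "p \<doteq> q" using l[of _ p] l[of _ q] eq by (intro eqv_if_moments_eq) force
qed

lemma gram_in_V: "gram p \<in> V"
  unfolding gram_def by (intro vs.subspace_sum vs.subspace_scale subspace_V mono_in_V) auto

lemma finite_independent_in_V:
  assumes "vs.independent C" "C \<subseteq> V"
  shows "finite C"
  using vs.independent_span_bound[of "mono_at ` K" C] assms by (simp add: V_eq_span)

lemma card_hbasis:
  assumes U: "U \<subseteq> V" "vs.subspace U" and B: "hbasis k \<rho> s (cl ` U) B"
  shows "card B = vs.dim (gram ` U)"
proof -
  have finB: "finite B" and BU: "B \<subseteq> cl ` U"
    and ind: "\<And>c. hlincomb k \<rho> s B c = cl 0 \<Longrightarrow> \<forall>b\<in>B. c b = 0"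
    and gen: "cl ` U = {hlincomb k \<rho> s B c |c. True}"
    using B by (auto simp: hbasis_def)
  have BH: "B \<subseteq> H" using BU U by (auto simp: Hilb_eq)
  note lc = hlincomb_eq[OF BH finB]
  have inj: "inj_on (\<lambda>b. gram (rep b)) B"
  proof (rule inj_onI)
    fix b b' assume b: "b \<in> B" "b' \<in> B" "gram (rep b) = gram (rep b')"
    then have "cl (rep b) = cl (rep b')"
      using BH rep_Hilb(1) by (simp add: subset_iff gram_eq_iff cls_eq_iff)
    then show "b = b'" using b BH rep_Hilb(2) by auto
  qed
  define D where "D = (\<lambda>b. gram (rep b)) ` B"
  have sumV: "(\<Sum>b\<in>B. smul (c b) (rep b)) \<in> V" for c
    using BH rep_Hilb by (intro vs.subspace_sum vs.subspace_scale subspace_V) auto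
  have gram_sum: "gram (\<Sum>b\<in>B. smul (c b) (rep b)) = (\<Sum>b\<in>B. smul (c b) (gram (rep b)))" for c
    by (simp add: lin_sum[OF lin_gram] lin_scale[OF lin_gram])
  have "vs.independent D"
  proof
    assume "vs.dependent D"
    then obtain u where u: "\<exists>v\<in>D. u v \<noteq> 0" "(\<Sum>v\<in>D. smul (u v) v) = 0"
      using vs.dependent_finite[of D] finB by (auto simp: D_def)
    have "gram (\<Sum>b\<in>B. smul (u (gram (rep b))) (rep b)) = gram 0"
      using u(2) by (simp add: gram_sum D_def sum.reindex[OF inj] lin_zero[OF lin_gram])
    then have "hlincomb k \<rho> s B (\<lambda>b. u (gram (rep b))) = cl 0"
      using sumV vs.subspace_0[OF subspace_V] by (simp add: lc gram_eq_iff cls_eq_iff)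
    from ind[OF this] show False using u(1) by (auto simp: D_def)
  qed
  moreover have "D \<subseteq> gram ` U"
  proof
    fix d assume "d \<in> D"
    then obtain p where "p \<in> U" "d = gram (rep (cl p))" using BU by (auto simp: D_def)
    then show "d \<in> gram ` U" using rep_cls(2)[of p] U by (auto simp: gram_eq_iff)
  qed
  moreover have "gram ` U \<subseteq> vs.span D"
  proof
    fix d assume "d \<in> gram ` U"
    then obtain p where p: "p \<in> U" "d = gram p" by auto
    then have "cl p \<in> cl ` U" by simp
    then obtain c where "cl p = hlincomb k \<rho> s B c" unfolding gen by blast
    then have "p \<doteq> (\<Sum>b\<in>B. smul (c b) (rep b))"
      using p U sumV by (simp add: lc cls_eq_iff subset_iff)
    then have "d = (\<Sum>b\<in>B. smul (c b) (gram (rep b)))"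
      using p by (simp add: gram_eq_iff flip: gram_sum)
    also have "\<dots> \<in> vs.span D"
      by (intro vs.span_sum vs.span_scale vs.span_base) (auto simp: D_def)
    finally show "d \<in> vs.span D" .
  qed
  ultimately have "card D = vs.dim (gram ` U)" by (intro vs.basis_card_eq_dim)
  then show ?thesis by (simp add: D_def card_image[OF inj])
qed

lemma exists_hbasis:
  assumes U: "U \<subseteq> V" "vs.subspace U"
  shows "\<exists>B. hbasis k \<rho> s (cl ` U) B"
proof -
  obtain C where C: "C \<subseteq> gram ` U" "vs.independent C" "gram ` U \<subseteq> vs.span C"
    using vs.maximal_independent_subset[of "gram ` U"] by auto
  then have finC: "finite C" using gram_in_V by (intro finite_independent_in_V) auto
  obtain r where r: "\<And>d. d \<in> C \<Longrightarrow> r d \<in> U \<and> gram (r d) = d"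
    using C(1) by (metis f_inv_into_f inv_into_into subsetD)
  define b where "b d = cl (r d)" for d
  define B where "B = b ` C"
  have rV: "r d \<in> V" if "d \<in> C" for d using that r U by auto
  have gb: "gram (rep (b d)) = d" if "d \<in> C" for d
    using that r rep_cls(2)[OF rV] gram_eq_iff by (metis b_def)
  have inj: "inj_on b C" by (metis gb inj_onI)
  have finB: "finite B" and BU: "B \<subseteq> cl ` U" using finC r by (auto simp: B_def b_def)
  then have BH: "B \<subseteq> H" using U by (auto simp: Hilb_eq)
  note lc = hlincomb_eq[OF BH finB]
  have sumV: "(\<Sum>b\<in>B. smul (c b) (rep b)) \<in> V" for c
    using BH rep_Hilb by (intro vs.subspace_sum vs.subspace_scale subspace_V) auto
  have gram_sum: "gram (\<Sum>b\<in>B. smul (c b) (rep b)) = (\<Sum>d\<in>C. smul (c (b d)) d)" for c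
    by (simp add: B_def sum.reindex[OF inj] lin_sum[OF lin_gram] lin_scale[OF lin_gram] gb)
  have gram_r: "gram (\<Sum>d\<in>C. smul (u d) (r d)) = (\<Sum>d\<in>C. smul (u d) d)" for u
    by (simp add: lin_sum[OF lin_gram] lin_scale[OF lin_gram] r)
  have sumU: "(\<Sum>d\<in>C. smul (u d) (r d)) \<in> U" for u
    using r by (intro vs.subspace_sum vs.subspace_scale U) auto
  have "\<forall>x\<in>B. c x = 0" if "hlincomb k \<rho> s B c = cl 0" for c
  proof -
    have "gram (\<Sum>b\<in>B. smul (c b) (rep b)) = gram 0"
      using that sumV vs.subspace_0[OF subspace_V] by (simp add: lc gram_eq_iff cls_eq_iff)
    then have "(\<Sum>d\<in>C. smul (c (b d)) d) = 0" by (simp add: gram_sum lin_zero[OF lin_gram])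
    then show ?thesis using C(2) finC vs.dependent_finite[of C] by (auto simp: B_def)
  qed
  moreover have "cl ` U = {hlincomb k \<rho> s B c |c. True}"
  proof (intro equalityI subsetI)
    fix x assume "x \<in> cl ` U"
    then obtain p where p: "p \<in> U" "x = cl p" by auto
    then have "gram p \<in> vs.span C" using C(3) by auto
    then obtain u where u: "gram p = (\<Sum>d\<in>C. smul (u d) d)" using vs.span_finite[OF finC] by auto
    define c where "c x = u (gram (rep x))" for x
    have "gram (\<Sum>b\<in>B. smul (c b) (rep b)) = gram p"
      unfolding gram_sum u by (intro sum.cong) (auto simp: c_def gb)
    then have "x = hlincomb k \<rho> s B c"
      using p U sumV by (simp add: lc cls_eq_iff subset_iff gram_eq_iff eqv_sym)
    then show "x \<in> {hlincomb k \<rho> s B c |c. True}" by blast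
  next
    fix x assume "x \<in> {hlincomb k \<rho> s B c |c. True}"
    then obtain c where x: "x = hlincomb k \<rho> s B c" by blast
    have "(\<Sum>b\<in>B. smul (c b) (rep b)) \<doteq> (\<Sum>d\<in>C. smul (c (b d)) (r d))"
      unfolding gram_eq_iff[symmetric] gram_sum gram_r ..
    moreover have "(\<Sum>d\<in>C. smul (c (b d)) (r d)) \<in> V" by (rule subsetD[OF U(1) sumU])
    ultimately have "x = cl (\<Sum>d\<in>C. smul (c (b d)) (r d))"
      using sumV by (simp add: x lc cls_eq_iff)
    then show "x \<in> cl ` U" using sumU[of "\<lambda>d. c (b d)"] by (simp add: imageI)
  qed
  ultimately show ?thesis using finB BU unfolding hbasis_def by blast
qed

lemma hdim_eq_dim_gram:
  assumes "U \<subseteq> V" "vs.subspace U"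
  shows "hdim k \<rho> s (cl ` U) = vs.dim (gram ` U)"
  unfolding hdim_def using card_hbasis[OF assms someI_ex[OF exists_hbasis[OF assms]]] .

lemma Hilb_Lin_eq_Hilb_iff:
  assumes "J \<subseteq> {..\<rho>}"
  shows "hdim k \<rho> s H = hdim k \<rho> s (Hilb_Lin k \<rho> s J) \<longleftrightarrow> H = Hilb_Lin k \<rho> s J"
proof
  let ?U = "Lin_monomials k J"
  have U: "?U \<subseteq> V" "vs.subspace ?U"
    using Lin_monomials_mono[OF assms] finite_subset[OF assms] by (auto simp: Lin_monomials_eq_span)
  assume "hdim k \<rho> s H = hdim k \<rho> s (Hilb_Lin k \<rho> s J)"
  then have "vs.dim (gram ` ?U) = vs.dim (gram ` V)"
    using hdim_eq_dim_gram[OF order_refl subspace_V] hdim_eq_dim_gram[OF U]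
    by (simp add: Hilb_eq Hilb_Lin_def)
  then have eq: "gram ` ?U = gram ` V"
    using U gram_in_V
    by (intro subspace_eq_if_dim_eq[of _ _ "mono_at ` K"] vsp.linear_subspace_image lin_gram subspace_V)
      (auto simp flip: V_eq_span)
  have "cl ` V \<subseteq> cl ` ?U"
  proof
    fix x assume "x \<in> cl ` V"
    then obtain p where p: "p \<in> V" "x = cl p" by auto
    then obtain q where q: "q \<in> ?U" "gram p = gram q" using eq by blast
    then have "x = cl q" using p U by (simp add: gram_eq_iff cls_eq_iff subset_iff)
    then show "x \<in> cl ` ?U" using q by blast
  qed
  then show "H = Hilb_Lin k \<rho> s J" using U by (auto simp: Hilb_eq Hilb_Lin_def)
qed simp

text \<open>
  The span of the monomials over \<open>\<Omega>\<^sub>0\<close> is a subspace of \<open>H\<close>, so equal dimensions mean equal spaces.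
\<close>

lemma dimensionally_stable_iff:
  "dimensionally_stable k \<rho> s \<longleftrightarrow> (\<forall>p\<in>V. \<exists>q\<in>Lin_monomials k (Omega0 k \<rho>). p \<doteq> q)"
proof -
  have J: "Omega0 k \<rho> \<subseteq> {..\<rho>}" by (auto simp: Omega0_def)
  have "dimensionally_stable k \<rho> s \<longleftrightarrow> H = Hilb_Lin k \<rho> s (Omega0 k \<rho>)"
    unfolding dimensionally_stable_def by (rule Hilb_Lin_eq_Hilb_iff[OF J])
  also have "\<dots> \<longleftrightarrow> cl ` V \<subseteq> cl ` Lin_monomials k (Omega0 k \<rho>)"
    using Lin_monomials_mono[OF J] by (auto simp: Hilb_eq Hilb_Lin_def)
  also have "\<dots> \<longleftrightarrow> (\<forall>p\<in>V. \<exists>q\<in>Lin_monomials k (Omega0 k \<rho>). cl p = cl q)"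
    by (auto simp: image_subset_iff image_iff)
  also have "\<dots> \<longleftrightarrow> (\<forall>p\<in>V. \<exists>q\<in>Lin_monomials k (Omega0 k \<rho>). p \<doteq> q)"
    using Lin_monomials_mono[OF J] by (intro ball_cong bex_cong refl cls_eq_iff) auto
  finally show ?thesis .
qed

subsection \<open>Operators\<close>

text \<open>
  Precomposing with \<open>trunc\<close> defines the lift, and makes it symmetric, on all polynomials.
\<close>

lemma operator_lift:
  assumes A: "selfadjoint_op k \<rho> s A"
  obtains T where "lin T" "\<And>x. T x \<in> V" "\<And>p. p \<in> V \<Longrightarrow> cl (T p) = A (cl p)"
    "\<And>x y. ip (T x) y = ip x (T y)"
proof -
  define f where "f p = rep (A (cl (trunc p)))" for p
  have AH: "A x \<in> H" if "x \<in> H" for x using that A by (auto simp: selfadjoint_op_def)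
  have fV: "f p \<in> V" and clf: "cl (f p) = A (cl (trunc p))" for p
    using rep_Hilb[OF AH[OF cls_in_Hilb[OF trunc_in_V]]] by (auto simp: f_def)
  have add: "f (p + q) \<doteq> f p + f q" for p q
  proof -
    have "cl (f (p + q)) = cl (f p) + cl (f q)"
      using A trunc_in_V by (simp add: clf trunc_add selfadjoint_op_def flip: cls_add)
    then show ?thesis using fV subspace_V by (simp add: cls_add cls_eq_iff vs.subspace_add)
  qed
  have scale: "f (smul c p) \<doteq> smul c (f p)" for c p
  proof -
    have "cl (f (smul c p)) = hscale k \<rho> s c (cl (f p))"
      using A trunc_in_V by (simp add: clf trunc_smul selfadjoint_op_def flip: hscale_cls)
    then show ?thesis using fV subspace_V by (simp add: hscale_cls cls_eq_iff vs.subspace_scale)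
  qed
  obtain T where T: "lin T" "\<And>x. T x \<in> V" "\<And>x. T x \<doteq> f x"
    using linear_lift[of UNIV V f] subspace_V fV add scale by auto
  have clT: "cl (T p) = A (cl (trunc p))" for p
    using T fV by (simp add: cls_eq_iff flip: clf)
  have cl_trunc: "cl (trunc p) = cl p" if "p \<in> V" for p
    using that trunc_in_V trunc_eqv by (simp add: cls_eq_iff)
  have "ip (T x) y = ip x (T y)" for x y
  proof -
    have "ip (T x) y = ip (T x) (trunc y)" by (intro eqv_ip eqv_refl eqv_sym[OF trunc_eqv])
    also have "\<dots> = hinner k \<rho> s (A (cl (trunc x))) (cl (trunc y))"
      using T trunc_in_V by (simp add: hinner_cls flip: clT)
    also have "\<dots> = hinner k \<rho> s (cl (trunc x)) (A (cl (trunc y)))"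
      using A trunc_in_V by (simp add: selfadjoint_op_def)
    also have "\<dots> = ip (trunc x) (T y)"
      using T trunc_in_V by (simp add: hinner_cls flip: clT)
    also have "\<dots> = ip x (T y)" by (intro eqv_ip eqv_refl trunc_eqv)
    finally show ?thesis .
  qed
  then show ?thesis using T clT cl_trunc by (intro that[of T]) auto
qed

definition hop :: "('n mpol \<Rightarrow> 'n mpol) \<Rightarrow> 'n mpol set \<Rightarrow> 'n mpol set" where
  "hop T x = cl (T (rep x))"

lemma hop_cls:
  assumes "\<And>x. T x \<in> V" "\<And>x y. ip (T x) y = ip x (T y)" "p \<in> V"
  shows "hop T (cl p) = cl (T p)"
  using assms rep_cls[OF assms(3)] by (simp add: hop_def cls_eq_iff eqv_def)

lemma selfadjoint_hop:
  assumes lin: "lin T" and V: "\<And>x. T x \<in> V" and sym: "\<And>x y. ip (T x) y = ip x (T y)"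
  shows "selfadjoint_op k \<rho> s (hop T)"
  unfolding selfadjoint_op_def
proof (intro conjI ballI allI)
  note hop = hop_cls[OF V sym]
  show "hop T x \<in> H" for x by (simp add: hop_def V)
  show "hop T (x + y) = hop T x + hop T y" if "x \<in> H" "y \<in> H" for x y
    using that subspace_V by (auto simp: Hilb_eq hop cls_add vs.subspace_add lin_add[OF lin])
  show "hop T (hscale k \<rho> s c x) = hscale k \<rho> s c (hop T x)" if "x \<in> H" for c x
    using that subspace_V by (auto simp: Hilb_eq hop hscale_cls vs.subspace_scale lin_scale[OF lin])
  show "hinner k \<rho> s (hop T x) y = hinner k \<rho> s x (hop T y)" if "x \<in> H" "y \<in> H" for x y
    using that by (auto simp: Hilb_eq hop hinner_cls V sym)
qed

end

locale consistent_moment_data =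
  fixes k :: "nat \<Rightarrow> nat ^ 'n::finite" and \<rho> :: nat and s :: "nat ^ 'n \<Rightarrow> real"
  assumes inj: "inj_on k {..\<rho>}" and conditions: "moment_conditions k \<rho> s"
begin

sublocale moment_data k \<rho> s
  using inj conditions by unfold_locales (auto simp: moment_conditions_def)

notation eqv (infix "\<doteq>" 50)

text \<open>Multiplication by a variable is therefore compatible with passing to classes.\<close>

lemma mul_var_null: "p \<in> Lin_monomials k (Omega k \<rho> l) \<Longrightarrow> p \<doteq> 0 \<Longrightarrow> mul_var l p \<doteq> 0"
  using conditions kernel_condition_iff by (auto simp: moment_conditions_def)

lemma subspace_Lin_Omega: "vs.subspace (Lin_monomials k (Omega k \<rho> l))"
  by (simp add: Lin_monomials_eq_span finite_Omega)

lemma Lin_Omega_subset_V: "Lin_monomials k (Omega k \<rho> l) \<subseteq> V"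
  by (rule Lin_monomials_mono[OF Omega_subset])

lemma mul_var_in_V:
  assumes "p \<in> Lin_monomials k (Omega k \<rho> l)"
  shows "mul_var l p \<in> V"
proof -
  have "vs.subspace {p. mul_var l p \<in> V}"
    using subspace_V linear_mul_var by (rule vsp.linear_subspace_vimage[unfolded vimage_def, rotated])
  then have "Lin_monomials k (Omega k \<rho> l) \<subseteq> {p. mul_var l p \<in> V}"
    unfolding Lin_monomials_eq_span[OF finite_Omega]
    by (intro vs.span_minimal) (auto simp: mul_var_mono Omega_def simp del: One_nat_def intro!: mono_in_V)
  then show ?thesis using assms by auto
qed

lemma M_op_cls:
  assumes "p \<in> Lin_monomials k (Omega k \<rho> l)"
  shows "M_op k \<rho> s l (cl p) = cl (mul_var l p)"
proof -
  let ?L = "Lin_monomials k (Omega k \<rho> l)"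
  define q where "q = (SOME q. q \<in> ?L \<and> cl q = cl p)"
  have "q \<in> ?L \<and> cl q = cl p" unfolding q_def by (rule someI[of _ p]) (simp add: assms)
  then have q: "q \<in> ?L" "q \<doteq> p" using assms Lin_Omega_subset_V by (auto simp: cls_eq_iff subset_iff)
  then have "mul_var l (q - p) \<doteq> 0"
    using assms subspace_Lin_Omega by (intro mul_var_null) (auto simp: vs.subspace_diff simp flip: eqv_diff_zero_iff)
  then have "mul_var l q \<doteq> mul_var l p"
    by (simp add: lin_diff[OF linear_mul_var] flip: eqv_diff_zero_iff)
  then show ?thesis
    using q assms by (simp add: M_op_def mul_var_def[symmetric] q_def[symmetric] cls_eq_iff mul_var_in_V
        del: One_nat_def)
qed

end

section \<open>Canonical solutions and commuting extensions\<close>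

text \<open>
  Commuting self-adjoint extensions of the operators \<open>M\<^sub>l\<close>, lifted from classes to polynomials.
  Equality of classes is written out as equality of all products.
\<close>

locale extension_tuple = consistent_moment_data k \<rho> s
  for k :: "nat \<Rightarrow> nat ^ 'n::finite" and \<rho> :: nat and s :: "nat ^ 'n \<Rightarrow> real" +
  fixes T :: "'n \<Rightarrow> 'n mpol \<Rightarrow> 'n mpol"
  assumes lin_T: "Vector_Spaces.linear smul smul (T l)"
    and T_in_V: "T l x \<in> Lin_monomials k {..\<rho>}"
    and T_symmetric: "form k \<rho> s (T l x) y = form k \<rho> s x (T l y)"
    and T_commute: "form k \<rho> s (T i (T j x)) y = form k \<rho> s (T j (T i x)) y"
    and T_extends: "p \<in> Lin_monomials k (Omega k \<rho> l) \<Longrightarrow> form k \<rho> s (T l p) y = form k \<rho> s (mul_var l p) y"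
begin

sublocale commuting_tuple smul ip T "mono_at ` K"
proof unfold_locales
  show "\<exists>y\<in>vs.span (mono_at ` K). x \<doteq> y" for x
    unfolding V_eq_span[symmetric] by (rule bexI[of _ "trunc x"]) (auto intro: trunc_in_V eqv_sym[OF trunc_eqv])
  show "T l x \<in> vs.span (mono_at ` K)" for l x using T_in_V by (simp add: V_eq_span)
  show "T i (T j x) \<doteq> T j (T i x)" for i j x by (simp only: eqv_def T_commute simp_thms)
qed (simp_all add: lin_add[OF lin_T] lin_scale[OF lin_T] T_symmetric)

lemma T_mono:
  assumes "u \<in> K" "u + axis l 1 \<in> K"
  shows "T l (mono_at u) \<doteq> mono_at (u + axis l 1)"
proof -
  obtain j where j: "j \<in> Omega k \<rho> l" "u = k j" using assms by (auto simp: Omega_def)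
  have "mono_at u \<in> Lin_monomials k (Omega k \<rho> l)"
    using j by (auto simp: Lin_monomials_eq_span finite_Omega intro!: vs.span_base)
  then show ?thesis unfolding mul_var_mono[symmetric] eqv_def by (auto simp: T_extends)
qed

end

context moment_data
begin

lemma eqv_via_trunc:
  assumes "\<And>x y. ip (f x) y = ip x (f y)" "\<And>x y. ip (g x) y = ip x (g y)"
    "\<And>p. p \<in> V \<Longrightarrow> f p \<doteq> g p"
  shows "f x \<doteq> g x"
proof -
  have "f x \<doteq> f (trunc x)"
    unfolding eqv_def assms(1) using eqv_ip[OF trunc_eqv eqv_refl] by simp
  also have "\<dots> \<doteq> g (trunc x)" by (intro assms(3) trunc_in_V)
  also have "\<dots> \<doteq> g x"
    unfolding eqv_def assms(2) using eqv_ip[OF trunc_eqv eqv_refl] by simp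
  finally show ?thesis .
qed

lemma mono_zero: "mono_at 0 = 1"
  by (simp add: mono_at_def)

end

context consistent_moment_data
begin

text \<open>
  The operators and the projections on classes lift to polynomials.  The measure is finite because its
  zeroth moment exists, so it is determined by the values of \<^const>\<open>measure\<close>.
\<close>

lemma canonical_solution_imp_spectral_tuple:
  assumes "0 \<in> K" and can: "canonical_solution k \<rho> s \<mu>"
  obtains T e where "extension_tuple k \<rho> s T" "spectral_tuple smul ip e T" "\<mu> = scal_measure ip e 1"
proof -
  obtain A E where A: "\<And>l. selfadjoint_op k \<rho> s (A l)"
    and comm: "\<And>i j x. x \<in> H \<Longrightarrow> A i (A j x) = A j (A i x)"
    and ext: "\<And>l x. x \<in> Hilb_Lin k \<rho> s (Omega k \<rho> l) \<Longrightarrow> A l x = M_op k \<rho> s l x"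
    and joint: "joint_spectral_measure k \<rho> s A E"
    and \<mu>: "\<And>\<delta>. \<delta> \<in> sets borel \<Longrightarrow> of_real (measure \<mu> \<delta>) = hinner k \<rho> s (E \<delta> (cl 1)) (cl 1)"
    and sol: "moment_solution (K + K) s \<mu>"
    using can unfolding canonical_solution_def by blast
  have one: "1 \<in> V" using mono_in_V[OF assms(1)] by (simp add: mono_zero)
  have E: "selfadjoint_op k \<rho> s (E \<delta>)" if "\<delta> \<in> sets borel" for \<delta>
    using joint that by (simp add: joint_spectral_measure_def spectral_measure_def)
  have E_UNIV: "E UNIV x = x" if "x \<in> H" for x
    using joint that by (simp add: joint_spectral_measure_def spectral_measure_def)
  have E_Int: "E (\<delta> \<inter> \<delta>') x = E \<delta> (E \<delta>' x)" if "\<delta> \<in> sets borel" "\<delta>' \<in> sets borel" "x \<in> H" for \<delta> \<delta>' x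
    using joint that by (simp add: joint_spectral_measure_def spectral_measure_def)
  have E_sums: "(\<lambda>i. hinner k \<rho> s (E (D i) x) y) sums hinner k \<rho> s (E (\<Union>i. D i) x) y"
    if "range D \<subseteq> sets borel" "disjoint_family D" "x \<in> H" "y \<in> H" for D x y
    using joint that by (simp add: joint_spectral_measure_def spectral_measure_def)
  have quad: "integrable (scalar_measure k \<rho> s E x) (\<lambda>t. (t $ l)\<^sup>2)"
    "hinner k \<rho> s (A l x) x = of_real (\<integral>t. t $ l \<partial>scalar_measure k \<rho> s E x)" if "x \<in> H" for x l
    using joint that by (simp_all add: joint_spectral_measure_def)
  have "\<forall>l. \<exists>T. lin T \<and> (\<forall>x. T x \<in> V) \<and> (\<forall>p\<in>V. cl (T p) = A l (cl p)) \<and> (\<forall>x y. ip (T x) y = ip x (T y))"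
    using operator_lift[OF A] by metis
  then obtain T where T: "\<And>l. lin (T l)" "\<And>l x. T l x \<in> V" "\<And>l p. p \<in> V \<Longrightarrow> cl (T l p) = A l (cl p)"
    "\<And>l x y. ip (T l x) y = ip x (T l y)" by metis
  have "\<forall>\<delta>. \<exists>T. \<delta> \<in> sets borel \<longrightarrow>
      lin T \<and> (\<forall>x. T x \<in> V) \<and> (\<forall>p\<in>V. cl (T p) = E \<delta> (cl p)) \<and> (\<forall>x y. ip (T x) y = ip x (T y))"
    using operator_lift[OF E] by metis
  then obtain e where "\<forall>\<delta>. \<delta> \<in> sets borel \<longrightarrow>
      lin (e \<delta>) \<and> (\<forall>x. e \<delta> x \<in> V) \<and> (\<forall>p\<in>V. cl (e \<delta> p) = E \<delta> (cl p)) \<and>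
      (\<forall>x y. ip (e \<delta> x) y = ip x (e \<delta> y))"
    by (rule choice[THEN exE])
  then have e: "\<And>\<delta>. \<delta> \<in> sets borel \<Longrightarrow> lin (e \<delta>)" "\<And>\<delta> x. \<delta> \<in> sets borel \<Longrightarrow> e \<delta> x \<in> V"
    "\<And>\<delta> p. \<delta> \<in> sets borel \<Longrightarrow> p \<in> V \<Longrightarrow> cl (e \<delta> p) = E \<delta> (cl p)"
    "\<And>\<delta> x y. \<delta> \<in> sets borel \<Longrightarrow> ip (e \<delta> x) y = ip x (e \<delta> y)"
    by blast+
  have ext_T: "extension_tuple k \<rho> s T"
  proof unfold_locales
    show "ip (T i (T j x)) y = ip (T j (T i x)) y" for i j x y
    proof -
      have "ip x (T j (T i y)) = ip (trunc x) (T j (T i y))" for i j x y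
        by (intro eqv_ip eqv_sym[OF trunc_eqv] eqv_refl)
      then have tr: "ip (T i (T j x)) y = ip (T i (T j (trunc x))) y" for i j x y by (simp add: T(4))
      have "T i (T j p) \<doteq> T j (T i p)" if "p \<in> V" for p
      proof -
        have "cl (T i (T j p)) = cl (T j (T i p))" using that T(2,3) comm by simp
        then show ?thesis using T(2) by (simp add: cls_eq_iff)
      qed
      from this[OF trunc_in_V, of x] show ?thesis
        unfolding tr[of i j x] tr[of j i x] by (simp add: eqv_def)
    qed
    show "ip (T l p) y = ip (mul_var l p) y" if "p \<in> Lin_monomials k (Omega k \<rho> l)" for l p y
    proof -
      have "p \<in> V" using that Lin_Omega_subset_V by auto
      then have "cl (T l p) = A l (cl p)" by (rule T(3))
      also have "\<dots> = M_op k \<rho> s l (cl p)" using that by (intro ext) (auto simp: Hilb_Lin_def)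
      also have "\<dots> = cl (mul_var l p)" by (rule M_op_cls[OF that])
      finally show ?thesis using T(2) mul_var_in_V[OF that] by (simp add: cls_eq_iff eqv_def)
    qed
  qed (use T in \<open>auto simp: lin_add lin_scale\<close>)
  have e_cls: "hinner k \<rho> s (E \<delta> (cl (trunc x))) (cl (trunc y)) = ip (e \<delta> x) y"
    if \<delta>: "\<delta> \<in> sets borel" for \<delta> x y
  proof -
    have "hinner k \<rho> s (E \<delta> (cl (trunc x))) (cl (trunc y)) = ip (e \<delta> (trunc x)) (trunc y)"
      using \<delta> trunc_in_V e by (simp add: hinner_cls flip: e(3))
    also have "\<dots> = ip (e \<delta> (trunc x)) y" by (intro eqv_ip eqv_refl trunc_eqv)
    also have "\<dots> = ip (trunc x) (e \<delta> y)" by (rule e(4)[OF \<delta>])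
    also have "\<dots> = ip x (e \<delta> y)" by (intro eqv_ip eqv_refl trunc_eqv)
    finally show ?thesis by (simp add: e(4)[OF \<delta>])
  qed
  have scal: "scal_measure ip e x = scalar_measure k \<rho> s E (cl (trunc x))" for x
    unfolding scal_measure_def scalar_measure_def
  proof (rule measure_of_eq)
    fix \<delta> :: "(real ^ 'n) set" assume "\<delta> \<in> sigma_sets UNIV (sets borel)"
    then have "\<delta> \<in> sets borel" using sets.sigma_sets_eq[of "borel :: (real ^ 'n) measure"] by simp
    then show "ennreal (Re (ip (e \<delta> x) x)) =
        ennreal (Re (hinner k \<rho> s (E \<delta> (cl (trunc x))) (cl (trunc x))))" by (simp add: e_cls)
  qed simp
  have spec_e: "spectral_tuple smul ip e T"
  proof unfold_locales
    show "e UNIV x \<doteq> x" for x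
    proof -
      have "e UNIV p \<doteq> p" if "p \<in> V" for p
      proof -
        have "cl (e UNIV p) = cl p" using that e(3)[of UNIV] E_UNIV by simp
        then show ?thesis using that e(2)[of UNIV] by (simp add: cls_eq_iff)
      qed
      then show ?thesis using eqv_via_trunc[of "e UNIV" "\<lambda>x. x"] e(4)[of UNIV] by simp
    qed
    show "e (\<delta> \<inter> \<delta>') x \<doteq> e \<delta> (e \<delta>' x)" if \<delta>: "\<delta> \<in> sets borel" "\<delta>' \<in> sets borel" for \<delta> \<delta>' x
      unfolding eqv_def
    proof
      fix y
      have "cl (e (\<delta> \<inter> \<delta>') (trunc x)) = cl (e \<delta> (e \<delta>' (trunc x)))"
        using \<delta> trunc_in_V e E_Int by simp
      then have *: "ip (e (\<delta> \<inter> \<delta>') (trunc x)) y = ip (e \<delta> (e \<delta>' (trunc x))) y"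
        using \<delta> e(2) by (simp add: cls_eq_iff eqv_def)
      have "ip (e (\<delta> \<inter> \<delta>') x) y = ip (e (\<delta> \<inter> \<delta>') (trunc x)) y"
        using \<delta> eqv_ip[OF trunc_eqv eqv_refl] by (simp add: e(4))
      also note *
      also have "ip (e \<delta> (e \<delta>' (trunc x))) y = ip (e \<delta> (e \<delta>' x)) y"
        using \<delta> eqv_ip[OF trunc_eqv eqv_refl] by (simp add: e(4))
      finally show "ip (e (\<delta> \<inter> \<delta>') x) y = ip (e \<delta> (e \<delta>' x)) y" .
    qed
    show "(\<lambda>i. ip (e (D i) x) y) sums ip (e (\<Union>i. D i) x) y"
      if D: "range D \<subseteq> sets borel" "disjoint_family D" for D :: "nat \<Rightarrow> (real ^ 'n) set" and x y
    proof -
      have "D i \<in> sets borel" "(\<Union>i. D i) \<in> sets borel" for i using D by auto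
      then show ?thesis
        using E_sums[OF D, of "cl (trunc x)" "cl (trunc y)"] trunc_in_V by (simp add: e_cls)
    qed
    show "integrable (scal_measure ip e x) (\<lambda>t. (t $ l)\<^sup>2)" for x l
      unfolding scal using trunc_in_V by (intro quad) simp
    show "ip (T l x) x = of_real (\<integral>t. t $ l \<partial>scal_measure ip e x)" for l x
    proof -
      have "ip (T l x) x = ip x (T l (trunc x))"
        using eqv_ip[OF eqv_refl trunc_eqv, of "T l x" x] by (simp add: T(4))
      also have "\<dots> = ip (trunc x) (T l (trunc x))" by (intro eqv_ip eqv_refl eqv_sym[OF trunc_eqv])
      also have "\<dots> = hinner k \<rho> s (A l (cl (trunc x))) (cl (trunc x))"
        using trunc_in_V T by (simp add: hinner_cls flip: T(3))
      also have "\<dots> = of_real (\<integral>t. t $ l \<partial>scal_measure ip e x)"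
        unfolding scal using trunc_in_V by (intro quad) simp
      finally show ?thesis .
    qed
  qed (use T e in \<open>auto simp: lin_add lin_scale\<close>)
  then interpret spectral_tuple smul ip e T .
  have "\<mu> = scal_measure ip e 1"
  proof (rule measure_eqI)
    show "sets \<mu> = sets (scal_measure ip e 1)" using sol by (simp add: moment_solution_def)
    fix \<delta> assume "\<delta> \<in> sets \<mu>"
    then have \<delta>: "\<delta> \<in> sets borel" using sol by (simp add: moment_solution_def)
    have "\<forall>k\<in>K + K. has_bochner_integral \<mu> (\<lambda>t. \<Prod>i\<in>UNIV. (t $ i) ^ (k $ i)) (s k)"
      using sol by (simp add: moment_solution_def)
    from bspec[OF this set_plus_intro[OF assms(1) assms(1)]] have "integrable \<mu> (\<lambda>t. 1 :: real)" by (simp add: has_bochner_integral_iff)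
    then interpret finite_measure \<mu>
      by (auto intro!: finite_measureI simp: integrable_iff_bounded)
    have "of_real (measure \<mu> \<delta>) = ip (e \<delta> 1) 1"
      unfolding \<mu>[OF \<delta>] e(3)[OF \<delta> one, symmetric] by (rule hinner_cls[OF e(2)[OF \<delta>] one])
    then have "measure \<mu> \<delta> = Re (ip (e \<delta> 1) 1)" by (metis Re_complex_of_real)
    then show "emeasure \<mu> \<delta> = emeasure (scal_measure ip e 1) \<delta>"
      using \<delta> by (simp add: emeasure_eq_measure emeasure_scal)
  qed
  then show ?thesis by (rule that[OF ext_T spec_e])
qed

end

context extension_tuple
begin

lemma spectral_tuple_imp_canonical_solution:
  assumes "0 \<in> K" and spec: "spectral_tuple smul ip e T"
    and e: "\<And>\<delta>. lin (e \<delta>)" "\<And>\<delta> x. e \<delta> x \<in> V"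
    and sol: "moment_solution (K + K) s (scal_measure ip e 1)"
  shows "canonical_solution k \<rho> s (scal_measure ip e 1)"
proof -
  interpret E: spectral_tuple smul ip e T by fact
  have one: "1 \<in> V" using mono_in_V[OF assms(1)] by (simp add: mono_zero)
  define A where "A l = hop (T l)" for l
  define F where "F \<delta> = hop (e \<delta>)" for \<delta>
  have A: "A l (cl p) = cl (T l p)" if "p \<in> V" for l p
    unfolding A_def by (rule hop_cls[OF T_in_V T_symmetric that])
  have F: "F \<delta> (cl p) = cl (e \<delta> p)" if "\<delta> \<in> sets borel" "p \<in> V" for \<delta> p
    unfolding F_def using that by (intro hop_cls e E.e_symmetric)
  have scal: "scalar_measure k \<rho> s F (cl p) = scal_measure ip e p" if "p \<in> V" for p
    unfolding scal_measure_def scalar_measure_def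
  proof (rule measure_of_eq)
    fix \<delta> :: "(real ^ 'n) set" assume "\<delta> \<in> sigma_sets UNIV (sets borel)"
    then have "\<delta> \<in> sets borel" using sets.sigma_sets_eq[of "borel :: (real ^ 'n) measure"] by simp
    then show "ennreal (Re (hinner k \<rho> s (F \<delta> (cl p)) (cl p))) = ennreal (Re (ip (e \<delta> p) p))"
      using that e by (simp add: F hinner_cls)
  qed simp
  have "spectral_measure k \<rho> s F"
    unfolding spectral_measure_def
  proof (intro conjI ballI allI impI)
    show "selfadjoint_op k \<rho> s (F \<delta>)" if "\<delta> \<in> sets borel" for \<delta>
      unfolding F_def using that by (intro selfadjoint_hop e E.e_symmetric)
    show Int: "F (\<delta> \<inter> \<delta>') x = F \<delta> (F \<delta>' x)" if "\<delta> \<in> sets borel" "\<delta>' \<in> sets borel" "x \<in> H" for \<delta> \<delta>' x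
    proof -
      obtain p where "p \<in> V" "x = cl p" using \<open>x \<in> H\<close> by (auto simp: Hilb_eq)
      then show ?thesis using that e E.e_Int by (simp add: F cls_eq_iff)
    qed
    show "F \<delta> (F \<delta> x) = F \<delta> x" if "\<delta> \<in> sets borel" "x \<in> H" for \<delta> x
      using Int[OF that(1,1,2)] by simp
    show "F UNIV x = x" if "x \<in> H" for x
    proof -
      obtain p where "p \<in> V" "x = cl p" using \<open>x \<in> H\<close> by (auto simp: Hilb_eq)
      then show ?thesis using e E.e_UNIV by (simp add: F cls_eq_iff)
    qed
    show "(\<lambda>i. hinner k \<rho> s (F (D i) x) y) sums hinner k \<rho> s (F (\<Union>i. D i) x) y"
      if D: "range D \<subseteq> sets borel" "disjoint_family D" and xy: "x \<in> H" "y \<in> H" for D x y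
    proof -
      obtain p q where pq: "p \<in> V" "q \<in> V" "x = cl p" "y = cl q" using xy by (auto simp: Hilb_eq)
      have "D i \<in> sets borel" "(\<Union>i. D i) \<in> sets borel" for i using D by auto
      then show ?thesis using E.e_sums[OF D, of p q] pq e by (simp add: F hinner_cls)
    qed
  qed
  then have joint: "joint_spectral_measure k \<rho> s A F"
    unfolding joint_spectral_measure_def
    using E.square_integrable E.quadratic_form T_in_V by (auto simp: Hilb_eq scal A hinner_cls)
  show ?thesis
    unfolding canonical_solution_def
  proof (intro conjI exI[of _ A] exI[of _ F] allI ballI)
    show "moment_solution (K + K) s (scal_measure ip e 1)" by fact
    show "selfadjoint_op k \<rho> s (A l)" for l
      unfolding A_def by (intro selfadjoint_hop lin_T T_in_V T_symmetric)
    show "A i (A j x) = A j (A i x)" if "x \<in> H" for i j x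
    proof -
      obtain p where "p \<in> V" "x = cl p" using \<open>x \<in> H\<close> by (auto simp: Hilb_eq)
      then show ?thesis using T_in_V T_commute by (simp add: A cls_eq_iff eqv_def)
    qed
    show "A l x = M_op k \<rho> s l x" if "x \<in> Hilb_Lin k \<rho> s (Omega k \<rho> l)" for l x
    proof -
      obtain p where p: "p \<in> Lin_monomials k (Omega k \<rho> l)" "x = cl p"
        using \<open>x \<in> Hilb_Lin _ _ _ _\<close> by (auto simp: Hilb_Lin_def)
      moreover have "p \<in> V" using p Lin_Omega_subset_V by auto
      ultimately show ?thesis
        using T_in_V T_extends mul_var_in_V by (simp add: A M_op_cls cls_eq_iff eqv_def)
    qed
    show "joint_spectral_measure k \<rho> s A F" by (rule joint)
    show "of_real (measure (scal_measure ip e 1) \<delta>) = hinner k \<rho> s (F \<delta> (cl 1)) (cl 1)"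
      if "\<delta> \<in> sets borel" for \<delta>
    proof -
      have "hinner k \<rho> s (F \<delta> (cl 1)) (cl 1) = ip (e \<delta> 1) 1" using that one e by (simp add: F hinner_cls)
      also have "\<dots> = of_real (Re (ip (e \<delta> 1) 1))"
        using ip_self_real E.ip_e_self[OF that] by metis
      finally show ?thesis using that by (simp add: E.measure_scal)
    qed
  qed
qed

end

section \<open>Moments on the close extension\<close>

text \<open>The last unit vector of a chain from \<open>0\<close> to \<open>u\<close> inside \<open>K\<close> is removed.\<close>

lemma admissible_predecessor:
  assumes "admissible K" "u \<in> K" "u \<noteq> 0"
  obtains v l where "v \<in> K" "u = v + axis l 1"
proof -
  define d where "d = (\<Sum>i\<in>UNIV. u $ i)"
  obtain a where a: "u = (\<Sum>j = 1..d. axis (a j) 1)" "\<And>q. q \<in> {1..d} \<Longrightarrow> (\<Sum>j = 1..q. axis (a j) 1) \<in> K"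
    using assms unfolding admissible_def d_def by blast
  have "d \<noteq> 0" using a(1) assms(3) by (metis atLeastatMost_empty less_one sum.empty)
  then obtain q where q: "d = Suc q" by (cases d) auto
  have "(\<Sum>j = 1..q. axis (a j) 1) \<in> K"
    using a(2)[of q] q assms(1) by (cases "q = 0") (auto simp: admissible_def)
  moreover have "u = (\<Sum>j = 1..q. axis (a j) 1) + axis (a d) 1" by (simp add: a(1) q)
  ultimately show ?thesis by (rule that)
qed

lemma admissible_induct [consumes 2, case_names zero step]:
  assumes K: "admissible K" "u \<in> K"
    and zero: "P 0"
    and step: "\<And>v l. v \<in> K \<Longrightarrow> v + axis l 1 \<in> K \<Longrightarrow> P v \<Longrightarrow> P (v + axis l 1)"
  shows "P u"
  using K(2)
proof (induction "\<Sum>i\<in>UNIV. u $ i" arbitrary: u rule: less_induct)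
  case less
  show ?case
  proof (cases "u = 0")
    case False
    then obtain v l where v: "v \<in> K" "u = v + axis l 1"
      using admissible_predecessor[OF K(1) less.prems] by blast
    have "(\<Sum>i\<in>UNIV. v $ i) < (\<Sum>i\<in>UNIV. u $ i)"
      by (rule sum_strict_mono_ex1) (auto simp: v(2) axis_def intro!: exI[of _ l])
    then show ?thesis using less v step by blast
  qed (simp add: zero)
qed

lemma Ext_cases:
  assumes "u \<in> Ext K"
  obtains "u \<in> K" | v l where "v \<in> K" "u = v + axis l 1"
  using assms by (auto simp: Ext_def set_plus_def)

lemma mem_ExtI: "u \<in> K \<Longrightarrow> u \<in> Ext K" "u \<in> K \<Longrightarrow> u + axis l 1 \<in> Ext K"
  by (auto simp: Ext_def set_plus_def)

context symmetric_tuple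
begin

text \<open>
  If \<open>s\<close> is a Gram matrix of vectors on which \<open>T l\<close> acts as the shift by \<open>axis l 1\<close>, a
  coefficient vector in the kernel of \<open>\<Gamma>\<^sub>l\<close> is a null combination, and \<open>T l\<close> preserves null vectors.
\<close>

lemma moment_conditions_if_gram:
  assumes shift: "\<And>l u. T l (X u) \<doteq> X (u + axis l 1)"
    and gram: "\<And>u v. u \<in> k ` {..\<rho>} \<Longrightarrow> v \<in> k ` {..\<rho>} \<Longrightarrow> ip (X u) (X v) = of_real (s (u + v))"
  shows "moment_conditions k \<rho> s"
  unfolding moment_conditions_def
proof (intro conjI allI subsetI)
  show "psd_on {..\<rho>} (Gam k s)"
    unfolding psd_on_def
  proof
    fix x :: "nat \<Rightarrow> complex"
    define y where "y = (\<Sum>j\<le>\<rho>. x j \<odot> X (k j))"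
    have "(\<Sum>m\<le>\<rho>. \<Sum>j\<le>\<rho>. cnj (x m) * of_real (Gam k s m j) * x j) = ip y y"
      unfolding y_def ip_sum_left ip_sum_right
      by (auto intro!: sum.cong simp: ip_scale_left ip_scale_right gram Gam_def)
    then show "(\<Sum>m\<le>\<rho>. \<Sum>j\<le>\<rho>. cnj (x m) * of_real (Gam k s m j) * x j) \<in> \<real>\<^sub>\<ge>\<^sub>0"
      using ip_nonneg[of y] ip_self_real[of y] by (simp add: complex_nonneg_Reals_iff complex_eq_iff)
  qed
  fix l x
  let ?J = "Omega k \<rho> l"
  assume x: "x \<in> Ker_on ?J (Gam k s)"
  define y where "y = (\<Sum>j\<in>?J. x j \<odot> X (k j))"
  have J: "k j \<in> k ` {..\<rho>}" "k j + axis l 1 \<in> k ` {..\<rho>}" if "j \<in> ?J" for j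
    using that by (auto simp: Omega_def)
  have "ip y (X (k m)) = 0" if "m \<in> ?J" for m
  proof -
    have "ip y (X (k m)) = (\<Sum>j\<in>?J. of_real (Gam k s m j) * x j)"
      unfolding y_def ip_sum_left using that J
      by (intro sum.cong refl) (simp add: ip_scale_left gram Gam_def)
    then show ?thesis using x that by (simp add: Ker_on_def)
  qed
  then have "ip y y = 0"
    by (subst (2) y_def) (simp add: ip_sum_right ip_scale_right)
  then have "T l y \<doteq> 0"
    using T_eqv[of y 0 l] by (simp add: eqv_zero_iff lin_zero[OF lin_T])
  have "T l y = (\<Sum>j\<in>?J. x j \<odot> T l (X (k j)))"
    by (simp add: y_def lin_sum[OF lin_T] lin_scale[OF lin_T])
  also have "\<dots> \<doteq> (\<Sum>j\<in>?J. x j \<odot> X (k j + axis l 1))"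
    by (intro eqv_sum eqv_scale shift)
  finally have y': "(\<Sum>j\<in>?J. x j \<odot> X (k j + axis l 1)) \<doteq> 0"
    using \<open>T l y \<doteq> 0\<close> eqv_sym eqv_trans by blast
  have "(\<Sum>j\<in>?J. of_real (Gam_hat k s l m j) * x j) = 0" if "m \<in> ?J" for m
  proof -
    have "(\<Sum>j\<in>?J. of_real (Gam_hat k s l m j) * x j) =
        ip (\<Sum>j\<in>?J. x j \<odot> X (k j + axis l 1)) (X (k m + axis l 1))"
      unfolding ip_sum_left using that J
      by (intro sum.cong refl) (simp add: ip_scale_left gram Gam_hat_def)
    then show ?thesis using y' by (simp add: eqv_def)
  qed
  then show "x \<in> Ker_on ?J (Gam_hat k s l)" using x by (simp add: Ker_on_def)
qed

end

definition moments_on :: "(nat ^ 'n::finite) set \<Rightarrow> (real ^ 'n) measure \<Rightarrow> nat ^ 'n \<Rightarrow> real" where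
  "moments_on M \<mu> = restrict (\<lambda>m. \<integral>t. mpower t m \<partial>\<mu>) M"

lemma moment_solution_iff_mpower:
  "moment_solution M s \<mu> \<longleftrightarrow> sets \<mu> = sets borel \<and> (\<forall>m\<in>M. has_bochner_integral \<mu> (\<lambda>t. mpower t m) (s m))"
  by (simp add: moment_solution_def mpower_def)

locale extension_problem = consistent_moment_data k \<rho> s
  for k :: "nat \<Rightarrow> nat ^ 'n::finite" and \<rho> :: nat and s :: "nat ^ 'n \<Rightarrow> real" +
  fixes \<rho>' :: nat
  assumes admissible: "admissible (k ` {..\<rho>})"
    and border: "Ext (k ` {..\<rho>}) - k ` {..\<rho>} \<subseteq> border (Ext (k ` {..\<rho>}))"
    and bij': "bij_betw k {..\<rho>'} (Ext (k ` {..\<rho>}))"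
begin

abbreviation "L \<equiv> Ext K"

lemma image_k': "k ` {..\<rho>'} = L" and inj': "inj_on k {..\<rho>'}"
  using bij' by (auto simp: bij_betw_def)

lemma zero_in_K: "0 \<in> K"
  using admissible by (simp add: admissible_def)

lemma K_subset_L: "K \<subseteq> L"
  by (auto simp: Ext_def)

text \<open>
  Every \<open>K + e\<^sub>l\<close> lies in the extension, and the border hypothesis excludes the new points.
\<close>

lemma Omega0_extension: "Omega0 k \<rho>' = {..\<rho>}"
proof -
  have "card K \<le> card L"
    using image_k' K_subset_L by (intro card_mono) (metis finite_atMost finite_imageI, simp)
  then have le: "\<rho> \<le> \<rho>'"
    using card_image[OF inj_k] card_image[OF inj'] by (simp add: image_k')
  have "j \<in> Omega0 k \<rho>' \<longleftrightarrow> j \<le> \<rho>'  \<and> (\<forall>l. k j + axis l 1 \<in> L)" for j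
    by (simp add: Omega0_def image_k')
  moreover have "j \<le> \<rho>' \<and> (\<forall>l. k j + axis l 1 \<in> L) \<longleftrightarrow> j \<le> \<rho>' \<and> k j \<in> K" for j
  proof -
    have "k j \<in> K" if "j \<le> \<rho>'" "\<forall>l. k j + axis l 1 \<in> L"
    proof (rule ccontr)
      assume "k j \<notin> K"
      moreover have "k j \<in> L" using that image_k' by auto
      ultimately show False using border that by (auto simp: border_def)
    qed
    then show ?thesis using mem_ExtI(2)[of "k j" K] by auto
  qed
  moreover have "j \<le> \<rho>' \<and> k j \<in> K \<longleftrightarrow> j \<le> \<rho>" for j
    using inj_on_image_mem_iff[OF inj', of j "{..\<rho>}"] le by auto
  ultimately show ?thesis by auto
qed

lemma mono_eqv_moment_vector:
  assumes "extension_tuple k \<rho> s T" "X 0 \<doteq> 1" "\<And>u l. T l (X u) \<doteq> X (u + axis l 1)" "u \<in> K"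
  shows "X u \<doteq> mono_at u"
proof -
  interpret extension_tuple k \<rho> s T by fact
  show ?thesis using admissible assms(4)
  proof (induction rule: admissible_induct)
    case zero
    then show ?case using assms(2) by (simp add: mono_zero)
  next
    case (step v l)
    have "X (v + axis l 1) \<doteq> T l (X v)" by (rule eqv_sym[OF assms(3)])
    also have "\<dots> \<doteq> T l (mono_at v)" by (rule T_eqv[OF step(3)])
    also have "\<dots> \<doteq> mono_at (v + axis l 1)" by (rule T_mono[OF step(1,2)])
    finally show ?case .
  qed
qed

lemma moment_vectors_of_extension:
  assumes T: "extension_tuple k \<rho> s T" and e: "spectral_tuple smul ip e T"
  obtains X where "\<And>u. u \<in> K \<Longrightarrow> X u \<doteq> mono_at u" "\<And>u l. T l (X u) \<doteq> X (u + axis l 1)" "\<And>u. X u \<in> V"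
    "\<And>u v. integrable (scal_measure ip e 1) (\<lambda>t. mpower t (u + v))"
    "\<And>u v. ip (X u) (X v) = of_real (\<integral>t. mpower t (u + v) \<partial>scal_measure ip e 1)"
proof -
  interpret extension_tuple k \<rho> s T by fact
  interpret S: spectral_tuple smul ip e T by fact
  interpret commuting_spectral_tuple smul ip e T "mono_at ` K" by unfold_locales
  obtain X where X: "X 0 \<doteq> 1" "\<And>u l. T l (X u) \<doteq> X (u + axis l 1)" "\<And>u. X u \<in> V"
    "\<And>u v. \<exists>r. has_bochner_integral (scal_measure ip e 1) (\<lambda>t. mpower t (u + v)) r \<and> ip (X u) (X v) = of_real r"
    using moment_vectors[of 1] unfolding V_eq_span[symmetric] by metis
  show ?thesis
    using mono_eqv_moment_vector[OF T X(1,2)] X by (intro that[of X]) (auto simp: has_bochner_integral_iff)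
qed

text \<open>
  For dimensional stability, \<open>X u\<close> is itself a polynomial over \<open>K\<close>, and in the extended form it has
  the same products with the monomials over \<open>Ext K\<close> as \<open>t\<^sup>u\<close>.
\<close>

lemma canonical_solution_moments:
  assumes "canonical_solution k \<rho> s \<mu>"
  shows "moments_on (L + L) \<mu> \<in> {s' \<in> extensional (L + L). (\<forall>m\<in>K + K. s' m = s m) \<and>
    moment_conditions k \<rho>' s' \<and> dimensionally_stable k \<rho>' s'}"
proof -
  let ?s = "moments_on (L + L) \<mu>"
  obtain T e where T: "extension_tuple k \<rho> s T" and e: "spectral_tuple smul ip e T"
    and \<mu>: "\<mu> = scal_measure ip e 1"
    using canonical_solution_imp_spectral_tuple[OF zero_in_K assms] by metis
  interpret extension_tuple k \<rho> s T by (rule T)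
  obtain X where X: "\<And>u. u \<in> K \<Longrightarrow> X u \<doteq> mono_at u" "\<And>u l. T l (X u) \<doteq> X (u + axis l 1)" "\<And>u. X u \<in> V"
    "\<And>u v. ip (X u) (X v) = of_real (\<integral>t. mpower t (u + v) \<partial>\<mu>)"
    using moment_vectors_of_extension[OF T e] unfolding \<mu> by metis
  have gram: "ip (X u) (X v) = of_real (?s (u + v))" if "u \<in> L" "v \<in> L" for u v
    using that by (simp add: X(4) moments_on_def set_plus_intro)
  have "?s m = s m" if "m \<in> K + K" for m
  proof -
    obtain u v where uv: "u \<in> K" "v \<in> K" "m = u + v"
      using \<open>m \<in> K + K\<close> by (auto simp: set_plus_def)
    then have "of_real (?s m) = ip (X u) (X v)"
      using gram[of u v] subsetD[OF K_subset_L] by simp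
    also have "\<dots> = ip (mono_at u) (mono_at v)" using uv by (intro eqv_ip X)
    also have "\<dots> = of_real (s m)" using uv by (simp add: ip_mono)
    finally show ?thesis by (simp only: of_real_eq_iff)
  qed
  moreover have cond: "moment_conditions k \<rho>' ?s"
    using X(2) gram by (intro moment_conditions_if_gram) (auto simp: image_k')
  moreover have "dimensionally_stable k \<rho>' ?s"
  proof -
    interpret M: moment_data k \<rho>' ?s
      using inj' cond by unfold_locales (auto simp: moment_conditions_def)
    have "M.eqv (mono_at u) (X u)" if u: "u \<in> L" for u
    proof (rule M.eqv_if_moments_eq)
      fix v assume "v \<in> k ` {..\<rho>'}"
      then have v: "v \<in> L" by (simp add: image_k')
      have "vs.subspace {p. M.ip p (mono_at v) = ip p (X v)}"
        by (auto simp: vs.subspace_def M.ip_add_left M.ip_scale_left ip_add_left ip_scale_left)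
      moreover have "M.ip (mono_at w) (mono_at v) = ip (mono_at w) (X v)" if "w \<in> K" for w
      proof -
        have "M.ip (mono_at w) (mono_at v) = of_real (?s (w + v))"
          using that v K_subset_L by (intro M.ip_mono) (auto simp: image_k')
        also have "\<dots> = ip (X w) (X v)" using that v K_subset_L by (subst gram) auto
        also have "\<dots> = ip (mono_at w) (X v)" using that by (intro eqv_ip X eqv_refl)
        finally show ?thesis .
      qed
      ultimately have "V \<subseteq> {p. M.ip p (mono_at v) = ip p (X v)}"
        unfolding V_eq_span by (intro vs.span_minimal) auto
      then have "M.ip (X u) (mono_at v) = ip (X u) (X v)" using X(3) by auto
      then show "M.ip (mono_at u) (mono_at v) = M.ip (X u) (mono_at v)"
        using u v by (simp add: gram M.ip_mono image_k')
    qed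
    then have mono: "mono_at ` L \<subseteq> {p. \<exists>q\<in>V. M.eqv p q}" using X(3) by blast
    have "vs.subspace {p. \<exists>q\<in>V. M.eqv p q}"
      unfolding vs.subspace_def
    proof (intro conjI ballI allI)
      show "0 \<in> {p. \<exists>q\<in>V. M.eqv p q}" using subspace_V vs.subspace_0 M.eqv_refl by blast
      show "x + y \<in> {p. \<exists>q\<in>V. M.eqv p q}"
        if "x \<in> {p. \<exists>q\<in>V. M.eqv p q}" "y \<in> {p. \<exists>q\<in>V. M.eqv p q}" for x y
        using that subspace_V by (blast intro: M.eqv_add vs.subspace_add)
      show "smul c x \<in> {p. \<exists>q\<in>V. M.eqv p q}" if "x \<in> {p. \<exists>q\<in>V. M.eqv p q}" for c x
        using that subspace_V by (blast intro: M.eqv_scale vs.subspace_scale)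
    qed
    then have "M.V \<subseteq> {p. \<exists>q\<in>V. M.eqv p q}"
      unfolding M.V_eq_span image_k' using mono by (rule vs.span_minimal[rotated])
    then show ?thesis by (auto simp: M.dimensionally_stable_iff Omega0_extension)
  qed
  ultimately show ?thesis by (simp add: moments_on_def)
qed

text \<open>The moments at \<open>u + e\<^sub>l + v\<close> with \<open>u, v \<in> K\<close> are the matrix entries of \<open>T l\<close>.\<close>

lemma canonical_solution_unique:
  assumes "canonical_solution k \<rho> s \<mu>" "canonical_solution k \<rho> s \<nu>"
    and eq: "moments_on (L + L) \<mu> = moments_on (L + L) \<nu>"
  shows "\<mu> = \<nu>"
proof -
  have ip_T: "ip (T l (mono_at u)) (mono_at v) = of_real (moments_on (L + L) \<mu> (u + axis l 1 + v))"
    if T: "extension_tuple k \<rho> s T" and e: "spectral_tuple smul ip e T" and \<mu>: "\<mu> = scal_measure ip e 1"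
      and uv: "u \<in> K" "v \<in> K" for \<mu> T e l u v
  proof -
    interpret extension_tuple k \<rho> s T by (rule T)
    obtain X where X: "\<And>u. u \<in> K \<Longrightarrow> X u \<doteq> mono_at u" "\<And>u l. T l (X u) \<doteq> X (u + axis l 1)"
      "\<And>u v. ip (X u) (X v) = of_real (\<integral>t. mpower t (u + v) \<partial>\<mu>)"
      using moment_vectors_of_extension[OF T e] unfolding \<mu> by metis
    have "ip (T l (mono_at u)) (mono_at v) = ip (T l (X u)) (X v)"
      using uv by (intro eqv_ip T_eqv eqv_sym[OF X(1)])
    also have "\<dots> = ip (X (u + axis l 1)) (X v)" by (intro eqv_ip X eqv_refl)
    finally show ?thesis
      using set_plus_intro[OF mem_ExtI(2)[OF uv(1), of l] mem_ExtI(1)[OF uv(2)]]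
      by (simp add: X(3) moments_on_def del: One_nat_def)
  qed
  obtain T e where T: "extension_tuple k \<rho> s T" "spectral_tuple smul ip e T" "\<mu> = scal_measure ip e 1"
    using canonical_solution_imp_spectral_tuple[OF zero_in_K assms(1)] by metis
  obtain T' e' where T': "extension_tuple k \<rho> s T'" "spectral_tuple smul ip e' T'" "\<nu> = scal_measure ip e' 1"
    using canonical_solution_imp_spectral_tuple[OF zero_in_K assms(2)] by metis
  interpret extension_tuple k \<rho> s T by (rule T)
  interpret T': extension_tuple k \<rho> s T' by (rule T')
  have mono: "T l (mono_at u) \<doteq> T' l (mono_at u)" if "u \<in> K" for l u
    using ip_T[OF T that] ip_T[OF T' that] eq by (intro eqv_if_moments_eq) simp
  have "T l p \<doteq> T' l p" if "p \<in> V" for l p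
    by (rule linear_eqv_on_V[OF lin_T T'.lin_T mono that])
  then have "T l p \<doteq> T' l p" for l p
    by (rule eqv_via_trunc[OF T_symmetric T'.T_symmetric])
  then have "ip (T l p) q = ip (T' l p) q" for l p q by (simp add: eqv_def)
  then show ?thesis
    unfolding T(3) T'(3) by (rule scal_measure_unique[OF commuting_tuple_axioms T(2) T'(2)])
qed

text \<open>
  On polynomials over \<open>K\<close> the extended form restricts to the given one, so by dimensional stability
  the two spaces coincide, and multiplication by \<open>t\<^sub>l\<close>, which leads from \<open>K\<close> to \<open>Ext K\<close>, becomes an operator on \<open>H\<close>.  Shifting both
  arguments by unit vectors stays within \<open>Ext K + Ext K\<close>; there the value depends only on the sum of
  all exponents, which gives symmetry and commutativity.
\<close>

lemma canonical_solution_exists: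
  assumes s': "s' \<in> extensional (L + L)" and agree: "\<And>m. m \<in> K + K \<Longrightarrow> s' m = s m"
    and cond: "moment_conditions k \<rho>' s'" and stable: "dimensionally_stable k \<rho>' s'"
  shows "\<exists>\<mu>. canonical_solution k \<rho> s \<mu> \<and> moments_on (L + L) \<mu> = s'"
proof -
  interpret M: consistent_moment_data k \<rho>' s'
    using inj' cond by unfold_locales
  note ip_mono' = M.ip_mono[unfolded image_k']
  have in_L: "u \<in> L" "u + axis l 1 \<in> L" if "u \<in> K" for u l using mem_ExtI[OF that] by auto
  have sesq: "M.ip (F p) (G q) = ip' (F' p) (G' q)"
    if "semidefinite_form smul ip'" "lin F" "lin F'" "lin G" "lin G'" "p \<in> V" "q \<in> V"
      and mono: "\<And>u v. u \<in> K \<Longrightarrow> v \<in> K \<Longrightarrow>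
        M.ip (F (mono_at u)) (G (mono_at v)) = ip' (F' (mono_at u)) (G' (mono_at v))"
    for ip' F G F' G' p q
  proof (rule sesquilinear_eq_on_span[OF M.semidefinite_form_axioms that(1-5), where A = "mono_at ` K"])
    show "M.ip (F u) (G v) = ip' (F' u) (G' v)" if "u \<in> mono_at ` K" "v \<in> mono_at ` K" for u v
      using that mono by blast
  qed (use that(6,7) in \<open>simp_all flip: V_eq_span\<close>)
  have ip_V: "M.ip p q = ip p q" if "p \<in> V" "q \<in> V" for p q
  proof (rule sesq[of ip id id id id, unfolded id_apply, OF semidefinite_form_axioms _ _ _ _ that])
    show "M.ip (mono_at u) (mono_at v) = ip (mono_at u) (mono_at v)" if "u \<in> K" "v \<in> K" for u v
      using that by (simp add: ip_mono ip_mono' in_L agree set_plus_intro)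
  qed (rule vs.linear_ident)+
  have eqv_V: "M.eqv p q \<longleftrightarrow> p \<doteq> q" if "p \<in> V" "q \<in> V" for p q
    using that vs.subspace_diff[OF subspace_V that] by (simp add: eqv_iff M.eqv_iff ip_V)
  have shift_commute: "M.ip (mul_var i p) (mul_var j q) = M.ip (mul_var j p) (mul_var i q)"
    if "p \<in> V" "q \<in> V" for i j p q
  proof (rule sesq[OF M.semidefinite_form_axioms linear_mul_var linear_mul_var linear_mul_var linear_mul_var that])
    show "M.ip (mul_var i (mono_at u)) (mul_var j (mono_at v)) =
        M.ip (mul_var j (mono_at u)) (mul_var i (mono_at v))" if "u \<in> K" "v \<in> K" for u v
      using in_L[OF that(1)] in_L[OF that(2)] by (simp add: mul_var_mono ip_mono' add_ac del: One_nat_def)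
  qed
  have shift_symmetric: "M.ip (mul_var i p) q = M.ip p (mul_var i q)" if "p \<in> V" "q \<in> V" for i p q
  proof (rule sesq[of M.ip "mul_var i" id id "mul_var i", unfolded id_apply,
        OF M.semidefinite_form_axioms linear_mul_var _ _ linear_mul_var that])
    show "M.ip (mul_var i (mono_at u)) (mono_at v) = M.ip (mono_at u) (mul_var i (mono_at v))"
      if "u \<in> K" "v \<in> K" for u v
      using in_L[OF that(1)] in_L[OF that(2)] by (simp add: mul_var_mono ip_mono' add_ac del: One_nat_def)
  qed (rule vs.linear_ident)+
  have mul_var_V: "mul_var l p \<in> M.V" if "p \<in> V" for l p
  proof -
    have "vs.subspace {p. mul_var l p \<in> M.V}"
      using M.subspace_V linear_mul_var by (rule vsp.linear_subspace_vimage[unfolded vimage_def, rotated])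
    then have "V \<subseteq> {p. mul_var l p \<in> M.V}"
      unfolding V_eq_span using in_L
      by (intro vs.span_minimal) (auto simp: mul_var_mono image_k' simp del: One_nat_def intro!: M.mono_in_V)
    then show ?thesis using that by auto
  qed
  define f where "f l p = (SOME q. q \<in> V \<and> M.eqv (mul_var l (trunc p)) q)" for l p
  have f: "f l p \<in> V \<and> M.eqv (mul_var l (trunc p)) (f l p)" for l p
  proof -
    have "\<exists>q\<in>V. M.eqv (mul_var l (trunc p)) q"
      using stable mul_var_V[OF trunc_in_V, of l p]
      unfolding M.dimensionally_stable_iff Omega0_extension by (rule bspec)
    then show ?thesis unfolding f_def Bex_def by (rule someI_ex)
  qed
  have "\<exists>g. lin g \<and> (\<forall>x. g x \<in> V \<and> g x \<doteq> f l x)" for l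
  proof -
    have add: "f l (x + y) \<doteq> f l x + f l y" for x y
    proof -
      have "M.eqv (f l (x + y)) (mul_var l (trunc (x + y)))" using f M.eqv_sym by blast
      also have "mul_var l (trunc (x + y)) = mul_var l (trunc x) + mul_var l (trunc y)"
        by (simp add: trunc_add lin_add[OF linear_mul_var])
      also have "M.eqv \<dots> (f l x + f l y)" using f by (intro M.eqv_add) auto
      finally show ?thesis using f subspace_V by (simp add: eqv_V vs.subspace_add)
    qed
    have scale: "f l (smul c x) \<doteq> smul c (f l x)" for c x
    proof -
      have "M.eqv (f l (smul c x)) (mul_var l (trunc (smul c x)))" using f M.eqv_sym by blast
      also have "mul_var l (trunc (smul c x)) = smul c (mul_var l (trunc x))"
        by (simp add: trunc_smul lin_scale[OF linear_mul_var])
      also have "M.eqv \<dots> (smul c (f l x))" using f by (intro M.eqv_scale) auto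
      finally show ?thesis using f subspace_V by (simp add: eqv_V vs.subspace_scale)
    qed
    show ?thesis
    proof (rule linear_lift[of UNIV V "f l"])
      fix g assume "lin g" "\<And>x. g x \<in> V" "\<And>x. x \<in> UNIV \<Longrightarrow> g x \<doteq> f l x"
      then show "\<exists>g. lin g \<and> (\<forall>x. g x \<in> V \<and> g x \<doteq> f l x)" by (intro exI[of _ g]) simp
    next
      show "f l x \<in> V" for x using f by blast
    qed (rule vs.subspace_UNIV subspace_V add scale)+
  qed
  then obtain T where T: "\<And>l. lin (T l)" "\<And>l x. T l x \<in> V" "\<And>l x. T l x \<doteq> f l x" by metis
  have T_mul: "M.eqv (T l x) (mul_var l (trunc x))" for l x
    using T(2,3)[of l x] f[of l x] M.eqv_trans M.eqv_sym by (metis eqv_V)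
  have ip_TT: "ip (T i x) (T j y) = M.ip (mul_var i (trunc x)) (mul_var j (trunc y))" for i j x y
    using T(2) M.eqv_ip[OF T_mul T_mul] by (simp flip: ip_V)
  have ip_T: "ip (T l x) y = M.ip (mul_var l (trunc x)) (trunc y)" for l x y
  proof -
    have "ip (T l x) y = ip (T l x) (trunc y)" by (intro eqv_ip eqv_refl eqv_sym[OF trunc_eqv])
    also have "\<dots> = M.ip (T l x) (trunc y)" using T(2) trunc_in_V by (simp add: ip_V)
    also have "\<dots> = M.ip (mul_var l (trunc x)) (trunc y)" by (intro M.eqv_ip T_mul M.eqv_refl)
    finally show ?thesis .
  qed
  have sym: "ip (T l x) y = ip x (T l y)" for l x y
  proof -
    have "ip x (T l y) = cnj (ip (T l y) x)" by (rule ip_commute)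
    also have "\<dots> = M.ip (trunc x) (mul_var l (trunc y))"
      unfolding ip_T by (rule M.ip_commute[symmetric])
    finally show ?thesis using trunc_in_V by (simp add: ip_T shift_symmetric)
  qed
  have ext: "extension_tuple k \<rho> s T"
  proof (intro extension_tuple.intro extension_tuple_axioms.intro)
    show "consistent_moment_data k \<rho> s" by unfold_locales
    show "ip (T i (T j x)) y = ip (T j (T i x)) y" for i j x y
      unfolding sym[of i "T j x"] sym[of j "T i x"] ip_TT by (intro shift_commute trunc_in_V)
    show "ip (T l p) y = ip (mul_var l p) y" if p: "p \<in> Lin_monomials k (Omega k \<rho> l)" for l p y
    proof -
      have pV: "p \<in> V" using p Lin_Omega_subset_V by auto
      then have "ip (T l p) y = M.ip p (mul_var l (trunc y))"
        using trunc_in_V by (simp add: ip_T trunc_id shift_symmetric)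
      also have "\<dots> = ip (mul_var l p) (trunc y)"
        using pV trunc_in_V mul_var_in_V[OF p] by (simp add: ip_V flip: shift_symmetric)
      also have "\<dots> = ip (mul_var l p) y" by (intro eqv_ip eqv_refl trunc_eqv)
      finally show ?thesis .
    qed
  qed (use T sym in auto)
  interpret extension_tuple k \<rho> s T by (rule ext)
  obtain e where e: "spectral_tuple smul ip e T" "\<And>\<delta>. lin (e \<delta>)" "\<And>\<delta> x. e \<delta> x \<in> V"
    using exists_spectral_tuple unfolding V_eq_span[symmetric] by metis
  interpret S: spectral_tuple smul ip e T by (rule e)
  define \<mu> where "\<mu> = scal_measure ip e 1"
  obtain X where X: "\<And>u. u \<in> K \<Longrightarrow> X u \<doteq> mono_at u" "\<And>u l. T l (X u) \<doteq> X (u + axis l 1)" "\<And>u. X u \<in> V"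
    "\<And>u v. integrable \<mu> (\<lambda>t. mpower t (u + v))"
    "\<And>u v. ip (X u) (X v) = of_real (\<integral>t. mpower t (u + v) \<partial>\<mu>)"
    using moment_vectors_of_extension[OF ext e(1)] unfolding \<mu>_def by metis
  have X_mono: "M.eqv (X u) (mono_at u)" if "u \<in> L" for u
    using that
  proof (cases rule: Ext_cases)
    case 1
    then show ?thesis using X(1,3) by (simp add: eqv_V mono_in_V)
  next
    case (2 v l)
    have "X u \<doteq> T l (mono_at v)"
      unfolding 2 using X(1,2) T_eqv 2 by (meson eqv_sym eqv_trans)
    then have "M.eqv (X u) (T l (mono_at v))" using X(3) T(2) by (simp add: eqv_V)
    also have "M.eqv \<dots> (mul_var l (trunc (mono_at v)))" by (rule T_mul)
    also have "trunc (mono_at v) = mono_at v" using 2 by (intro trunc_id mono_in_V)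
    finally show ?thesis by (simp only: mul_var_mono 2)
  qed
  have moments: "(\<integral>t. mpower t (u + v) \<partial>\<mu>) = s' (u + v)" if "u \<in> L" "v \<in> L" for u v
  proof -
    have "of_real (\<integral>t. mpower t (u + v) \<partial>\<mu>) = M.ip (X u) (X v)" using X by (simp add: ip_V)
    also have "\<dots> = M.ip (mono_at u) (mono_at v)" by (intro M.eqv_ip X_mono that)
    also have "\<dots> = of_real (s' (u + v))" using that by (rule ip_mono')
    finally show ?thesis by (simp only: of_real_eq_iff)
  qed
  have "moment_solution (K + K) s \<mu>"
    unfolding moment_solution_iff_mpower
  proof (intro conjI ballI)
    show "sets \<mu> = sets borel" by (simp add: \<mu>_def)
    fix m assume m: "m \<in> K + K"
    then obtain u v where uv: "u \<in> K" "v \<in> K" "m = u + v" by (auto simp: set_plus_def)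
    then show "has_bochner_integral \<mu> (\<lambda>t. mpower t m) (s m)"
      using X(4) moments[of u v] in_L agree[OF m] by (simp add: has_bochner_integral_iff)
  qed
  then have "canonical_solution k \<rho> s \<mu>"
    unfolding \<mu>_def using e zero_in_K by (intro spectral_tuple_imp_canonical_solution)
  moreover have "moments_on (L + L) \<mu> = s'"
  proof
    fix m show "moments_on (L + L) \<mu> m = s' m"
    proof (cases "m \<in> L + L")
      case True
      then obtain u v where "u \<in> L" "v \<in> L" "m = u + v" by (auto simp: set_plus_def)
      then show ?thesis using moments True by (simp add: moments_on_def)
    next
      case False
      then show ?thesis using s' by (simp add: moments_on_def extensional_def)
    qed
  qed
  ultimately show ?thesis by blast
qed

end

theorem theorem2:
  fixes K :: "(nat ^ 'n::finite) set"
    and k :: "nat \<Rightarrow> nat ^ 'n"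
    and \<rho> \<rho>' :: nat
    and s :: "nat ^ 'n \<Rightarrow> real"
  assumes "admissible K"
    and "Ext K - K \<subseteq> border (Ext K)"
    and "bij_betw k {..\<rho>} K"
    and "moment_conditions k \<rho> s"
    and "bij_betw k {..\<rho>'} (Ext K)"
  shows "\<exists>F. bij_betw F
    {\<mu> :: (real ^ 'n) measure. canonical_solution k \<rho> s \<mu>}
    {s' \<in> extensional (Ext K + Ext K).
       (\<forall>m \<in> K + K. s' m = s m) \<and>
       moment_conditions k \<rho>' s' \<and> dimensionally_stable k \<rho>' s'}"
proof -
  have K: "k ` {..\<rho>} = K" "inj_on k {..\<rho>}" using assms(3) by (auto simp: bij_betw_def)
  interpret extension_problem k \<rho> s \<rho>'
    using assms K by unfold_locales auto
  show ?thesis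
    unfolding bij_betw_def
  proof (intro exI[of _ "moments_on (Ext K + Ext K)"] conjI)
    show "inj_on (moments_on (Ext K + Ext K)) {\<mu>. canonical_solution k \<rho> s \<mu>}"
      using canonical_solution_unique unfolding K(1) by (auto intro!: inj_onI)
    show "moments_on (Ext K + Ext K) ` {\<mu>. canonical_solution k \<rho> s \<mu>} =
        {s' \<in> extensional (Ext K + Ext K). (\<forall>m \<in> K + K. s' m = s m) \<and>
          moment_conditions k \<rho>' s' \<and> dimensionally_stable k \<rho>' s'}"
    proof (intro equalityI subsetI)
      fix s' assume "s' \<in> moments_on (Ext K + Ext K) ` {\<mu>. canonical_solution k \<rho> s \<mu>}"
      then show "s' \<in> {s' \<in> extensional (Ext K + Ext K). (\<forall>m \<in> K + K. s' m = s m) \<and>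
          moment_conditions k \<rho>' s' \<and> dimensionally_stable k \<rho>' s'}"
        using canonical_solution_moments unfolding K(1) by blast
    next
      fix s' assume "s' \<in> {s' \<in> extensional (Ext K + Ext K). (\<forall>m \<in> K + K. s' m = s m) \<and>
          moment_conditions k \<rho>' s' \<and> dimensionally_stable k \<rho>' s'}"
      then obtain \<mu> where "canonical_solution k \<rho> s \<mu>" "moments_on (Ext K + Ext K) \<mu> = s'"
        using canonical_solution_exists[of s'] unfolding K(1) by blast
      then show "s' \<in> moments_on (Ext K + Ext K) ` {\<mu>. canonical_solution k \<rho> s \<mu>}" by blast
    qed
  qed
qed

end
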